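(* Assume (A1) (see context). Let $n\ge 0$ and $N\geq 1$, and set $$c_1(\rho):=\rho^2-1,\qquad c_2(\rho):=2c_1(\rho)\,\bigl(2c_1(\rho)(c_1(\rho)+1)+1\bigr).$$ Then for any measurable $f:S_n\to\mathbb{R}^+$ such that $\eta_n(f)<\infty$, and for any $N\geq c_2(\rho_n)\,n$, $$\left(1-c_1(\rho_n)\frac{n}{N}\right)\eta_n(f)\ \leq\ \mathbb{E}\left(m(\xi_n)(f)\right)=\mathbb{E}\left(m(\xi'_n)\mathbb{H}_{n,m(\xi')}(f)\right)\ \leq\ \left(1+c_2(\rho_n)\frac{n}{N}\right)\eta_n(f).$$ In particular, for any $f\in \mathbb{L}_1(\eta_n)$ and any $N\geq c_2(\rho_n)\,n$, $$\left|\mathbb{E}\left(m(\xi_n)(f)\right)-\eta_n(f)\right|=\left|\mathbb{E}\left(m(\xi'_n)\mathbb{H}_{n,m(\xi')}(f)\right)-\eta_n(f)\right|\leq c_2(\rho_n)\,\frac{n}{N}\,\eta_n(|f|).$$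
   Context: **Notation.** For a measure $\mu$, an integral operator $Q$ and a function $f$: $\mu(f)=\int\mu(dx)f(x)$, $Q(f)(x)=\int Q(x,dy)f(y)$, $(\mu Q)(f)=\mu(Q(f))$; products of operators are compositions. **Feynman-Kac model on path space.** Let $(S'_n)_{n\ge0}$ be measurable spaces, $X'_n$ a Markov chain with $X'_n\in S'_n$, initial distribution $\eta_0$ on $S_0=S'_0$ and Markov transitions $M'_n$ from $S'_{n-1}$ into $S'_n$, and $G'_n:S'_n\to(0,\infty)$ bounded measurable functions. Let $S_n:=S'_0\times\dots\times S'_n$, let $X_n:=(X'_0,\dots,X'_n)\in S_n$ be the historical process, with Markov transitions $M_n$ from $S_{n-1}$ into $S_n$, and $G_n(x'_0,\dots,x'_n):=G'_n(x'_n)$. Define $$\gamma_n(f)=\mathbb{E}\Bigl(f(X_n)\prod_{0\le p<n}G_p(X_p)\Bigr),\qquad \eta_n(f)=\gamma_n(f)/\gamma_n(1),$$ $Q_{n+1}(x,dy)=G_n(x)M_{n+1}(x,dy)$, and $Q_{p,n}=Q_{p+1}\cdots Q_n$ for $p<n$, $Q_{n,n}=Id$. **(A1)** For any $n\ge 0$ there exists $\rho_n<\infty$ such that for all $0\le p\le q\le n$ and all $x_p,y_p\in S_p$, $Q_{p,q}(1)(x_p)\le\rho_n\,Q_{p,q}(1)(y_p)$. The $\rho_n$ in the claim is this constant. **Particle model.** Let $\Psi_{G}(\eta)(dx)=G(x)\eta(dx)/\eta(G)$ and $\Phi_{n+1}(\eta)=\Psi_{G_n}(\eta)M_{n+1}$.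 The particle model is the Markov chain $\xi_n=(\xi_n^i)_{1\le i\le N}\in S_n^N$ such that $\xi_0^1,\dots,\xi_0^N$ are i.i.d. with law $\eta_0$ and, given $\xi_0,\dots,\xi_n$, the $\xi_{n+1}^i$, $1\le i\le N$, are i.i.d. with law $\Phi_{n+1}(m(\xi_n))$, where $m(\xi_n):=\frac1N\sum_{i=1}^N\delta_{\xi^i_n}$. Write $\xi^i_n=(\xi^i_{0,n},\dots,\xi^i_{n,n})$ (the ancestral line of particle $i$) and $\xi'_n:=(\xi^{i}_{n,n})_{1\le i\le N}\in (S'_n)^N$ for the terminal states, $m(\xi'_n)=\frac1N\sum_i\delta_{\xi^i_{n,n}}$. **Backward kernel.** It is assumed that $G'_k(x)M'_{k+1}(x,dy)=H'_{k+1}(x,y)\,\nu'_{k+1}(dy)$ for some density $H'_{k+1}$ and reference measure $\nu'_{k+1}$ on $S'_{k+1}$. The Markov transition $\mathbb{H}_{n,m(\xi')}$ from $S'_n$ into $S_n$ is $$\mathbb{H}_{n,m(\xi')}(x_n,d(y_0,\dots,y_n)):=\delta_{x_n}(dy_n)\prod_{0\le k<n}\frac{m(\xi'_k)(dy_k)\,H'_{k+1}(y_k,y_{k+1})}{m(\xi'_k)\bigl(H'_{k+1}(\cdot,y_{k+1})\bigr)}.$$ *)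

theory Defs
  imports "HOL-Probability.Probability"
begin

text \<open>
  A measure used as a state space contributes only its underlying set and sigma-algebra.
  A path (x_0, ..., x_n) is a function on {..n} in the sense of \<^const>\<open>PiM\<close>
  (undefined outside {..n}), and an N-tuple of particles a function on {1..N}.
\<close>

section \<open>Markov chains and empirical measures\<close>

text \<open>
  X is a Markov chain on the probability space P with X_n in E n, initial law mu and
  K (n+1) the transition from E n to E (n+1) (K 0 is irrelevant): the conditional
  law of X_{n+1} given (X_0, ..., X_n) is K (n+1) (X_n).
\<close>

definition markov_chain ::
  "'w measure \<Rightarrow> (nat \<Rightarrow> 's measure) \<Rightarrow> 's measure \<Rightarrow> (nat \<Rightarrow> 's \<Rightarrow> 's measure)
    \<Rightarrow> (nat \<Rightarrow> 'w \<Rightarrow> 's) \<Rightarrow> bool" where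
  "markov_chain P E \<mu> K X \<longleftrightarrow>
     prob_space P \<and>
     (\<forall>n. X n \<in> measurable P (E n)) \<and>
     distr P (E 0) (X 0) = \<mu> \<and>
     (\<forall>n. \<forall>A \<in> sets (PiM {..n} E). \<forall>B \<in> sets (E (Suc n)).
        emeasure P {\<omega> \<in> space P. (\<lambda>k\<in>{..n}. X k \<omega>) \<in> A \<and> X (Suc n) \<omega> \<in> B}
        = (\<integral>\<^sup>+\<omega>. indicator A (\<lambda>k\<in>{..n}. X k \<omega>) * emeasure (K (Suc n) (X n \<omega>)) B \<partial>P))"

text \<open>(1/N) times the sum of the Dirac masses at x 1, ..., x N, as a measure on A.\<close>

definition empirical :: "nat \<Rightarrow> 's measure \<Rightarrow> (nat \<Rightarrow> 's) \<Rightarrow> 's measure" where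
  "empirical N A x = distr (uniform_count_measure {1..N}) A x"

section \<open>Feynman-Kac model on path space\<close>

text \<open>
  Primed objects live on the individual state spaces S' n, unprimed ones on the path
  spaces S_n = S' 0 x ... x S' n. Objects that lead from time n-1 to time n carry the
  index n and are used for n \<ge> 1 only.
\<close>

definition feynman_kac_model ::
  "(nat \<Rightarrow> 'a measure) \<Rightarrow> 'a measure \<Rightarrow> (nat \<Rightarrow> 'a \<Rightarrow> 'a measure) \<Rightarrow> (nat \<Rightarrow> 'a \<Rightarrow> real) \<Rightarrow> bool" where
  "feynman_kac_model S' \<eta>0 M' G' \<longleftrightarrow>
     \<eta>0 \<in> space (prob_algebra (S' 0)) \<and>
     (\<forall>n. M' (Suc n) \<in> measurable (S' n) (prob_algebra (S' (Suc n)))) \<and>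
     (\<forall>n. G' n \<in> borel_measurable (S' n) \<and>
          (\<forall>x \<in> space (S' n). 0 < G' n x) \<and>
          (\<exists>B. \<forall>x \<in> space (S' n). G' n x \<le> B))"

definition path_space :: "(nat \<Rightarrow> 'a measure) \<Rightarrow> nat \<Rightarrow> (nat \<Rightarrow> 'a) measure" where
  "path_space S' n = PiM {..n} S'"

definition historical :: "(nat \<Rightarrow> 'w \<Rightarrow> 'a) \<Rightarrow> nat \<Rightarrow> 'w \<Rightarrow> (nat \<Rightarrow> 'a)" where
  "historical X' n \<omega> = (\<lambda>k\<in>{..n}. X' k \<omega>)"

text \<open>The initial law, seen as a measure on the one-factor product S_0.\<close>

definition path_init :: "(nat \<Rightarrow> 'a measure) \<Rightarrow> 'a measure \<Rightarrow> (nat \<Rightarrow> 'a) measure" where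
  "path_init S' \<eta>0 = distr \<eta>0 (path_space S' 0) (\<lambda>x. \<lambda>k\<in>{..0}. x)"

text \<open>M_n: the path is kept and extended by one step of M' n.\<close>

definition path_trans ::
  "(nat \<Rightarrow> 'a measure) \<Rightarrow> (nat \<Rightarrow> 'a \<Rightarrow> 'a measure) \<Rightarrow> nat \<Rightarrow> (nat \<Rightarrow> 'a) \<Rightarrow> (nat \<Rightarrow> 'a) measure" where
  "path_trans S' M' n x = distr (M' n (x (n - 1))) (path_space S' n) (\<lambda>y. x(n := y))"

definition path_pot :: "(nat \<Rightarrow> 'a \<Rightarrow> real) \<Rightarrow> nat \<Rightarrow> (nat \<Rightarrow> 'a) \<Rightarrow> real" where
  "path_pot G' n x = G' n (x n)"

text \<open>gamma_n(f) = E(f(X_n) * (product of G_p(X_p) over p < n)), as a measure on S_n.\<close>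

definition fk_gamma ::
  "'w measure \<Rightarrow> (nat \<Rightarrow> 'a measure) \<Rightarrow> (nat \<Rightarrow> 'a \<Rightarrow> real) \<Rightarrow> (nat \<Rightarrow> 'w \<Rightarrow> 'a) \<Rightarrow> nat
    \<Rightarrow> (nat \<Rightarrow> 'a) measure" where
  "fk_gamma P S' G' X' n =
     distr (density P (\<lambda>\<omega>. \<Prod>p<n. ennreal (path_pot G' p (historical X' p \<omega>))))
       (path_space S' n) (historical X' n)"

definition fk_eta ::
  "'w measure \<Rightarrow> (nat \<Rightarrow> 'a measure) \<Rightarrow> (nat \<Rightarrow> 'a \<Rightarrow> real) \<Rightarrow> (nat \<Rightarrow> 'w \<Rightarrow> 'a) \<Rightarrow> nat
    \<Rightarrow> (nat \<Rightarrow> 'a) measure" where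
  "fk_eta P S' G' X' n =
     density (fk_gamma P S' G' X' n) (\<lambda>_. 1 / (\<integral>\<^sup>+x. 1 \<partial>fk_gamma P S' G' X' n))"

definition fk_Q ::
  "(nat \<Rightarrow> 'a measure) \<Rightarrow> (nat \<Rightarrow> 'a \<Rightarrow> 'a measure) \<Rightarrow> (nat \<Rightarrow> 'a \<Rightarrow> real) \<Rightarrow> nat
    \<Rightarrow> (nat \<Rightarrow> 'a) \<Rightarrow> (nat \<Rightarrow> 'a) measure" where
  "fk_Q S' M' G' n x = density (path_trans S' M' n x) (\<lambda>_. ennreal (path_pot G' (n - 1) x))"

text \<open>
  The composition Q_{p,n} = Q_{p+1} ... Q_n acting on nonnegative functions; the identity
  for n = p (and, irrelevantly, for n < p).
\<close>

fun fk_semigroup ::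
  "(nat \<Rightarrow> 'a measure) \<Rightarrow> (nat \<Rightarrow> 'a \<Rightarrow> 'a measure) \<Rightarrow> (nat \<Rightarrow> 'a \<Rightarrow> real) \<Rightarrow> nat \<Rightarrow> nat
    \<Rightarrow> ((nat \<Rightarrow> 'a) \<Rightarrow> ennreal) \<Rightarrow> (nat \<Rightarrow> 'a) \<Rightarrow> ennreal" where
  "fk_semigroup S' M' G' p 0 f = f"
| "fk_semigroup S' M' G' p (Suc n) f =
     (if p \<le> n
      then fk_semigroup S' M' G' p n (\<lambda>x. \<integral>\<^sup>+y. f y \<partial>fk_Q S' M' G' (Suc n) x)
      else f)"

definition fk_A1 ::
  "(nat \<Rightarrow> 'a measure) \<Rightarrow> (nat \<Rightarrow> 'a \<Rightarrow> 'a measure) \<Rightarrow> (nat \<Rightarrow> 'a \<Rightarrow> real) \<Rightarrow> (nat \<Rightarrow> real) \<Rightarrow> bool" where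
  "fk_A1 S' M' G' \<rho> \<longleftrightarrow>
     (\<forall>n p q. p \<le> q \<and> q \<le> n \<longrightarrow>
        (\<forall>x \<in> space (path_space S' p). \<forall>y \<in> space (path_space S' p).
           fk_semigroup S' M' G' p q (\<lambda>_. 1) x
           \<le> ennreal (\<rho> n) * fk_semigroup S' M' G' p q (\<lambda>_. 1) y))"

section \<open>Particle model\<close>

definition boltzmann_gibbs :: "('s \<Rightarrow> real) \<Rightarrow> 's measure \<Rightarrow> 's measure" where
  "boltzmann_gibbs g \<mu> = density \<mu> (\<lambda>x. ennreal (g x) / (\<integral>\<^sup>+z. ennreal (g z) \<partial>\<mu>))"

definition fk_Phi ::
  "(nat \<Rightarrow> 'a measure) \<Rightarrow> (nat \<Rightarrow> 'a \<Rightarrow> 'a measure) \<Rightarrow> (nat \<Rightarrow> 'a \<Rightarrow> real) \<Rightarrow> nat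
    \<Rightarrow> (nat \<Rightarrow> 'a) measure \<Rightarrow> (nat \<Rightarrow> 'a) measure" where
  "fk_Phi S' M' G' n \<mu> = boltzmann_gibbs (path_pot G' (n - 1)) \<mu> \<bind> path_trans S' M' n"

text \<open>The value \<xi> n \<omega> i k is the state at time k on the ancestral line of particle i of generation n.\<close>

definition particle_model ::
  "'v measure \<Rightarrow> (nat \<Rightarrow> 'a measure) \<Rightarrow> 'a measure \<Rightarrow> (nat \<Rightarrow> 'a \<Rightarrow> 'a measure)
    \<Rightarrow> (nat \<Rightarrow> 'a \<Rightarrow> real) \<Rightarrow> nat \<Rightarrow> (nat \<Rightarrow> 'v \<Rightarrow> nat \<Rightarrow> nat \<Rightarrow> 'a) \<Rightarrow> bool" where
  "particle_model P S' \<eta>0 M' G' N \<xi> \<longleftrightarrow>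
     markov_chain P
       (\<lambda>n. PiM {1..N} (\<lambda>_. path_space S' n))
       (PiM {1..N} (\<lambda>_. path_init S' \<eta>0))
       (\<lambda>n x. PiM {1..N} (\<lambda>_. fk_Phi S' M' G' n (empirical N (path_space S' (n - 1)) x)))
       \<xi>"

definition path_empirical ::
  "(nat \<Rightarrow> 'a measure) \<Rightarrow> nat \<Rightarrow> (nat \<Rightarrow> 'v \<Rightarrow> nat \<Rightarrow> nat \<Rightarrow> 'a) \<Rightarrow> nat \<Rightarrow> 'v
    \<Rightarrow> (nat \<Rightarrow> 'a) measure" where
  "path_empirical S' N \<xi> n \<omega> = empirical N (path_space S' n) (\<xi> n \<omega>)"

definition terminal_empirical ::
  "(nat \<Rightarrow> 'a measure) \<Rightarrow> nat \<Rightarrow> (nat \<Rightarrow> 'v \<Rightarrow> nat \<Rightarrow> nat \<Rightarrow> 'a) \<Rightarrow> 'v \<Rightarrow> nat \<Rightarrow> 'a measure" where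
  "terminal_empirical S' N \<xi> \<omega> n = empirical N (S' n) (\<lambda>i. \<xi> n \<omega> i n)"

section \<open>Backward kernel\<close>

definition transition_densities ::
  "(nat \<Rightarrow> 'a measure) \<Rightarrow> (nat \<Rightarrow> 'a \<Rightarrow> 'a measure) \<Rightarrow> (nat \<Rightarrow> 'a \<Rightarrow> real)
    \<Rightarrow> (nat \<Rightarrow> 'a \<Rightarrow> 'a \<Rightarrow> ennreal) \<Rightarrow> (nat \<Rightarrow> 'a measure) \<Rightarrow> bool" where
  "transition_densities S' M' G' H' \<nu>' \<longleftrightarrow>
     (\<forall>k. sets (\<nu>' (Suc k)) = sets (S' (Suc k)) \<and>
          (\<lambda>(x, y). H' (Suc k) x y) \<in> borel_measurable (S' k \<Otimes>\<^sub>M S' (Suc k)) \<and>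
          (\<forall>x \<in> space (S' k).
             density (M' (Suc k) x) (\<lambda>_. ennreal (G' k x)) = density (\<nu>' (Suc k)) (H' (Suc k) x)))"

text \<open>
  The kernel from S' n to the paths determined by a sequence m of measures, m k on S' k.
  Where the denominator is 0 or infinite, the convention 0/0 = \<infinity>/\<infinity> = 0 of
  \<^typ>\<open>ennreal\<close> applies.
\<close>

definition backward_kernel ::
  "(nat \<Rightarrow> 'a measure) \<Rightarrow> (nat \<Rightarrow> 'a \<Rightarrow> 'a \<Rightarrow> ennreal) \<Rightarrow> (nat \<Rightarrow> 'a measure) \<Rightarrow> nat \<Rightarrow> 'a
    \<Rightarrow> (nat \<Rightarrow> 'a) measure" where
  "backward_kernel S' H' m n x =
     density (PiM {..n} (\<lambda>k. if k = n then return (S' n) x else m k))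
       (\<lambda>y. \<Prod>k<n. H' (Suc k) (y k) (y (Suc k)) / (\<integral>\<^sup>+z. H' (Suc k) z (y (Suc k)) \<partial>m k))"

section \<open>The two estimates and the constants\<close>

text \<open>m(\<xi>_n)(f)\<close>

definition path_mean ::
  "(nat \<Rightarrow> 'a measure) \<Rightarrow> nat \<Rightarrow> (nat \<Rightarrow> 'v \<Rightarrow> nat \<Rightarrow> nat \<Rightarrow> 'a) \<Rightarrow> nat
    \<Rightarrow> ((nat \<Rightarrow> 'a) \<Rightarrow> real) \<Rightarrow> 'v \<Rightarrow> real" where
  "path_mean S' N \<xi> n f \<omega> = (\<integral>x. f x \<partial>path_empirical S' N \<xi> n \<omega>)"

text \<open>(m(\<xi>'_n) H_{n,m(\<xi>')})(f)\<close>

definition backward_mean ::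
  "(nat \<Rightarrow> 'a measure) \<Rightarrow> (nat \<Rightarrow> 'a \<Rightarrow> 'a \<Rightarrow> ennreal) \<Rightarrow> nat \<Rightarrow> (nat \<Rightarrow> 'v \<Rightarrow> nat \<Rightarrow> nat \<Rightarrow> 'a) \<Rightarrow> nat
    \<Rightarrow> ((nat \<Rightarrow> 'a) \<Rightarrow> real) \<Rightarrow> 'v \<Rightarrow> real" where
  "backward_mean S' H' N \<xi> n f \<omega> =
     (\<integral>x. (\<integral>y. f y \<partial>backward_kernel S' H' (terminal_empirical S' N \<xi> \<omega>) n x)
       \<partial>terminal_empirical S' N \<xi> \<omega> n)"

definition c1 :: "real \<Rightarrow> real" where
  "c1 r = r\<^sup>2 - 1"

definition c2 :: "real \<Rightarrow> real" where
  "c2 r = 2 * c1 r * (2 * c1 r * (c1 r + 1) + 1)"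

end

theory Submission
  imports Defs
begin

text \<open>
  For p \<le> n let V_p = m(\<xi>_p)(Q_{p,n} f) / m(\<xi>_p)(Q_{p,n} 1). Then V_n = m(\<xi>_n)(f), and the same
  expression with \<eta>_0 in place of m(\<xi>_0) is \<eta>_n(f). The particles \<xi>_{p+1} are i.i.d. with law
  \<mu> = \<Phi>_{p+1}(m(\<xi>_p)), and \<mu>(Q_{p+1,n} f) / \<mu>(Q_{p+1,n} 1) = V_p, because Q_{p,n} = Q_{p+1} Q_{p+1,n}
  and the normalising constant of \<mu> cancels. So every generation replaces a quotient \<mu>(F) / \<mu>(h)
  by the quotient of the sums of F and of h over an i.i.d. sample of \<mu>. Here F = Q_{p+1,n} f
  and h = Q_{p+1,n} 1. The expectation of the new quotient differs from \<mu>(F) / \<mu>(h) by a factor of at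
  most k = 1 + r (r - 1) / N in either direction, if the values of h have mutual quotients of at
  most r; (A1) gives r = \<rho>_n. The first generation arises in the same way from \<mu> = \<eta>_0.

  This factor comes from an exchange argument (\<open>iid_ratio\<close>): let z be a further independent draw.
  Swapping z with the i-th particle v turns F(v) h(z) / (h(v) + S) into F(z) h(v) / (h(z) + S), where S is the
  sum of h over the other particles. Summed over i, the expectations with denominator h(v) + S in which z
  carries F give exactly \<mu>(F), and those in which z carries h give \<mu>(h) times the wanted
  expectation. The swap changes one out of N comparable terms of the denominator, hence the factor k.
  The bound is multiplicative in F, which yields errors proportional to \<eta>_n(f) for
  unbounded f. In the last generation h = 1 and the step is exact; the n steps before it cost k^n, and
  k^n is compared with 1 + c_2 n/N and 1 / (1 - c_1 n/N) in \<open>bias_factor_bounds\<close>.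

  The two estimates have the same expectation because, given all terminal states, the ancestral line of
  a particle is distributed according to the backward kernel. For one generation this is Bayes'
  formula (\<open>Phi_backward\<close>): a particle that ends at v descends from the j-th
  particle of the previous generation, with terminal state x_j, with probability proportional to
  H'(x_j, v). The induction over the
  generations (\<open>backward_identity\<close>) is about functions g of a path and of the terminal states of its
  generation: integrating out the last generation turns both sides into the same kind
  of expression one generation earlier, for one and the same function \<open>pull\<close> g. Integrals
  against the backward kernel are nested finite sums (\<open>backward\<close>), which makes their measurability
  and their interchange with expectations elementary.
\<close>

section \<open>One step of a Markov chain\<close>

text \<open>
  The definition of a Markov chain speaks of rectangles only. They form an intersection-stable
  generator of the product sigma-algebra and so determine the joint law of the history and the next state.
\<close>

lemma markov_chain_nn_integral:
  assumes chain: "markov_chain P E \<mu> K X"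
    and K: "K (Suc n) \<in> measurable (E n) (prob_algebra (E (Suc n)))"
    and \<phi>[measurable]: "\<phi> \<in> borel_measurable (PiM {..n} E \<Otimes>\<^sub>M E (Suc n))"
  shows "(\<integral>\<^sup>+\<omega>. \<phi> (\<lambda>k\<in>{..n}. X k \<omega>, X (Suc n) \<omega>) \<partial>P)
    = (\<integral>\<^sup>+\<omega>. (\<integral>\<^sup>+y. \<phi> (\<lambda>k\<in>{..n}. X k \<omega>, y) \<partial>K (Suc n) (X n \<omega>)) \<partial>P)"
proof -
  interpret prob_space P
    using chain by (simp add: markov_chain_def)
  let ?H = "PiM {..n} E" and ?S = "E (Suc n)"
  let ?h = "\<lambda>\<omega>. \<lambda>k\<in>{..n}. X k \<omega>"
  have X[measurable]: "X k \<in> measurable P (E k)" for k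
    using chain by (simp add: markov_chain_def)
  have h[measurable]: "?h \<in> measurable P ?H"
    by measurable
  have Kn[measurable]: "K (Suc n) \<in> measurable (E n) (subprob_algebra ?S)"
    using K by (rule measurable_prob_algebraD)
  have Kh[measurable]: "(\<lambda>\<omega>. K (Suc n) (X n \<omega>)) \<in> measurable P (subprob_algebra ?S)"
    by measurable
  have sK: "sets (K (Suc n) (X n \<omega>)) = sets ?S" if "\<omega> \<in> space P" for \<omega>
    using sets_kernel[OF Kh that] .
  have "(\<lambda>\<omega>. distr (K (Suc n) (X n \<omega>)) (?H \<Otimes>\<^sub>M ?S) (Pair (?h \<omega>))) \<in> measurable P (subprob_algebra (?H \<Otimes>\<^sub>M ?S))"
    by (rule measurable_distr2[OF _ Kh]) measurable
  note this[measurable]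
  define B where "B = P \<bind> (\<lambda>\<omega>. distr (K (Suc n) (X n \<omega>)) (?H \<Otimes>\<^sub>M ?S) (Pair (?h \<omega>)))"
  define D where "D = distr P (?H \<Otimes>\<^sub>M ?S) (\<lambda>\<omega>. (?h \<omega>, X (Suc n) \<omega>))"
  have B_int: "(\<integral>\<^sup>+z. \<psi> z \<partial>B) = (\<integral>\<^sup>+\<omega>. (\<integral>\<^sup>+y. \<psi> (?h \<omega>, y) \<partial>K (Suc n) (X n \<omega>)) \<partial>P)"
    if [measurable]: "\<psi> \<in> borel_measurable (?H \<Otimes>\<^sub>M ?S)" for \<psi>
    unfolding B_def
    apply (subst nn_integral_bind[where B="?H \<Otimes>\<^sub>M ?S"])
      apply measurable
    apply (intro nn_integral_cong)
    subgoal for \<omega>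
      using measurable_space[OF h, of \<omega>]
      by (subst nn_integral_distr) (auto simp: measurable_cong_sets[OF sK refl])
    done
  have setsB: "sets B = sets (?H \<Otimes>\<^sub>M ?S)"
    unfolding B_def by (rule sets_bind) (auto simp: not_empty)
  have "D = B"
  proof (rule measure_eqI_generator_eq[OF Int_stable_pair_measure_generator[of ?H ?S], where A="\<lambda>_. space ?H \<times> space ?S"])
    show "{a \<times> b |a b. a \<in> sets ?H \<and> b \<in> sets ?S} \<subseteq> Pow (space ?H \<times> space ?S)"
      by (rule pair_measure_closed)
    show "sets D = sigma_sets (space ?H \<times> space ?S) {a \<times> b |a b. a \<in> sets ?H \<and> b \<in> sets ?S}"
      by (simp add: D_def sets_pair_measure)
    show "sets B = sigma_sets (space ?H \<times> space ?S) {a \<times> b |a b. a \<in> sets ?H \<and> b \<in> sets ?S}"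
      by (simp add: setsB sets_pair_measure)
    show "emeasure D (space ?H \<times> space ?S) \<noteq> \<infinity>" for i :: nat
      unfolding D_def by (subst emeasure_distr) auto
    fix Z assume "Z \<in> {a \<times> b |a b. a \<in> sets ?H \<and> b \<in> sets ?S}"
    then obtain A C where Z: "Z = A \<times> C" and A[measurable]: "A \<in> sets ?H" and C[measurable]: "C \<in> sets ?S"
      by auto
    have "emeasure D Z = emeasure P {\<omega> \<in> space P. ?h \<omega> \<in> A \<and> X (Suc n) \<omega> \<in> C}"
      unfolding D_def Z by (subst emeasure_distr) (auto intro!: arg_cong[where f="emeasure P"])
    also have "\<dots> = (\<integral>\<^sup>+\<omega>. indicator A (?h \<omega>) * emeasure (K (Suc n) (X n \<omega>)) C \<partial>P)"
      using chain A C unfolding markov_chain_def by blast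
    also have "\<dots> = (\<integral>\<^sup>+\<omega>. (\<integral>\<^sup>+y. indicator Z (?h \<omega>, y) \<partial>K (Suc n) (X n \<omega>)) \<partial>P)"
      unfolding Z indicator_times
      by (intro nn_integral_cong) (simp add: nn_integral_cmult sK)
    also have "\<dots> = (\<integral>\<^sup>+z. indicator Z z \<partial>B)"
      by (rule B_int[symmetric]) (simp add: Z)
    also have "\<dots> = emeasure B Z"
      by (simp add: setsB Z)
    finally show "emeasure D Z = emeasure B Z" .
  qed auto
  then have "(\<integral>\<^sup>+z. \<phi> z \<partial>D) = (\<integral>\<^sup>+z. \<phi> z \<partial>B)"
    by simp
  then show ?thesis
    by (simp add: B_int[OF \<phi>] D_def nn_integral_distr)
qed

section \<open>Ratios of sums over an i.i.d. sample\<close>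

text \<open>
  Replacing b by a adds at most (r - 1) b, and b is at most r / m times the sum of the
  m = card J + 1 terms, because b exceeds none of them by more than the factor r.
\<close>

lemma sum_replace_one_le:
  fixes g :: "'i \<Rightarrow> real"
  assumes J: "finite J" and r: "1 \<le> r" and b: "0 \<le> b" "a \<le> r * b" "\<And>j. j \<in> J \<Longrightarrow> b \<le> r * g j"
  shows "a + sum g J \<le> (1 + r * (r - 1) / (real (card J) + 1)) * (b + sum g J)"
proof -
  define m where "m = real (card J) + 1"
  have m: "m > 0" by (simp add: m_def)
  have "real (card J) * b \<le> r * sum g J"
    using sum_mono[of J "\<lambda>_. b" "\<lambda>j. r * g j"] b(3) by (simp add: sum_distrib_left)
  moreover have "b \<le> r * b"
    using b(1) r by (simp add: mult_le_cancel_right1)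
  ultimately have "m * b \<le> r * (b + sum g J)"
    by (simp add: m_def algebra_simps)
  then have "(r - 1) * (m * b) \<le> (r - 1) * (r * (b + sum g J))"
    using r by (intro mult_left_mono) auto
  then have "(r - 1) * b \<le> r * (r - 1) / m * (b + sum g J)"
    using m by (simp add: field_simps)
  moreover have "a \<le> b + (r - 1) * b"
    using b(2) by (simp add: algebra_simps)
  ultimately show ?thesis
    by (simp add: m_def algebra_simps)
qed

lemma ennreal_sum_replace_one_le:
  fixes h :: "'i \<Rightarrow> ennreal"
  assumes J: "finite J" and r: "1 \<le> r"
    and le: "a \<le> ennreal r * b" "\<And>j. j \<in> J \<Longrightarrow> b \<le> ennreal r * h j"
    and fin: "a < \<top>" "b < \<top>" "\<And>j. j \<in> J \<Longrightarrow> h j < \<top>"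
  shows "a + sum h J \<le> ennreal (1 + r * (r - 1) / (real (card J) + 1)) * (b + sum h J)"
proof -
  define g where "g j = enn2real (h j)" for j
  have g: "h j = ennreal (g j)" "0 \<le> g j" if "j \<in> J" for j
    using fin(3)[OF that] by (auto simp: g_def)
  have S: "sum h J = ennreal (sum g J)"
    using g by (subst sum_ennreal[symmetric]) auto
  obtain a' where a': "a = ennreal a'" "0 \<le> a'"
    using fin(1) by (cases a) auto
  obtain b' where b': "b = ennreal b'" "0 \<le> b'"
    using fin(2) by (cases b) auto
  have "a' + sum g J \<le> (1 + r * (r - 1) / (real (card J) + 1)) * (b' + sum g J)"
  proof (rule sum_replace_one_le[OF J r b'(2)])
    show "a' \<le> r * b'"
      using le(1) r b'(2) unfolding a' b' by (simp flip: ennreal_mult'')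
    show "b' \<le> r * g j" if "j \<in> J" for j
      using le(2)[OF that] r g[OF that] unfolding b' by (simp flip: ennreal_mult'')
  qed
  moreover have "0 \<le> sum g J"
    using g by (simp add: sum_nonneg)
  ultimately show ?thesis
    using r a' b' unfolding S
    by (simp flip: ennreal_plus ennreal_mult'' add: ennreal_leI)
qed

lemma ennreal_inverse_le_scaled:
  fixes a b k :: ennreal
  assumes "a \<le> k * b" "0 < a" "b < \<top>" "0 < b" "a < \<top>" "k < \<top>"
  shows "inverse b \<le> k * inverse a"
  using assms
  by (cases a; cases b; cases k)
    (auto simp: inverse_ennreal simp flip: ennreal_mult'' intro!: ennreal_leI simp: field_simps)

text \<open>
  S is the contribution of the other particles to the denominator. Both products are double integrals
  of F(v) h(z) over independent draws v and z; they differ in which of the two draws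
  occurs in the denominator.
\<close>

lemma iid_ratio_step:
  fixes F h :: "'s \<Rightarrow> ennreal"
  assumes \<mu>: "prob_space \<mu>"
    and [measurable]: "F \<in> borel_measurable \<mu>" "h \<in> borel_measurable \<mu>"
    and k: "k < \<top>" and le: "\<And>v z. v \<in> space \<mu> \<Longrightarrow> z \<in> space \<mu> \<Longrightarrow> h z + S \<le> k * (h v + S)"
    and pos: "\<And>z. z \<in> space \<mu> \<Longrightarrow> 0 < h z \<and> h z < \<top>" and S: "S < \<top>"
  shows "(\<integral>\<^sup>+z. h z \<partial>\<mu>) * (\<integral>\<^sup>+v. F v / (h v + S) \<partial>\<mu>) \<le> k * ((\<integral>\<^sup>+v. F v \<partial>\<mu>) * (\<integral>\<^sup>+z. h z / (h z + S) \<partial>\<mu>))"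
    and "(\<integral>\<^sup>+v. F v \<partial>\<mu>) * (\<integral>\<^sup>+z. h z / (h z + S) \<partial>\<mu>) \<le> k * ((\<integral>\<^sup>+z. h z \<partial>\<mu>) * (\<integral>\<^sup>+v. F v / (h v + S) \<partial>\<mu>))"
proof -
  interpret prob_space \<mu> by fact
  let ?B = "\<integral>\<^sup>+v. (\<integral>\<^sup>+z. F v * h z * inverse (h v + S) \<partial>\<mu>) \<partial>\<mu>"
  let ?A = "\<integral>\<^sup>+v. (\<integral>\<^sup>+z. F v * h z * inverse (h z + S) \<partial>\<mu>) \<partial>\<mu>"
  have B: "(\<integral>\<^sup>+z. h z \<partial>\<mu>) * (\<integral>\<^sup>+v. F v / (h v + S) \<partial>\<mu>) = ?B"
  proof -
    have "(\<integral>\<^sup>+z. F v * h z * inverse (h v + S) \<partial>\<mu>) = (\<integral>\<^sup>+z. h z \<partial>\<mu>) * (F v / (h v + S))" for v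
      by (simp add: nn_integral_cmult nn_integral_multc divide_ennreal_def ac_simps)
    then show ?thesis
      by (simp add: nn_integral_cmult)
  qed
  have A: "(\<integral>\<^sup>+v. F v \<partial>\<mu>) * (\<integral>\<^sup>+z. h z / (h z + S) \<partial>\<mu>) = ?A"
    by (simp add: nn_integral_cmult nn_integral_multc divide_ennreal_def mult.assoc)
  have inv: "inverse (h v + S) \<le> k * inverse (h z + S)" if "v \<in> space \<mu>" "z \<in> space \<mu>" for v z
    using le[OF that] pos[OF that(1)] pos[OF that(2)] S k
    by (intro ennreal_inverse_le_scaled) (auto simp: add_pos_nonneg)
  have inv1: "F v * h z * inverse (h v + S) \<le> k * (F v * h z * inverse (h z + S))"
    and inv2: "F v * h z * inverse (h z + S) \<le> k * (F v * h z * inverse (h v + S))"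
    if "v \<in> space \<mu>" "z \<in> space \<mu>" for v z
    using mult_left_mono[OF inv[OF that], of "F v * h z"] mult_left_mono[OF inv[OF that(2,1)], of "F v * h z"]
    by (simp_all only: ac_simps zero_le)
  have "?B \<le> (\<integral>\<^sup>+v. (\<integral>\<^sup>+z. k * (F v * h z * inverse (h z + S)) \<partial>\<mu>) \<partial>\<mu>)"
    by (intro nn_integral_mono inv1)
  also have "\<dots> = k * ?A"
    by (simp add: nn_integral_cmult)
  finally show "(\<integral>\<^sup>+z. h z \<partial>\<mu>) * (\<integral>\<^sup>+v. F v / (h v + S) \<partial>\<mu>) \<le> k * ((\<integral>\<^sup>+v. F v \<partial>\<mu>) * (\<integral>\<^sup>+z. h z / (h z + S) \<partial>\<mu>))"
    unfolding A B .
  have "?A \<le> (\<integral>\<^sup>+v. (\<integral>\<^sup>+z. k * (F v * h z * inverse (h v + S)) \<partial>\<mu>) \<partial>\<mu>)"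
    by (intro nn_integral_mono inv2)
  also have "\<dots> = k * ?B"
  proof -
    have "(\<integral>\<^sup>+z. k * (F v * h z * inverse (h v + S)) \<partial>\<mu>) = k * (\<integral>\<^sup>+z. F v * h z * inverse (h v + S) \<partial>\<mu>)" for v
      by (simp add: nn_integral_cmult)
    moreover have "(\<lambda>v. \<integral>\<^sup>+z. F v * h z * inverse (h v + S) \<partial>\<mu>) \<in> borel_measurable \<mu>"
      by (simp add: nn_integral_multc nn_integral_cmult)
    ultimately show ?thesis
      by (simp add: nn_integral_cmult)
  qed
  finally show "(\<integral>\<^sup>+v. F v \<partial>\<mu>) * (\<integral>\<^sup>+z. h z / (h z + S) \<partial>\<mu>) \<le> k * ((\<integral>\<^sup>+z. h z \<partial>\<mu>) * (\<integral>\<^sup>+v. F v / (h v + S) \<partial>\<mu>))"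
    unfolding A B .
qed

text \<open>
  With h in place of F the quotient is 1, so the products that have the integral of F as a factor in
  \<open>iid_ratio_step\<close> sum up to this integral when i runs through I. Conditioning on all
  particles but the i-th reduces the claim to that lemma.
\<close>

lemma iid_ratio:
  fixes F h :: "'s \<Rightarrow> ennreal" and I :: "'i set"
  assumes \<mu>: "prob_space \<mu>" and I: "finite I" "I \<noteq> {}" and r: "1 \<le> r"
    and [measurable]: "F \<in> borel_measurable \<mu>" "h \<in> borel_measurable \<mu>"
    and pos: "\<And>z. z \<in> space \<mu> \<Longrightarrow> 0 < h z \<and> h z < \<top>"
    and cmp: "\<And>v z. v \<in> space \<mu> \<Longrightarrow> z \<in> space \<mu> \<Longrightarrow> h v \<le> ennreal r * h z"
  defines "k \<equiv> ennreal (1 + r * (r - 1) / card I)"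
    and "R \<equiv> \<integral>\<^sup>+y. (\<Sum>i\<in>I. F (y i)) / (\<Sum>i\<in>I. h (y i)) \<partial>PiM I (\<lambda>_. \<mu>)"
  shows "(\<integral>\<^sup>+z. h z \<partial>\<mu>) * R \<le> k * (\<integral>\<^sup>+z. F z \<partial>\<mu>)"
    and "(\<integral>\<^sup>+z. F z \<partial>\<mu>) \<le> k * ((\<integral>\<^sup>+z. h z \<partial>\<mu>) * R)"
proof -
  interpret \<mu>: prob_space \<mu> by fact
  interpret product_prob_space "\<lambda>_::'i. \<mu>" by standard
  have PI: "prob_space (PiM I (\<lambda>_. \<mu>))"
    by (rule prob_space_PiM) (rule \<mu>)
  define \<Sigma> where "\<Sigma> J y = (\<Sum>j\<in>J. h (y j))" for J :: "'i set" and y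
  have \<Sigma>_meas[measurable]: "\<Sigma> J \<in> borel_measurable (PiM J (\<lambda>_. \<mu>))" for J
    unfolding \<Sigma>_def by measurable
  define A B where "A f i = (\<integral>\<^sup>+y. f (y i) / \<Sigma> I y \<partial>PiM I (\<lambda>_. \<mu>))"
    and "B f J = (\<integral>\<^sup>+y. (\<integral>\<^sup>+v. f v / (h v + \<Sigma> J y) \<partial>\<mu>) \<partial>PiM J (\<lambda>_. \<mu>))" for f :: "'s \<Rightarrow> ennreal" and i J
  have A_eq: "A f i = B f (I - {i})" if "i \<in> I" and [measurable]: "f \<in> borel_measurable \<mu>" for f i
  proof -
    let ?J = "I - {i}"
    have I_eq: "I = insert i ?J"
      using that by auto
    have "A f i = (\<integral>\<^sup>+y. f (y i) / \<Sigma> (insert i ?J) y \<partial>PiM (insert i ?J) (\<lambda>_. \<mu>))"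
      unfolding A_def I_eq[symmetric] ..
    also have "\<dots> = (\<integral>\<^sup>+y. (\<integral>\<^sup>+v. f ((y(i := v)) i) / \<Sigma> (insert i ?J) (y(i := v)) \<partial>\<mu>) \<partial>PiM ?J (\<lambda>_. \<mu>))"
      using I by (subst product_nn_integral_insert) auto
    also have "\<dots> = B f ?J"
    proof -
      have "\<Sigma> (insert i ?J) (y(i := v)) = h v + \<Sigma> ?J y" for y v
        using I by (simp add: \<Sigma>_def sum.insert_remove)
      then show ?thesis
        by (simp add: B_def)
    qed
    finally show ?thesis .
  qed
  have R: "R = (\<Sum>i\<in>I. A F i)"
    unfolding R_def A_def \<Sigma>_def[symmetric]
    by (subst nn_integral_sum[symmetric]) (auto simp: divide_ennreal_def sum_distrib_right)
  have 1: "1 = (\<Sum>i\<in>I. A h i)"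
  proof -
    have "(\<Sum>i\<in>I. A h i) = (\<integral>\<^sup>+y. \<Sigma> I y / \<Sigma> I y \<partial>PiM I (\<lambda>_. \<mu>))"
      unfolding A_def
      by (subst nn_integral_sum[symmetric]) (auto simp: divide_ennreal_def sum_distrib_right \<Sigma>_def)
    also have "\<dots> = (\<integral>\<^sup>+y. 1 \<partial>PiM I (\<lambda>_. \<mu>))"
    proof (intro nn_integral_cong)
      fix y assume "y \<in> space (PiM I (\<lambda>_. \<mu>))"
      then have y: "y i \<in> space \<mu>" if "i \<in> I" for i
        using that by (auto simp: space_PiM)
      obtain i where "i \<in> I" using I by auto
      then have "\<Sigma> I y \<noteq> 0"
        using pos[OF y, of i] I by (auto simp: \<Sigma>_def)
      moreover have "\<Sigma> I y \<noteq> \<top>"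
        using pos[OF y] I by (auto simp: \<Sigma>_def less_top)
      ultimately show "\<Sigma> I y / \<Sigma> I y = 1"
        by (simp add: less_top)
    qed
    also have "\<dots> = 1"
      using PI by (simp add: prob_space.emeasure_space_1)
    finally show ?thesis ..
  qed
  have step: "(\<integral>\<^sup>+z. h z \<partial>\<mu>) * A F i \<le> k * ((\<integral>\<^sup>+z. F z \<partial>\<mu>) * A h i)"
    "(\<integral>\<^sup>+z. F z \<partial>\<mu>) * A h i \<le> k * ((\<integral>\<^sup>+z. h z \<partial>\<mu>) * A F i)" if i: "i \<in> I" for i
  proof -
    let ?J = "I - {i}"
    have card: "real (card ?J) + 1 = card I"
      using I i by (simp add: card_gt_0_iff of_nat_diff Suc_leI)
    have y: "y j \<in> space \<mu>" if "y \<in> space (PiM ?J (\<lambda>_. \<mu>))" "j \<in> ?J" for y j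
      using that by (auto simp: space_PiM)
    have le: "h z + \<Sigma> ?J y \<le> k * (h v + \<Sigma> ?J y)"
      if "y \<in> space (PiM ?J (\<lambda>_. \<mu>))" "v \<in> space \<mu>" "z \<in> space \<mu>" for y v z
      unfolding \<Sigma>_def k_def card[symmetric]
      using I r cmp pos y[OF that(1)] that by (intro ennreal_sum_replace_one_le) auto
    have fin: "\<Sigma> ?J y < \<top>" if "y \<in> space (PiM ?J (\<lambda>_. \<mu>))" for y
      using pos[OF y[OF that]] I by (simp add: \<Sigma>_def less_top)
    have k: "k < \<top>" by (simp add: k_def)
    note s = iid_ratio_step[OF \<mu> \<open>F \<in> _\<close> \<open>h \<in> _\<close> k le pos fin]
    have c: "c * B f ?J = (\<integral>\<^sup>+y. c * (\<integral>\<^sup>+v. f v / (h v + \<Sigma> ?J y) \<partial>\<mu>) \<partial>PiM ?J (\<lambda>_. \<mu>))"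
      if [measurable]: "f \<in> borel_measurable \<mu>" for c f
      unfolding B_def by (subst nn_integral_cmult) auto
    show "(\<integral>\<^sup>+z. h z \<partial>\<mu>) * A F i \<le> k * ((\<integral>\<^sup>+z. F z \<partial>\<mu>) * A h i)"
      unfolding A_eq[OF i \<open>F \<in> _\<close>] A_eq[OF i \<open>h \<in> _\<close>] mult.assoc[symmetric]
      unfolding c[OF \<open>F \<in> _\<close>] c[OF \<open>h \<in> _\<close>]
      using s(1) by (intro nn_integral_mono) (simp add: ac_simps)
    show "(\<integral>\<^sup>+z. F z \<partial>\<mu>) * A h i \<le> k * ((\<integral>\<^sup>+z. h z \<partial>\<mu>) * A F i)"
      unfolding A_eq[OF i \<open>F \<in> _\<close>] A_eq[OF i \<open>h \<in> _\<close>] mult.assoc[symmetric]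
      unfolding c[OF \<open>F \<in> _\<close>] c[OF \<open>h \<in> _\<close>]
      using s(2) by (intro nn_integral_mono) (simp add: ac_simps)
  qed
  have "(\<integral>\<^sup>+z. h z \<partial>\<mu>) * R = (\<Sum>i\<in>I. (\<integral>\<^sup>+z. h z \<partial>\<mu>) * A F i)"
    by (simp add: R sum_distrib_left)
  also have "\<dots> \<le> (\<Sum>i\<in>I. k * ((\<integral>\<^sup>+z. F z \<partial>\<mu>) * A h i))"
    by (intro sum_mono step)
  also have "\<dots> = k * ((\<integral>\<^sup>+z. F z \<partial>\<mu>) * (\<Sum>i\<in>I. A h i))"
    by (simp add: sum_distrib_left)
  finally show "(\<integral>\<^sup>+z. h z \<partial>\<mu>) * R \<le> k * (\<integral>\<^sup>+z. F z \<partial>\<mu>)"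
    by (simp flip: 1)
  have "(\<integral>\<^sup>+z. F z \<partial>\<mu>) * (\<Sum>i\<in>I. A h i) = (\<Sum>i\<in>I. (\<integral>\<^sup>+z. F z \<partial>\<mu>) * A h i)"
    by (simp add: sum_distrib_left)
  also have "\<dots> \<le> (\<Sum>i\<in>I. k * ((\<integral>\<^sup>+z. h z \<partial>\<mu>) * A F i))"
    by (intro sum_mono step)
  also have "\<dots> = k * ((\<integral>\<^sup>+z. h z \<partial>\<mu>) * R)"
    by (simp add: sum_distrib_left R)
  finally show "(\<integral>\<^sup>+z. F z \<partial>\<mu>) \<le> k * ((\<integral>\<^sup>+z. h z \<partial>\<mu>) * R)"
    by (simp flip: 1)
qed

section \<open>Empirical measures and resampling\<close>

declare One_nat_def [simp del] \<comment> \<open>keeps the index set \<open>{1..N}\<close> in this form\<close>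

lemma sets_empirical[simp, measurable_cong]: "sets (empirical N A x) = sets A"
  by (simp add: empirical_def)

lemma nn_integral_empirical:
  assumes N: "N \<ge> 1" and x: "\<And>i. i \<in> {1..N} \<Longrightarrow> x i \<in> space A" and g: "g \<in> borel_measurable A"
  shows "(\<integral>\<^sup>+z. g z \<partial>empirical N A x) = (\<Sum>i\<in>{1..N}. g (x i)) / of_nat N"
proof -
  have "(\<integral>\<^sup>+z. g z \<partial>empirical N A x) = (\<integral>\<^sup>+i. g (x i) \<partial>uniform_count_measure {1..N})"
    unfolding empirical_def using x g
    by (subst nn_integral_distr) (auto simp: measurable_def space_uniform_count_measure sets_uniform_count_measure)
  also have "\<dots> = (\<Sum>i\<in>{1..N}. ennreal (1 / real N) * g (x i))"
    unfolding uniform_count_measure_def by (simp add: nn_integral_point_measure_finite mult.commute)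
  also have "\<dots> = (\<Sum>i\<in>{1..N}. g (x i)) / of_nat N"
  proof -
    have "ennreal (1 / real N) = inverse (of_nat N)"
      unfolding ennreal_of_nat_eq_real_of_nat using N
      by (subst inverse_ennreal) (auto simp: inverse_eq_divide)
    then show ?thesis
      by (simp add: divide_ennreal_def sum_distrib_left mult.commute)
  qed
  finally show ?thesis .
qed

lemma integral_empirical:
  fixes g :: "'s \<Rightarrow> real"
  assumes N: "N \<ge> 1" and x: "\<And>i. i \<in> {1..N} \<Longrightarrow> x i \<in> space A" and g: "g \<in> borel_measurable A"
  shows "(\<integral>z. g z \<partial>empirical N A x) = (\<Sum>i\<in>{1..N}. g (x i)) / real N"
proof -
  have "(\<integral>z. g z \<partial>empirical N A x) = (\<integral>i. g (x i) \<partial>uniform_count_measure {1..N})"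
    unfolding empirical_def using x g
    by (intro integral_distr) (auto simp: measurable_def space_uniform_count_measure sets_uniform_count_measure)
  also have "\<dots> = (\<Sum>i\<in>{1..N}. g (x i)) / real N"
    unfolding uniform_count_measure_def by (simp add: lebesgue_integral_point_measure_finite sum_divide_distrib)
  finally show ?thesis .
qed

lemma prob_space_empirical:
  assumes N: "N \<ge> 1" and x: "\<And>i. i \<in> {1..N} \<Longrightarrow> x i \<in> space A"
  shows "prob_space (empirical N A x)"
proof -
  have "prob_space (uniform_count_measure {1..N})"
    using N by (intro prob_space_uniform_count_measure) auto
  then show ?thesis
    unfolding empirical_def using x
    by (intro prob_space.prob_space_distr) (auto simp: measurable_def space_uniform_count_measure sets_uniform_count_measure)
qed

lemma sets_boltzmann_gibbs[simp, measurable_cong]: "sets (boltzmann_gibbs G \<mu>) = sets \<mu>"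
  by (simp add: boltzmann_gibbs_def)

text \<open>
  Selecting one of the points x 1, ..., x N with weights G and moving it by K. The factors 1/N of the empirical
  measure cancel between the weights and their normalisation.
\<close>

lemma nn_integral_resampling:
  assumes N: "N \<ge> 1" and x: "\<And>i. i \<in> {1..N} \<Longrightarrow> x i \<in> space A"
    and G[measurable]: "G \<in> borel_measurable A" and pos: "\<And>z. z \<in> space A \<Longrightarrow> 0 < G z"
    and K: "K \<in> measurable A (prob_algebra B)" and g[measurable]: "g \<in> borel_measurable B"
  shows "(\<integral>\<^sup>+y. g y \<partial>(boltzmann_gibbs G (empirical N A x) \<bind> K))
    = (\<Sum>i\<in>{1..N}. ennreal (G (x i)) * (\<integral>\<^sup>+y. g y \<partial>K (x i))) / (\<Sum>i\<in>{1..N}. ennreal (G (x i)))"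
proof -
  have K'[measurable]: "K \<in> measurable A (subprob_algebra B)"
    using K by (rule measurable_prob_algebraD)
  have Kg[measurable]: "(\<lambda>z. \<integral>\<^sup>+y. g y \<partial>K z) \<in> borel_measurable A"
    by (rule nn_integral_measurable_subprob_algebra2[OF _ K']) measurable
  define s where "s = (\<Sum>i\<in>{1..N}. G (x i))"
  have s: "0 < s"
    unfolding s_def using N pos x by (intro sum_pos) auto
  have S: "(\<Sum>i\<in>{1..N}. ennreal (G (x i))) = ennreal s"
    unfolding s_def using pos x by (intro sum_ennreal) (auto intro: less_imp_le)
  have Gint: "(\<integral>\<^sup>+z. ennreal (G z) \<partial>empirical N A x) = ennreal s / of_nat N"
    using N x by (subst nn_integral_empirical) (auto simp: S)
  have sN: "inverse (ennreal s / of_nat N) = of_nat N * inverse (ennreal s)"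
    unfolding ennreal_of_nat_eq_real_of_nat using s N
    by (simp add: divide_ennreal inverse_ennreal divide_inverse flip: ennreal_mult'')
  have "(\<integral>\<^sup>+y. g y \<partial>(boltzmann_gibbs G (empirical N A x) \<bind> K))
      = (\<integral>\<^sup>+z. (\<integral>\<^sup>+y. g y \<partial>K z) \<partial>boltzmann_gibbs G (empirical N A x))"
    by (rule nn_integral_bind[where B=B]) measurable
  also have "\<dots> = (\<integral>\<^sup>+z. ennreal (G z) / (ennreal s / of_nat N) * (\<integral>\<^sup>+y. g y \<partial>K z) \<partial>empirical N A x)"
    unfolding boltzmann_gibbs_def Gint by (subst nn_integral_density) measurable
  also have "\<dots> = (\<Sum>i\<in>{1..N}. ennreal (G (x i)) / (ennreal s / of_nat N) * (\<integral>\<^sup>+y. g y \<partial>K (x i))) / of_nat N"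
    using N x by (subst nn_integral_empirical) auto
  also have "\<dots> = (\<Sum>i\<in>{1..N}. ennreal (G (x i)) * (\<integral>\<^sup>+y. g y \<partial>K (x i))) * (inverse (ennreal s) * (of_nat N * inverse (of_nat N)))"
    by (simp add: divide_ennreal_def[of _ "_ / _"] divide_ennreal_def[of "sum _ _"] sN sum_distrib_right sum_distrib_left ac_simps)
  also have "of_nat N * inverse (of_nat N :: ennreal) = 1"
    unfolding divide_ennreal_def[symmetric] using N
    by (intro ennreal_divide_self) (auto simp: of_nat_less_top)
  finally show ?thesis
    by (simp add: S divide_ennreal_def)
qed

text \<open>
  The finite sums of \<open>nn_integral_resampling\<close> are measurable in the configuration x.
\<close>

lemma resampling_kernel:
  assumes N: "N \<ge> 1"
    and G[measurable]: "G \<in> borel_measurable A" and pos: "\<And>z. z \<in> space A \<Longrightarrow> 0 < G z"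
    and K: "K \<in> measurable A (prob_algebra B)"
  shows "(\<lambda>x. boltzmann_gibbs G (empirical N A x) \<bind> K) \<in> measurable (PiM {1..N} (\<lambda>_. A)) (prob_algebra B)"
    (is "?\<Phi> \<in> _")
proof (rule measurable_prob_algebraI)
  have K'[measurable]: "K \<in> measurable A (subprob_algebra B)"
    using K by (rule measurable_prob_algebraD)
  have xi: "x i \<in> space A" if "x \<in> space (PiM {1..N} (\<lambda>_. A))" "i \<in> {1..N}" for x i
    using that by (auto simp: space_PiM)
  have ne: "space A \<noteq> {}" if "x \<in> space (PiM {1..N} (\<lambda>_. A))" for x
    using xi[OF that, of 1] N by auto
  have s: "sets (?\<Phi> x) = sets B" if "x \<in> space (PiM {1..N} (\<lambda>_. A))" for x
    using ne[OF that] sets_kernel[OF K'] sets_eq_imp_space_eq[of "boltzmann_gibbs G (empirical N A x)" A]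
    by (intro sets_bind) auto
  have e: "emeasure (?\<Phi> x) C = (\<Sum>i\<in>{1..N}. ennreal (G (x i)) * emeasure (K (x i)) C) / (\<Sum>i\<in>{1..N}. ennreal (G (x i)))"
    if x: "x \<in> space (PiM {1..N} (\<lambda>_. A))" and C: "C \<in> sets B" for x C
  proof -
    have "emeasure (?\<Phi> x) C = (\<integral>\<^sup>+y. indicator C y \<partial>?\<Phi> x)"
      using s[OF x] C by simp
    also have "\<dots> = (\<Sum>i\<in>{1..N}. ennreal (G (x i)) * (\<integral>\<^sup>+y. indicator C y \<partial>K (x i))) / (\<Sum>i\<in>{1..N}. ennreal (G (x i)))"
      using xi[OF x] C by (intro nn_integral_resampling[OF N _ G pos K]) auto
    finally show ?thesis
      using sets_kernel[OF K' xi[OF x]] C by simp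
  qed
  show p: "prob_space (?\<Phi> x)" if x: "x \<in> space (PiM {1..N} (\<lambda>_. A))" for x
  proof
    have "emeasure (?\<Phi> x) (space (?\<Phi> x)) = emeasure (?\<Phi> x) (space B)"
      using sets_eq_imp_space_eq[OF s[OF x]] by simp
    also have "\<dots> = (\<Sum>i\<in>{1..N}. ennreal (G (x i)) * emeasure (K (x i)) (space B)) / (\<Sum>i\<in>{1..N}. ennreal (G (x i)))"
      using e[OF x] by simp
    also have "\<dots> = (\<Sum>i\<in>{1..N}. ennreal (G (x i))) / (\<Sum>i\<in>{1..N}. ennreal (G (x i)))"
    proof -
      have "emeasure (K (x i)) (space B) = 1" if "i \<in> {1..N}" for i
        using measurable_space[OF K xi[OF x that]]
        by (auto simp: space_prob_algebra dest!: sets_eq_imp_space_eq intro: prob_space.emeasure_space_1)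
          (metis prob_space.emeasure_space_1)
      then show ?thesis by simp
    qed
    also have "\<dots> = 1"
    proof (rule ennreal_divide_self)
      have "0 < (\<Sum>i\<in>{1..N}. G (x i))"
        using N pos xi[OF x] by (intro sum_pos) auto
      moreover have "(\<Sum>i\<in>{1..N}. ennreal (G (x i))) = ennreal (\<Sum>i\<in>{1..N}. G (x i))"
        using pos xi[OF x] by (intro sum_ennreal) (auto intro: less_imp_le)
      ultimately show "(\<Sum>i\<in>{1..N}. ennreal (G (x i))) \<noteq> 0" "(\<Sum>i\<in>{1..N}. ennreal (G (x i))) < \<top>"
        by auto
    qed
    finally show "emeasure (?\<Phi> x) (space (?\<Phi> x)) = 1" .
  qed
  show "?\<Phi> \<in> measurable (PiM {1..N} (\<lambda>_. A)) (subprob_algebra B)"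
  proof (rule measurable_subprob_algebra)
    fix C assume C[measurable]: "C \<in> sets B"
    have "(\<lambda>x. (\<Sum>i\<in>{1..N}. ennreal (G (x i)) * emeasure (K (x i)) C) / (\<Sum>i\<in>{1..N}. ennreal (G (x i))))
        \<in> borel_measurable (PiM {1..N} (\<lambda>_. A))"
    proof (intro borel_measurable_divide_ennreal borel_measurable_sum borel_measurable_times_ennreal)
      fix i assume i: "i \<in> {1..N}"
      then show "(\<lambda>x. emeasure (K (x i)) C) \<in> borel_measurable (PiM {1..N} (\<lambda>_. A))"
        by measurable
      show "(\<lambda>x. ennreal (G (x i))) \<in> borel_measurable (PiM {1..N} (\<lambda>_. A))"
        using i by measurable
      show "(\<lambda>x. ennreal (G (x i))) \<in> borel_measurable (PiM {1..N} (\<lambda>_. A))"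
        using i by measurable
    qed
    then show "(\<lambda>x. emeasure (?\<Phi> x) C) \<in> borel_measurable (PiM {1..N} (\<lambda>_. A))"
      by (subst measurable_cong[OF e[OF _ C]])
  qed (use s p in \<open>auto intro: prob_space_imp_subprob_space\<close>)
qed

text \<open>
  On boxes the product measure is a finite product of measurable functions, and boxes generate.
\<close>

lemma iid_kernel:
  assumes I: "finite I" and K: "K \<in> measurable A (prob_algebra B)"
  shows "(\<lambda>x. PiM I (\<lambda>_. K x)) \<in> measurable A (prob_algebra (PiM I (\<lambda>_. B)))"
proof -
  have K'[measurable]: "K \<in> measurable A (subprob_algebra B)"
    using K by (rule measurable_prob_algebraD)
  have sK: "sets (K x) = sets B" and pK: "prob_space (K x)" if "x \<in> space A" for x
    using measurable_space[OF K that] by (auto simp: space_prob_algebra)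
  show ?thesis
  proof (rule measurable_prob_algebra_generated[OF sets_PiM Int_stable_prod_algebra prod_algebra_sets_into_space])
    fix x assume x: "x \<in> space A"
    show "prob_space (PiM I (\<lambda>_. K x))"
      by (rule prob_space_PiM) (rule pK[OF x])
    show "sets (PiM I (\<lambda>_. K x)) = sets (PiM I (\<lambda>_. B))"
      by (intro sets_PiM_cong refl sK x)
  next
    fix C assume "C \<in> prod_algebra I (\<lambda>_. B)"
    then obtain X where C: "C = PiE I X" and X: "\<And>i. i \<in> I \<Longrightarrow> X i \<in> sets B"
      unfolding prod_algebra_eq_finite[OF I] by auto
    have "emeasure (PiM I (\<lambda>_. K x)) C = (\<Prod>i\<in>I. emeasure (K x) (X i))" if x: "x \<in> space A" for x
    proof -
      interpret prob_space "K x" by (rule pK[OF x])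
      interpret finite_product_prob_space "\<lambda>_. K x" I by standard (rule I)
      show ?thesis
        unfolding C using X sK[OF x] by (intro measure_times) auto
    qed
    then show "(\<lambda>x. emeasure (PiM I (\<lambda>_. K x)) C) \<in> borel_measurable A"
      using X by (subst measurable_cong) auto
  qed
qed

section \<open>The Feynman-Kac semigroup\<close>

lemma nn_integral_pos:
  assumes "prob_space \<mu>" "f \<in> borel_measurable \<mu>" "\<And>x. x \<in> space \<mu> \<Longrightarrow> 0 < f x"
  shows "0 < (\<integral>\<^sup>+x. f x \<partial>\<mu>)"
proof (rule ccontr)
  assume "\<not> ?thesis"
  then have "AE x in \<mu>. f x = 0"
    using assms(2) by (simp add: nn_integral_0_iff_AE)
  from this AE_space[of \<mu>] have "AE x in \<mu>. False"
    by eventually_elim (metis assms(3) less_irrefl)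
  then show False
    using prob_space.AE_False[OF assms(1)] by simp
qed

locale feynman_kac =
  fixes S' :: "nat \<Rightarrow> 'a measure"
    and \<eta>0 :: "'a measure"
    and M' :: "nat \<Rightarrow> 'a \<Rightarrow> 'a measure"
    and G' :: "nat \<Rightarrow> 'a \<Rightarrow> real"
  assumes model: "feynman_kac_model S' \<eta>0 M' G'"
begin

abbreviation "E \<equiv> path_space S'"
abbreviation "M \<equiv> path_trans S' M'"
abbreviation "Q \<equiv> fk_semigroup S' M' G'"

lemma M'_kernel: "M' (Suc n) \<in> measurable (S' n) (prob_algebra (S' (Suc n)))"
  using model by (simp add: feynman_kac_model_def)

lemma M'_subprob[measurable]: "M' (Suc n) \<in> measurable (S' n) (subprob_algebra (S' (Suc n)))"
  using M'_kernel by (rule measurable_prob_algebraD)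

lemma sets_M': "x \<in> space (S' n) \<Longrightarrow> sets (M' (Suc n) x) = sets (S' (Suc n))"
  using sets_kernel[OF M'_subprob] .

lemma prob_space_M': "x \<in> space (S' n) \<Longrightarrow> prob_space (M' (Suc n) x)"
  using measurable_space[OF M'_kernel] by (auto simp: space_prob_algebra)

lemma G'_measurable[measurable]: "G' n \<in> borel_measurable (S' n)"
  and G'_pos: "x \<in> space (S' n) \<Longrightarrow> 0 < G' n x"
  using model by (auto simp: feynman_kac_model_def)

lemma G'_bounded: obtains B where "0 \<le> B" "\<And>x. x \<in> space (S' n) \<Longrightarrow> G' n x \<le> B"
proof -
  obtain B where "\<forall>x\<in>space (S' n). G' n x \<le> B"
    using model unfolding feynman_kac_model_def by meson
  then show ?thesis
    by (intro that[of "max 0 B"]) (auto simp: le_max_iff_disj)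
qed

lemma \<eta>0: "sets \<eta>0 = sets (S' 0)" "prob_space \<eta>0"
  using model by (auto simp: feynman_kac_model_def space_prob_algebra)

lemma path_component[measurable]: "k \<le> n \<Longrightarrow> (\<lambda>x. x k) \<in> measurable (E n) (S' k)"
  by (simp add: path_space_def)

lemma path_component_space: "x \<in> space (E n) \<Longrightarrow> k \<le> n \<Longrightarrow> x k \<in> space (S' k)"
  by (auto simp: path_space_def space_PiM)

lemma path_extend_measurable[measurable]:
  assumes [measurable]: "f \<in> measurable A (E n)" "g \<in> measurable A (S' (Suc n))"
  shows "(\<lambda>z. (f z)(Suc n := g z)) \<in> measurable A (E (Suc n))"
proof -
  have "(\<lambda>z. case (f z, g z) of (x, y) \<Rightarrow> x(Suc n := y)) \<in> measurable A (PiM (insert (Suc n) {..n}) S')"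
    by (rule measurable_compose[OF _ measurable_add_dim]) (use assms in \<open>simp add: path_space_def\<close>)
  then show ?thesis
    by (simp add: path_space_def atMost_Suc)
qed

lemma path_extend_space: "x \<in> space (E n) \<Longrightarrow> y \<in> space (S' (Suc n)) \<Longrightarrow> x(Suc n := y) \<in> space (E (Suc n))"
  by (auto simp: path_space_def space_PiM PiE_def extensional_def Pi_def)

lemma path_trans_kernel: "M (Suc n) \<in> measurable (E n) (prob_algebra (E (Suc n)))"
proof (rule measurable_prob_algebraI)
  show "prob_space (M (Suc n) x)" if x: "x \<in> space (E n)" for x
    unfolding path_trans_def
  proof (rule prob_space.prob_space_distr)
    show "prob_space (M' (Suc n) (x (Suc n - 1)))"
      using prob_space_M' path_component_space[OF x] by simp
    show "(\<lambda>y. x(Suc n := y)) \<in> measurable (M' (Suc n) (x (Suc n - 1))) (E (Suc n))"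
      using x path_component_space[OF x, of n] by (simp add: measurable_cong_sets[OF sets_M' refl])
  qed
  show "M (Suc n) \<in> measurable (E n) (subprob_algebra (E (Suc n)))"
    unfolding path_trans_def
    by (rule measurable_distr2[where M="S' (Suc n)"]) auto
qed

lemma nn_integral_path_trans:
  assumes x: "x \<in> space (E n)" and [measurable]: "f \<in> borel_measurable (E (Suc n))"
  shows "(\<integral>\<^sup>+y. f y \<partial>M (Suc n) x) = (\<integral>\<^sup>+y. f (x(Suc n := y)) \<partial>M' (Suc n) (x n))"
  unfolding path_trans_def using x path_component_space[OF x, of n]
  by (subst nn_integral_distr) (auto simp: measurable_cong_sets[OF sets_M' refl])

lemma path_pot_measurable[measurable]: "path_pot G' n \<in> borel_measurable (E n)"
  unfolding path_pot_def by measurable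

lemma path_pot_pos: "x \<in> space (E n) \<Longrightarrow> 0 < path_pot G' n x"
  by (simp add: path_pot_def G'_pos path_component_space)

lemma nn_integral_fk_Q:
  assumes x: "x \<in> space (E n)" and f[measurable]: "f \<in> borel_measurable (E (Suc n))"
  shows "(\<integral>\<^sup>+y. f y \<partial>fk_Q S' M' G' (Suc n) x) = ennreal (path_pot G' n x) * (\<integral>\<^sup>+y. f y \<partial>M (Suc n) x)"
proof -
  have "sets (M (Suc n) x) = sets (E (Suc n))"
    by (simp add: path_trans_def)
  note [measurable_cong] = this
  show ?thesis
    unfolding fk_Q_def by (simp add: nn_integral_density nn_integral_cmult)
qed

lemma fk_Q_measurable:
  assumes f[measurable]: "f \<in> borel_measurable (E (Suc n))"
  shows "(\<lambda>x. \<integral>\<^sup>+y. f y \<partial>fk_Q S' M' G' (Suc n) x) \<in> borel_measurable (E n)"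
proof (subst measurable_cong[OF nn_integral_fk_Q[OF _ f]])
  have "M (Suc n) \<in> measurable (E n) (subprob_algebra (E (Suc n)))"
    using path_trans_kernel by (rule measurable_prob_algebraD)
  then have [measurable]: "(\<lambda>x. \<integral>\<^sup>+y. f y \<partial>M (Suc n) x) \<in> borel_measurable (E n)"
    by (rule nn_integral_measurable_subprob_algebra2[rotated]) measurable
  show "(\<lambda>x. ennreal (path_pot G' n x) * (\<integral>\<^sup>+y. f y \<partial>M (Suc n) x)) \<in> borel_measurable (E n)"
    by measurable
qed

lemma semigroup_same[simp]: "Q n n f = f"
  by (cases n) auto

lemma semigroup_measurable:
  "p \<le> n \<Longrightarrow> f \<in> borel_measurable (E n) \<Longrightarrow> Q p n f \<in> borel_measurable (E p)"
proof (induction n arbitrary: f)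
  case (Suc n)
  then show ?case
    using fk_Q_measurable by (cases "p = Suc n") auto
qed simp

text \<open>
  The defining recursion splits off the last factor of Q_{p,n}; moving forward from generation p
  to p + 1 needs the first one.
\<close>

lemma semigroup_left:
  "p < n \<Longrightarrow> Q p n f = (\<lambda>x. \<integral>\<^sup>+y. Q (Suc p) n f y \<partial>fk_Q S' M' G' (Suc p) x)"
proof (induction n arbitrary: f)
  case (Suc n)
  show ?case
  proof (cases "p = n")
    case False
    with Suc have "p < n" by simp
    then show ?thesis
      using Suc.IH[of "\<lambda>x. \<integral>\<^sup>+y. f y \<partial>fk_Q S' M' G' (Suc n) x"] by simp
  qed simp
qed simp

lemma semigroup_pos:
  "p \<le> n \<Longrightarrow> f \<in> borel_measurable (E n) \<Longrightarrow> (\<And>x. x \<in> space (E n) \<Longrightarrow> 0 < f x)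
    \<Longrightarrow> x \<in> space (E p) \<Longrightarrow> 0 < Q p n f x"
proof (induction n arbitrary: f x)
  case (Suc n)
  show ?case
  proof (cases "p = Suc n")
    case True
    then show ?thesis using Suc.prems by simp
  next
    case False
    then have p: "p \<le> n" using Suc.prems by simp
    have "0 < (\<integral>\<^sup>+y. f y \<partial>fk_Q S' M' G' (Suc n) x)" if x: "x \<in> space (E n)" for x
    proof -
      have "sets (M (Suc n) x) = sets (E (Suc n))" "prob_space (M (Suc n) x)"
        using measurable_space[OF path_trans_kernel x] by (auto simp: space_prob_algebra)
      note s = this
      have "0 < (\<integral>\<^sup>+y. f y \<partial>M (Suc n) x)"
        using Suc.prems(2,3) sets_eq_imp_space_eq[OF s(1)]
        by (intro nn_integral_pos s(2)) (auto simp: measurable_cong_sets[OF s(1) refl])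
      then show ?thesis
        using path_pot_pos[OF x] Suc.prems by (simp add: nn_integral_fk_Q[OF x] ennreal_zero_less_mult_iff)
    qed
    then show ?thesis
      using p Suc.prems by (simp add: Suc.IH fk_Q_measurable)
  qed
qed simp

lemma semigroup_bounded:
  "p \<le> n \<Longrightarrow> f \<in> borel_measurable (E n) \<Longrightarrow> c < \<top> \<Longrightarrow> (\<And>x. x \<in> space (E n) \<Longrightarrow> f x \<le> c)
    \<Longrightarrow> x \<in> space (E p) \<Longrightarrow> Q p n f x < \<top>"
proof (induction n arbitrary: f c x)
  case 0
  then show ?case by (auto intro: le_less_trans)
next
  case (Suc n)
  show ?case
  proof (cases "p = Suc n")
    case True
    then show ?thesis using Suc.prems by (auto intro: le_less_trans)
  next
    case False
    then have p: "p \<le> n" using Suc.prems by simp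
    obtain B where B: "0 \<le> B" "\<And>x. x \<in> space (S' n) \<Longrightarrow> G' n x \<le> B"
      using G'_bounded[of n] by blast
    have "(\<integral>\<^sup>+y. f y \<partial>fk_Q S' M' G' (Suc n) x) \<le> ennreal B * c" if x: "x \<in> space (E n)" for x
    proof -
      have s: "sets (M (Suc n) x) = sets (E (Suc n))" and ps: "prob_space (M (Suc n) x)"
        using measurable_space[OF path_trans_kernel x] by (auto simp: space_prob_algebra)
      have "(\<integral>\<^sup>+y. f y \<partial>M (Suc n) x) \<le> (\<integral>\<^sup>+y. c \<partial>M (Suc n) x)"
        using Suc.prems(4) sets_eq_imp_space_eq[OF s] by (intro nn_integral_mono) auto
      also have "\<dots> = c"
        using ps by (simp add: prob_space.emeasure_space_1)
      finally show ?thesis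
        using B(2)[OF path_component_space[OF x]] Suc.prems(2)
        by (simp add: nn_integral_fk_Q[OF x] path_pot_def mult_mono ennreal_leI)
    qed
    then show ?thesis
      using p Suc.prems by (simp add: Suc.IH[where c="ennreal B * c"] fk_Q_measurable ennreal_mult_less_top)
  qed
qed

lemma semigroup_one:
  assumes "p \<le> n" "x \<in> space (E p)"
  shows "0 < Q p n (\<lambda>_. 1) x" "Q p n (\<lambda>_. 1) x < \<top>"
  using semigroup_pos[OF assms(1), of "\<lambda>_. 1" x] semigroup_bounded[OF assms(1), of "\<lambda>_. 1" 1 x] assms(2) by auto

lemma path_init: "sets (path_init S' \<eta>0) = sets (E 0)" "prob_space (path_init S' \<eta>0)"
proof -
  have [measurable]: "(\<lambda>x. \<lambda>k\<in>{..0}. x) \<in> measurable \<eta>0 (E 0)"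
    unfolding path_space_def by (rule measurable_restrict) (simp add: measurable_cong_sets[OF \<eta>0(1) refl])
  show "sets (path_init S' \<eta>0) = sets (E 0)" "prob_space (path_init S' \<eta>0)"
    unfolding path_init_def by (simp_all only: sets_distr, intro prob_space.prob_space_distr \<eta>0) measurable
qed

lemma path_space_nonempty: "space (E n) \<noteq> {}"
proof (induction n)
  case 0
  then show ?case
    using prob_space.not_empty[OF path_init(2)] sets_eq_imp_space_eq[OF path_init(1)] by simp
next
  case (Suc n)
  then obtain x where x: "x \<in> space (E n)" by auto
  show ?case
    using measurable_space[OF path_trans_kernel x] prob_space.not_empty
    by (auto simp: space_prob_algebra dest!: sets_eq_imp_space_eq)
qed

lemma path_init_distr:
  assumes "markov_chain PX S' \<eta>0 M' X'"
  shows "path_init S' \<eta>0 = distr PX (E 0) (historical X' 0)"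
proof -
  have X[measurable]: "X' 0 \<in> measurable PX (S' 0)" and d: "distr PX (S' 0) (X' 0) = \<eta>0"
    using assms by (auto simp: markov_chain_def)
  have r: "(\<lambda>x. \<lambda>k\<in>{..0}. x) \<in> measurable (S' 0) (E 0)"
    unfolding path_space_def by (rule measurable_restrict) auto
  have "path_init S' \<eta>0 = distr (distr PX (S' 0) (X' 0)) (E 0) (\<lambda>x. \<lambda>k\<in>{..0}. x)"
    by (simp add: path_init_def d)
  also have "\<dots> = distr PX (E 0) (\<lambda>\<omega>. \<lambda>k\<in>{..0}. X' 0 \<omega>)"
    by (subst distr_distr[OF r X]) (simp add: comp_def)
  finally show ?thesis
    by (simp add: historical_def[abs_def] cong: restrict_cong)
qed

lemma historical_measurable[measurable]:
  "markov_chain PX S' \<eta>0 M' X' \<Longrightarrow> historical X' n \<in> measurable PX (E n)"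
  unfolding historical_def[abs_def] path_space_def markov_chain_def
  by (intro measurable_restrict) auto

text \<open>
  Conditioning on the first n steps turns f into Q_{n+1} f, where the weight G_n of the last step is absorbed by Q_{n+1};
  iterating this leads down to the initial law.
\<close>

lemma nn_integral_gamma:
  assumes chain: "markov_chain PX S' \<eta>0 M' X'" and f: "f \<in> borel_measurable (E n)"
  shows "(\<integral>\<^sup>+x. f x \<partial>fk_gamma PX S' G' X' n) = (\<integral>\<^sup>+x. Q 0 n f x \<partial>path_init S' \<eta>0)"
proof -
  note historical_measurable[OF chain, measurable]
  have eq: "(\<integral>\<^sup>+x. f x \<partial>fk_gamma PX S' G' X' n)
      = (\<integral>\<^sup>+\<omega>. (\<Prod>p<n. ennreal (path_pot G' p (historical X' p \<omega>))) * f (historical X' n \<omega>) \<partial>PX)"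
    if [measurable]: "f \<in> borel_measurable (E n)" for n f
  proof -
    have [measurable]: "(\<lambda>\<omega>. \<Prod>p<n. ennreal (path_pot G' p (historical X' p \<omega>))) \<in> borel_measurable PX"
      by (intro borel_measurable_prod_ennreal) measurable
    show ?thesis
      unfolding fk_gamma_def by (subst nn_integral_distr) (auto simp: nn_integral_density)
  qed
  show ?thesis
    using f
  proof (induction n arbitrary: f)
    case 0
    note 0[measurable]
    show ?case
      by (simp add: eq[OF 0] path_init_distr[OF chain] nn_integral_distr)
  next
    case (Suc n)
    note Suc.prems[measurable]
    let ?W = "\<lambda>x. \<Prod>p<Suc n. ennreal (G' p (x p))"
    have [measurable]: "?W \<in> borel_measurable (E n)"
      by (intro borel_measurable_prod_ennreal) (auto intro!: measurable_compose[OF path_component])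
    have meas: "(\<lambda>(x, y). ?W x * f (x(Suc n := y))) \<in> borel_measurable (PiM {..n} S' \<Otimes>\<^sub>M S' (Suc n))"
      unfolding path_space_def[symmetric] by measurable
    have hist: "historical X' n \<omega> \<in> space (E n)" if "\<omega> \<in> space PX" for \<omega>
      using measurable_space[OF historical_measurable[OF chain] that] .
    have "(\<integral>\<^sup>+x. f x \<partial>fk_gamma PX S' G' X' (Suc n))
      = (\<integral>\<^sup>+\<omega>. (case (\<lambda>k\<in>{..n}. X' k \<omega>, X' (Suc n) \<omega>) of (x, y) \<Rightarrow> ?W x * f (x(Suc n := y))) \<partial>PX)"
    proof -
      have "(\<lambda>k\<in>{..n}. X' k \<omega>)(Suc n := X' (Suc n) \<omega>) = historical X' (Suc n) \<omega>" for \<omega>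
        by (auto simp: historical_def)
      moreover have "(\<Prod>p<Suc n. ennreal (path_pot G' p (historical X' p \<omega>))) = ?W (\<lambda>k\<in>{..n}. X' k \<omega>)" for \<omega>
        by (intro prod.cong refl) (simp add: path_pot_def historical_def)
      ultimately show ?thesis
        unfolding eq[OF Suc.prems] by (simp only: prod.case)
    qed
    also have "\<dots> = (\<integral>\<^sup>+\<omega>. (\<integral>\<^sup>+y. ?W (historical X' n \<omega>) * f ((historical X' n \<omega>)(Suc n := y)) \<partial>M' (Suc n) (X' n \<omega>)) \<partial>PX)"
      by (subst markov_chain_nn_integral[OF chain M'_kernel meas]) (simp only: prod.case historical_def)
    also have "\<dots> = (\<integral>\<^sup>+\<omega>. (\<Prod>p<n. ennreal (path_pot G' p (historical X' p \<omega>))) * (\<integral>\<^sup>+y. f y \<partial>fk_Q S' M' G' (Suc n) (historical X' n \<omega>)) \<partial>PX)"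
    proof (intro nn_integral_cong)
      fix \<omega> assume \<omega>: "\<omega> \<in> space PX"
      have X: "X' n \<omega> \<in> space (S' n)" "historical X' n \<omega> n = X' n \<omega>"
        using path_component_space[OF hist[OF \<omega>], of n] by (auto simp: historical_def)
      have fm: "(\<lambda>y. f ((historical X' n \<omega>)(Suc n := y))) \<in> borel_measurable (M' (Suc n) (X' n \<omega>))"
        using hist[OF \<omega>] by (simp add: measurable_cong_sets[OF sets_M'[OF X(1)] refl])
      have "?W (historical X' n \<omega>) = (\<Prod>p<n. ennreal (path_pot G' p (historical X' p \<omega>))) * ennreal (path_pot G' n (historical X' n \<omega>))"
        by (auto simp: path_pot_def historical_def intro!: prod.cong arg_cong2[where f="(*)"])
      then show "(\<integral>\<^sup>+y. ?W (historical X' n \<omega>) * f ((historical X' n \<omega>)(Suc n := y)) \<partial>M' (Suc n) (X' n \<omega>))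
        = (\<Prod>p<n. ennreal (path_pot G' p (historical X' p \<omega>))) * (\<integral>\<^sup>+y. f y \<partial>fk_Q S' M' G' (Suc n) (historical X' n \<omega>))"
        unfolding nn_integral_fk_Q[OF hist[OF \<omega>] Suc.prems] nn_integral_path_trans[OF hist[OF \<omega>] Suc.prems] X(2)
        by (subst nn_integral_cmult[OF fm]) (simp only: mult.assoc)
    qed
    also have "\<dots> = (\<integral>\<^sup>+x. Q 0 (Suc n) f x \<partial>path_init S' \<eta>0)"
      by (subst eq[symmetric, OF fk_Q_measurable[OF Suc.prems]])
         (simp add: Suc.IH fk_Q_measurable[OF Suc.prems])
    finally show ?case .
  qed
qed

lemma nn_integral_eta:
  assumes chain: "markov_chain PX S' \<eta>0 M' X'" and f[measurable]: "f \<in> borel_measurable (E n)"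
  shows "(\<integral>\<^sup>+x. f x \<partial>fk_eta PX S' G' X' n)
    = (\<integral>\<^sup>+x. Q 0 n f x \<partial>path_init S' \<eta>0) / (\<integral>\<^sup>+x. Q 0 n (\<lambda>_. 1) x \<partial>path_init S' \<eta>0)"
proof -
  have [measurable_cong]: "sets (fk_gamma PX S' G' X' n) = sets (E n)"
    by (simp add: fk_gamma_def)
  have "(\<integral>\<^sup>+x. f x \<partial>fk_eta PX S' G' X' n)
    = (1 / (\<integral>\<^sup>+x. 1 \<partial>fk_gamma PX S' G' X' n)) * (\<integral>\<^sup>+x. f x \<partial>fk_gamma PX S' G' X' n)"
    unfolding fk_eta_def by (subst nn_integral_density, measurable, rule nn_integral_cmult, measurable)
  then show ?thesis
    unfolding nn_integral_gamma[OF chain f] nn_integral_gamma[OF chain borel_measurable_const]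
    by (simp add: divide_ennreal_def mult.commute)
qed

end

section \<open>Propagation of the bias through the generations\<close>

context feynman_kac
begin

text \<open>
  The quotient V_p, which interpolates between \<eta>_n(f) and m(\<xi>_n)(f).
\<close>

abbreviation ratio :: "nat \<Rightarrow> nat \<Rightarrow> nat \<Rightarrow> ((nat \<Rightarrow> 'a) \<Rightarrow> ennreal) \<Rightarrow> (nat \<Rightarrow> nat \<Rightarrow> 'a) \<Rightarrow> ennreal" where
  "ratio N p n f x \<equiv> (\<Sum>i\<in>{1..N}. Q p n f (x i)) / (\<Sum>i\<in>{1..N}. Q p n (\<lambda>_. 1) (x i))"

lemma iid_ratio_semigroup:
  assumes N: "N \<ge> 1" and pn: "p \<le> n" and r: "1 \<le> r"
    and f: "f \<in> borel_measurable (E n)"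
    and \<mu>: "sets \<mu> = sets (E p)" "prob_space \<mu>"
    and cmp: "\<And>x y. x \<in> space (E p) \<Longrightarrow> y \<in> space (E p) \<Longrightarrow> Q p n (\<lambda>_. 1) x \<le> ennreal r * Q p n (\<lambda>_. 1) y"
  defines "k \<equiv> ennreal (1 + r * (r - 1) / N)"
    and "\<alpha> \<equiv> (\<integral>\<^sup>+x. Q p n f x \<partial>\<mu>) / (\<integral>\<^sup>+x. Q p n (\<lambda>_. 1) x \<partial>\<mu>)"
  shows "(\<integral>\<^sup>+x. ratio N p n f x \<partial>PiM {1..N} (\<lambda>_. \<mu>)) \<le> k * \<alpha>"
    and "\<alpha> \<le> k * (\<integral>\<^sup>+x. ratio N p n f x \<partial>PiM {1..N} (\<lambda>_. \<mu>))"
proof -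
  interpret \<mu>: prob_space \<mu> by fact
  have sp: "space \<mu> = space (E p)"
    by (rule sets_eq_imp_space_eq) fact
  have F: "Q p n f \<in> borel_measurable \<mu>" and h: "Q p n (\<lambda>_. 1) \<in> borel_measurable \<mu>"
    using semigroup_measurable[OF pn] f by (auto simp: measurable_cong_sets[OF \<mu>(1) refl])
  let ?h = "\<integral>\<^sup>+x. Q p n (\<lambda>_. 1) x \<partial>\<mu>" and ?R = "\<integral>\<^sup>+x. ratio N p n f x \<partial>PiM {1..N} (\<lambda>_. \<mu>)"
  have pos: "0 < ?h"
    using semigroup_one[OF pn] sp by (intro nn_integral_pos \<mu> h) auto
  obtain y where y: "y \<in> space (E p)"
    using path_space_nonempty[of p] by auto
  have "?h \<le> (\<integral>\<^sup>+x. ennreal r * Q p n (\<lambda>_. 1) y \<partial>\<mu>)"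
    using cmp y sp by (intro nn_integral_mono) auto
  also have "\<dots> < \<top>"
    using semigroup_one[OF pn y] by (simp add: \<mu>.emeasure_space_1 ennreal_mult_less_top)
  finally have fin: "?h < \<top>" .
  have pos': "0 < Q p n (\<lambda>_. 1) x \<and> Q p n (\<lambda>_. 1) x < \<top>" if "x \<in> space \<mu>" for x
    using semigroup_one[OF pn] that sp by simp
  have cmp': "Q p n (\<lambda>_. 1) x \<le> ennreal r * Q p n (\<lambda>_. 1) y" if "x \<in> space \<mu>" "y \<in> space \<mu>" for x y
    using cmp that sp by simp
  have "{1..N} \<noteq> {}"
    using N by simp
  note iid = iid_ratio[OF \<mu>(2) finite_atLeastAtMost this r F h pos' cmp', unfolded card_atLeastAtMost diff_Suc_1]
  have 1: "?h * ?R \<le> k * (\<integral>\<^sup>+x. Q p n f x \<partial>\<mu>)"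
    unfolding k_def by (rule iid(1))
  have 2: "(\<integral>\<^sup>+x. Q p n f x \<partial>\<mu>) \<le> k * (?h * ?R)"
    unfolding k_def by (rule iid(2))
  have inv: "?h * inverse ?h = 1"
    using pos fin by (simp add: ennreal_divide_self flip: divide_ennreal_def)
  have "?R = ?R * (?h * inverse ?h)"
    by (simp only: inv mult_1_right)
  also have "\<dots> = ?h * ?R * inverse ?h"
    by (simp only: ac_simps)
  also have "\<dots> \<le> k * (\<integral>\<^sup>+x. Q p n f x \<partial>\<mu>) * inverse ?h"
    using 1 by (rule mult_right_mono) simp
  finally show "?R \<le> k * \<alpha>"
    by (simp add: \<alpha>_def divide_ennreal_def mult.assoc)
  have "\<alpha> \<le> k * (?h * ?R) * inverse ?h"
    unfolding \<alpha>_def divide_ennreal_def[of "\<integral>\<^sup>+x. Q p n f x \<partial>\<mu>"]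
    using 2 by (rule mult_right_mono) simp
  also have "\<dots> = k * (?h * inverse ?h * ?R)"
    by (simp only: ac_simps)
  finally show "\<alpha> \<le> k * ?R"
    by (simp add: inv)
qed

end

locale particle_system = feynman_kac S' \<eta>0 M' G'
  for S' :: "nat \<Rightarrow> 'a measure" and \<eta>0 M' G' +
  fixes P :: "'v measure" and N :: nat and \<xi> :: "nat \<Rightarrow> 'v \<Rightarrow> nat \<Rightarrow> nat \<Rightarrow> 'a"
  assumes N: "N \<ge> 1" and particles: "particle_model P S' \<eta>0 M' G' N \<xi>"
begin

abbreviation "\<Phi> p x \<equiv> fk_Phi S' M' G' (Suc p) (empirical N (E p) x)"
abbreviation "C n \<equiv> PiM {1..N} (\<lambda>_. E n)"

sublocale P: prob_space P
  using particles by (simp add: particle_model_def markov_chain_def)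

lemma \<xi>_measurable[measurable]: "\<xi> n \<in> measurable P (C n)"
  using particles by (simp add: particle_model_def markov_chain_def)

lemma \<xi>_space: "\<omega> \<in> space P \<Longrightarrow> i \<in> {1..N} \<Longrightarrow> \<xi> n \<omega> i \<in> space (E n)"
  using measurable_space[OF \<xi>_measurable, of \<omega> n] by (auto simp: space_PiM)

lemma \<xi>_init: "distr P (C 0) (\<xi> 0) = PiM {1..N} (\<lambda>_. path_init S' \<eta>0)"
  using particles by (simp add: particle_model_def markov_chain_def)

lemma nn_integral_Phi:
  assumes "\<And>i. i \<in> {1..N} \<Longrightarrow> x i \<in> space (E p)" "g \<in> borel_measurable (E (Suc p))"
  shows "(\<integral>\<^sup>+y. g y \<partial>\<Phi> p x) = (\<Sum>i\<in>{1..N}. ennreal (path_pot G' p (x i)) * (\<integral>\<^sup>+y. g y \<partial>M (Suc p) (x i)))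
    / (\<Sum>i\<in>{1..N}. ennreal (path_pot G' p (x i)))"
  unfolding fk_Phi_def diff_Suc_1
  by (rule nn_integral_resampling[OF N assms(1) path_pot_measurable path_pot_pos path_trans_kernel assms(2)])

lemma Phi_kernel: "\<Phi> p \<in> measurable (C p) (prob_algebra (E (Suc p)))"
  unfolding fk_Phi_def diff_Suc_1
  by (rule resampling_kernel[OF N path_pot_measurable path_pot_pos path_trans_kernel])

lemma Phi_prob:
  assumes "x \<in> space (C p)"
  shows "sets (\<Phi> p x) = sets (E (Suc p))" "prob_space (\<Phi> p x)"
  using measurable_space[OF Phi_kernel assms] by (auto simp: space_prob_algebra)

lemma particle_kernel: "(\<lambda>x. PiM {1..N} (\<lambda>_. \<Phi> p x)) \<in> measurable (C p) (prob_algebra (C (Suc p)))"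
  by (rule iid_kernel[OF _ Phi_kernel]) simp

lemma particle_step_history:
  assumes "\<phi> \<in> borel_measurable (PiM {..p} C \<Otimes>\<^sub>M C (Suc p))"
  shows "(\<integral>\<^sup>+\<omega>. \<phi> (\<lambda>k\<in>{..p}. \<xi> k \<omega>, \<xi> (Suc p) \<omega>) \<partial>P)
    = (\<integral>\<^sup>+\<omega>. (\<integral>\<^sup>+y. \<phi> (\<lambda>k\<in>{..p}. \<xi> k \<omega>, y) \<partial>PiM {1..N} (\<lambda>_. \<Phi> p (\<xi> p \<omega>))) \<partial>P)"
proof -
  have "(\<lambda>x. PiM {1..N} (\<lambda>_. fk_Phi S' M' G' (Suc p) (empirical N (E (Suc p - 1)) x)))
      \<in> measurable (C p) (prob_algebra (C (Suc p)))"
    using particle_kernel by simp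
  from markov_chain_nn_integral[OF particles[unfolded particle_model_def] this assms]
  show ?thesis by simp
qed

lemma particle_step:
  assumes [measurable]: "\<phi> \<in> borel_measurable (C (Suc p))"
  shows "(\<integral>\<^sup>+\<omega>. \<phi> (\<xi> (Suc p) \<omega>) \<partial>P) = (\<integral>\<^sup>+\<omega>. (\<integral>\<^sup>+y. \<phi> y \<partial>PiM {1..N} (\<lambda>_. \<Phi> p (\<xi> p \<omega>))) \<partial>P)"
  using particle_step_history[of "\<lambda>(_, y). \<phi> y" p] by simp

lemma ratio_measurable:
  assumes "p \<le> n" "f \<in> borel_measurable (E n)"
  shows "ratio N p n f \<in> borel_measurable (C p)"
proof -
  have [measurable]: "Q p n f \<in> borel_measurable (E p)" "Q p n (\<lambda>_. 1) \<in> borel_measurable (E p)"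
    using assms by (auto intro: semigroup_measurable)
  show ?thesis
    by (intro borel_measurable_divide_ennreal borel_measurable_sum) measurable
qed

text \<open>
  Numerator and denominator have the same normalising constant m(x)(G_p).
\<close>

lemma ratio_Phi:
  assumes p: "p < n" and f: "f \<in> borel_measurable (E n)" and x: "x \<in> space (C p)"
  shows "(\<integral>\<^sup>+y. Q (Suc p) n f y \<partial>\<Phi> p x) / (\<integral>\<^sup>+y. Q (Suc p) n (\<lambda>_. 1) y \<partial>\<Phi> p x) = ratio N p n f x"
proof -
  have xi: "x i \<in> space (E p)" if "i \<in> {1..N}" for i
    using x that by (auto simp: space_PiM)
  have eq: "(\<integral>\<^sup>+y. Q (Suc p) n g y \<partial>\<Phi> p x) = (\<Sum>i\<in>{1..N}. Q p n g (x i)) / (\<Sum>i\<in>{1..N}. ennreal (path_pot G' p (x i)))"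
    if g: "g \<in> borel_measurable (E n)" for g
  proof -
    have m: "Q (Suc p) n g \<in> borel_measurable (E (Suc p))"
      using p g by (intro semigroup_measurable) auto
    have "(\<integral>\<^sup>+y. Q (Suc p) n g y \<partial>\<Phi> p x)
      = (\<Sum>i\<in>{1..N}. ennreal (path_pot G' p (x i)) * (\<integral>\<^sup>+y. Q (Suc p) n g y \<partial>M (Suc p) (x i)))
        / (\<Sum>i\<in>{1..N}. ennreal (path_pot G' p (x i)))"
      by (rule nn_integral_Phi[OF xi m])
    also have "\<dots> = (\<Sum>i\<in>{1..N}. Q p n g (x i)) / (\<Sum>i\<in>{1..N}. ennreal (path_pot G' p (x i)))"
      by (intro arg_cong2[where f="(/)"] sum.cong refl)
        (simp only: semigroup_left[OF p] nn_integral_fk_Q[OF xi m])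
    finally show ?thesis .
  qed
  define s where "s = (\<Sum>i\<in>{1..N}. path_pot G' p (x i))"
  have s: "0 < s"
    unfolding s_def using N xi path_pot_pos by (intro sum_pos) auto
  have S: "(\<Sum>i\<in>{1..N}. ennreal (path_pot G' p (x i))) = ennreal s"
    unfolding s_def using xi path_pot_pos by (intro sum_ennreal) (auto intro: less_imp_le)
  define b where "b = (\<Sum>i\<in>{1..N}. Q p n (\<lambda>_. 1) (x i))"
  have "b < \<top>"
    using semigroup_one(2)[OF _ xi] p by (simp add: b_def less_top)
  moreover have "inverse (ennreal s) * ennreal s = 1"
    using s by (simp add: inverse_ennreal flip: ennreal_mult'')
  moreover have "inverse (inverse (ennreal s)) = ennreal s"
    using s by (simp add: inverse_ennreal)
  moreover have "inverse (ennreal s) < \<top>"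
    using s by (simp add: inverse_ennreal)
  ultimately have "a / ennreal s / (b / ennreal s) = a / b" for a
    by (simp add: divide_ennreal_def ennreal_inverse_mult mult.assoc mult.left_commute[of "inverse (ennreal s)"])
  then show ?thesis
    unfolding eq[OF f] eq[OF borel_measurable_const] S b_def .
qed

lemma ratio_step:
  assumes p: "p < n" and r: "1 \<le> r" and f: "f \<in> borel_measurable (E n)"
    and cmp: "\<And>x y. x \<in> space (E (Suc p)) \<Longrightarrow> y \<in> space (E (Suc p)) \<Longrightarrow>
        Q (Suc p) n (\<lambda>_. 1) x \<le> ennreal r * Q (Suc p) n (\<lambda>_. 1) y"
  defines "k \<equiv> ennreal (1 + r * (r - 1) / N)"
  shows "(\<integral>\<^sup>+\<omega>. ratio N (Suc p) n f (\<xi> (Suc p) \<omega>) \<partial>P) \<le> k * (\<integral>\<^sup>+\<omega>. ratio N p n f (\<xi> p \<omega>) \<partial>P)"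
    and "(\<integral>\<^sup>+\<omega>. ratio N p n f (\<xi> p \<omega>) \<partial>P) \<le> k * (\<integral>\<^sup>+\<omega>. ratio N (Suc p) n f (\<xi> (Suc p) \<omega>) \<partial>P)"
proof -
  have p': "Suc p \<le> n" "p \<le> n" using p by auto
  note [measurable] = ratio_measurable[OF p'(1) f] ratio_measurable[OF p'(2) f]
  let ?I = "\<lambda>\<omega>. \<integral>\<^sup>+y. ratio N (Suc p) n f y \<partial>PiM {1..N} (\<lambda>_. \<Phi> p (\<xi> p \<omega>))"
  have x: "\<xi> p \<omega> \<in> space (C p)" if "\<omega> \<in> space P" for \<omega>
    using measurable_space[OF \<xi>_measurable that] .
  have iid: "?I \<omega> \<le> k * ratio N p n f (\<xi> p \<omega>)" "ratio N p n f (\<xi> p \<omega>) \<le> k * ?I \<omega>" if \<omega>: "\<omega> \<in> space P" for \<omega>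
    using iid_ratio_semigroup[OF N p'(1) r f Phi_prob[OF x[OF \<omega>]] cmp]
    unfolding ratio_Phi[OF p f x[OF \<omega>]] k_def by auto
  have Im: "?I \<in> borel_measurable P"
  proof -
    have "(\<lambda>x. \<integral>\<^sup>+y. ratio N (Suc p) n f y \<partial>PiM {1..N} (\<lambda>_. \<Phi> p x)) \<in> borel_measurable (C p)"
      by (rule nn_integral_measurable_subprob_algebra2[OF _ measurable_prob_algebraD[OF particle_kernel]])
         measurable
    then show ?thesis by measurable
  qed
  have eq: "(\<integral>\<^sup>+\<omega>. ratio N (Suc p) n f (\<xi> (Suc p) \<omega>) \<partial>P) = (\<integral>\<^sup>+\<omega>. ?I \<omega> \<partial>P)"
    by (rule particle_step) measurable
  have "(\<integral>\<^sup>+\<omega>. ?I \<omega> \<partial>P) \<le> (\<integral>\<^sup>+\<omega>. k * ratio N p n f (\<xi> p \<omega>) \<partial>P)"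
    by (intro nn_integral_mono iid)
  also have "\<dots> = k * (\<integral>\<^sup>+\<omega>. ratio N p n f (\<xi> p \<omega>) \<partial>P)"
    by (rule nn_integral_cmult) measurable
  finally show "(\<integral>\<^sup>+\<omega>. ratio N (Suc p) n f (\<xi> (Suc p) \<omega>) \<partial>P) \<le> k * (\<integral>\<^sup>+\<omega>. ratio N p n f (\<xi> p \<omega>) \<partial>P)"
    unfolding eq .
  have "(\<integral>\<^sup>+\<omega>. ratio N p n f (\<xi> p \<omega>) \<partial>P) \<le> (\<integral>\<^sup>+\<omega>. k * ?I \<omega> \<partial>P)"
    by (intro nn_integral_mono iid)
  also have "\<dots> = k * (\<integral>\<^sup>+\<omega>. ?I \<omega> \<partial>P)"
    by (rule nn_integral_cmult[OF Im])
  finally show "(\<integral>\<^sup>+\<omega>. ratio N p n f (\<xi> p \<omega>) \<partial>P) \<le> k * (\<integral>\<^sup>+\<omega>. ratio N (Suc p) n f (\<xi> (Suc p) \<omega>) \<partial>P)"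
    unfolding eq .
qed

lemma ratio_init:
  assumes r: "1 \<le> r" and f: "f \<in> borel_measurable (E n)"
    and cmp: "\<And>x y. x \<in> space (E 0) \<Longrightarrow> y \<in> space (E 0) \<Longrightarrow>
        Q 0 n (\<lambda>_. 1) x \<le> ennreal r * Q 0 n (\<lambda>_. 1) y"
    and chain: "markov_chain PX S' \<eta>0 M' X'"
  defines "k \<equiv> ennreal (1 + r * (r - 1) / N)" and "\<alpha> \<equiv> \<integral>\<^sup>+x. f x \<partial>fk_eta PX S' G' X' n"
  shows "(\<integral>\<^sup>+\<omega>. ratio N 0 n f (\<xi> 0 \<omega>) \<partial>P) \<le> k * \<alpha>"
    and "\<alpha> \<le> k * (\<integral>\<^sup>+\<omega>. ratio N 0 n f (\<xi> 0 \<omega>) \<partial>P)"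
proof -
  have "(\<integral>\<^sup>+\<omega>. ratio N 0 n f (\<xi> 0 \<omega>) \<partial>P) = (\<integral>\<^sup>+x. ratio N 0 n f x \<partial>PiM {1..N} (\<lambda>_. path_init S' \<eta>0))"
    unfolding \<xi>_init[symmetric] by (rule nn_integral_distr[symmetric]) (auto intro: ratio_measurable f)
  then show "(\<integral>\<^sup>+\<omega>. ratio N 0 n f (\<xi> 0 \<omega>) \<partial>P) \<le> k * \<alpha>"
    and "\<alpha> \<le> k * (\<integral>\<^sup>+\<omega>. ratio N 0 n f (\<xi> 0 \<omega>) \<partial>P)"
    unfolding k_def \<alpha>_def nn_integral_eta[OF chain f]
    using iid_ratio_semigroup[OF N _ r f path_init cmp] by auto
qed

text \<open>
  Each of the n steps from the initial law to \<xi>_{n-1} costs a factor k; the step to \<xi>_n is exact.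
\<close>

lemma mean_bounds:
  assumes r: "1 \<le> r" and f: "f \<in> borel_measurable (E n)"
    and cmp: "\<And>p x y. p \<le> n \<Longrightarrow> x \<in> space (E p) \<Longrightarrow> y \<in> space (E p) \<Longrightarrow>
        Q p n (\<lambda>_. 1) x \<le> ennreal r * Q p n (\<lambda>_. 1) y"
    and chain: "markov_chain PX S' \<eta>0 M' X'"
  defines "k \<equiv> ennreal (1 + r * (r - 1) / N)" and "\<alpha> \<equiv> \<integral>\<^sup>+x. f x \<partial>fk_eta PX S' G' X' n"
    and "\<beta> \<equiv> \<integral>\<^sup>+\<omega>. (\<Sum>i\<in>{1..N}. f (\<xi> n \<omega> i)) / of_nat N \<partial>P"
  shows "\<beta> \<le> k ^ n * \<alpha>" and "\<alpha> \<le> k ^ n * \<beta>"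
proof -
  define V where "V p = (\<integral>\<^sup>+\<omega>. ratio N p n f (\<xi> p \<omega>) \<partial>P)" for p
  have V: "V p \<le> k ^ Suc p * \<alpha> \<and> \<alpha> \<le> k ^ Suc p * V p" if "p < n" for p
    using that
  proof (induction p)
    case 0
    then show ?case
      using ratio_init[OF r f cmp chain] by (simp add: V_def k_def \<alpha>_def)
  next
    case (Suc p)
    then have IH: "V p \<le> k ^ Suc p * \<alpha>" "\<alpha> \<le> k ^ Suc p * V p" by auto
    have step: "V (Suc p) \<le> k * V p" "V p \<le> k * V (Suc p)"
      using ratio_step[OF _ r f cmp, of p] Suc.prems by (auto simp: V_def k_def)
    have "V (Suc p) \<le> k * (k ^ Suc p * \<alpha>)"
      using step(1) mult_left_mono[OF IH(1), of k] by (auto intro: order_trans)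
    moreover have "\<alpha> \<le> k ^ Suc p * (k * V (Suc p))"
      using IH(2) mult_left_mono[OF step(2), of "k ^ Suc p"] by (auto intro: order_trans)
    ultimately show ?case
      by (simp add: ac_simps)
  qed
  \<comment> \<open>\<open>Q n n\<close> is the identity, so the last step has a constant denominator and falls under r = 1\<close>
  have cmp1: "Q n n (\<lambda>_. 1) x \<le> ennreal 1 * Q n n (\<lambda>_. 1) y" for x y
    by simp
  have Vn: "V n = \<beta>"
    by (simp add: V_def \<beta>_def)
  have "\<beta> \<le> k ^ n * \<alpha> \<and> \<alpha> \<le> k ^ n * \<beta>"
  proof (cases n)
    case 0
    have "V 0 \<le> \<alpha>" "\<alpha> \<le> V 0"
      using ratio_init[OF order_refl f _ chain] cmp1 unfolding 0 by (auto simp: V_def \<alpha>_def 0)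
    then show ?thesis
      by (simp add: 0 flip: Vn)
  next
    case (Suc m)
    have "V n \<le> V m" "V m \<le> V n"
      using ratio_step[OF _ order_refl f, of m] cmp1 unfolding Suc by (auto simp: V_def Suc)
    moreover have "V m \<le> k ^ n * \<alpha>" "\<alpha> \<le> k ^ n * V m"
      using V[of m] by (auto simp: Suc)
    ultimately show ?thesis
      by (simp add: Vn)
  qed
  then show "\<beta> \<le> k ^ n * \<alpha>" and "\<alpha> \<le> k ^ n * \<beta>" by auto
qed

end

section \<open>The backward kernel as a finite sum\<close>

locale backward_particle_system = particle_system S' \<eta>0 M' G' P N \<xi>
  for S' :: "nat \<Rightarrow> 'a measure" and \<eta>0 M' G' and P :: "'v measure" and N \<xi> +
  fixes H' :: "nat \<Rightarrow> 'a \<Rightarrow> 'a \<Rightarrow> ennreal" and \<nu>' :: "nat \<Rightarrow> 'a measure"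
  assumes densities: "transition_densities S' M' G' H' \<nu>'"
begin

abbreviation "T n \<equiv> PiM {1..N} (\<lambda>_. S' n)"

text \<open>
  The conditional probability that a particle at v descends from the particle at z, if c lists the
  terminal states of the previous generation. The two divisions by N are the two occurrences of the
  empirical measure in the kernel.
\<close>

definition weight :: "nat \<Rightarrow> (nat \<Rightarrow> 'a) \<Rightarrow> 'a \<Rightarrow> 'a \<Rightarrow> ennreal" where
  "weight n c z v = H' (Suc n) z v / ((\<Sum>l\<in>{1..N}. H' (Suc n) (c l) v) / of_nat N) / of_nat N"

text \<open>
  The integral of f against the backward kernel from the state x at time n, as a nested sum over
  the indices of the ancestors; c k i is the terminal state of particle i of generation k.
\<close>

fun backward :: "(nat \<Rightarrow> nat \<Rightarrow> 'a) \<Rightarrow> nat \<Rightarrow> 'a \<Rightarrow> ((nat \<Rightarrow> 'a) \<Rightarrow> ennreal) \<Rightarrow> ennreal" where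
  "backward c 0 x f = f (\<lambda>k\<in>{..0}. x)"
| "backward c (Suc n) x f = (\<Sum>i\<in>{1..N}. weight n (c n) (c n i) x * backward c n (c n i) (\<lambda>y. f (y(Suc n := x))))"

lemma H'_measurable[measurable]:
  "(\<lambda>(x, y). H' (Suc k) x y) \<in> borel_measurable (S' k \<Otimes>\<^sub>M S' (Suc k))"
  using densities by (simp add: transition_densities_def)

lemma H'_compose[measurable]:
  assumes "f \<in> measurable A (S' k)" "g \<in> measurable A (S' (Suc k))"
  shows "(\<lambda>\<omega>. H' (Suc k) (f \<omega>) (g \<omega>)) \<in> borel_measurable A"
  using measurable_compose[OF measurable_Pair[OF assms] H'_measurable] by simp

lemma sets_\<nu>'[measurable_cong]: "sets (\<nu>' (Suc k)) = sets (S' (Suc k))"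
  using densities by (simp add: transition_densities_def)

lemma weight_measurable:
  assumes [measurable]: "f \<in> measurable A (S' k)" "g \<in> measurable A (S' (Suc k))"
    and c: "\<And>l. l \<in> {1..N} \<Longrightarrow> (\<lambda>\<omega>. c \<omega> l) \<in> measurable A (S' k)"
  shows "(\<lambda>\<omega>. weight k (c \<omega>) (f \<omega>) (g \<omega>)) \<in> borel_measurable A"
proof -
  have sum: "(\<lambda>\<omega>. \<Sum>l\<in>{1..N}. H' (Suc k) (c \<omega> l) (g \<omega>)) \<in> borel_measurable A"
    by (intro borel_measurable_sum H'_compose c) measurable
  show ?thesis
    unfolding weight_def
    by (intro borel_measurable_divide_ennreal H'_compose sum assms borel_measurable_const)
qed

lemma weight_cong: "(\<And>l. l \<in> {1..N} \<Longrightarrow> c l = c' l) \<Longrightarrow> weight n c z v = weight n c' z v"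
  unfolding weight_def
  by (intro arg_cong2[where f="(/)"] sum.cong refl) simp

text \<open>
  The denominator contains the numerator as a summand; if it is 0 or infinite, the weight is 0 by convention.
  Consequently the backward kernel integrates every measurable real function.
\<close>

lemma weight_finite:
  assumes i: "i \<in> {1..N}"
  shows "weight n c (c i) v < \<top>"
proof -
  define D where "D = (\<Sum>l\<in>{1..N}. H' (Suc n) (c l) v)"
  define h where "h = H' (Suc n) (c i) v"
  have le: "h \<le> D"
    unfolding D_def h_def by (rule member_le_sum) (use i in auto)
  have N': "(of_nat N :: ennreal) \<noteq> 0" "(of_nat N :: ennreal) \<noteq> \<top>"
    using N by (auto simp: of_nat_less_top less_top)
  consider "h = 0" | "D = \<top>" | "h \<noteq> 0" "D \<noteq> \<top>" by blast
  then have "h / (D / of_nat N) < \<top>"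
  proof cases
    case 2
    then show ?thesis
      using N' by (simp add: ennreal_top_divide)
  next
    case 3
    then show ?thesis
      using le N unfolding ennreal_of_nat_eq_real_of_nat
      by (cases D; cases h) (auto simp: divide_ennreal top_unique)
  qed simp
  then show ?thesis
    unfolding weight_def D_def[symmetric] h_def[symmetric] ennreal_of_nat_eq_real_of_nat using N
    by (cases "h / (D / ennreal (real N))") (auto simp: divide_ennreal)
qed

text \<open>
  Bayes' formula: the density of v times the conditional probability of the ancestor is the joint density.
\<close>

lemma sum_weight:
  assumes D: "(\<Sum>l\<in>{1..N}. H' (Suc n) (c l) v) < \<top>" and i: "i \<in> {1..N}"
  shows "(\<Sum>l\<in>{1..N}. H' (Suc n) (c l) v) * weight n c (c i) v = H' (Suc n) (c i) v"
proof -
  define D where "D = (\<Sum>l\<in>{1..N}. H' (Suc n) (c l) v)"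
  define h where "h = H' (Suc n) (c i) v"
  have le: "h \<le> D"
    unfolding D_def h_def by (rule member_le_sum) (use i in auto)
  obtain d where d: "D = ennreal d" "0 \<le> d"
    using D unfolding D_def[symmetric] by (cases D) auto
  obtain a where a: "h = ennreal a" "0 \<le> a"
    using le d by (cases h) (auto simp: top_unique)
  have N': "0 < real N" using N by simp
  show ?thesis
    unfolding weight_def D_def[symmetric] h_def[symmetric]
  proof (cases "d = 0")
    case True
    then show "D * (h / (D / of_nat N) / of_nat N) = h"
      using le d by simp
  next
    case False
    then have "0 < d" using d by simp
    then show "D * (h / (D / of_nat N) / of_nat N) = h"
      unfolding d(1) a(1) ennreal_of_nat_eq_real_of_nat using N' a(2)
      by (simp add: divide_ennreal flip: ennreal_mult'')
  qed
qed

text \<open>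
  The kernel is carried by paths that end at z.
\<close>

lemma backward_cong:
  assumes "\<And>k i. k < n \<Longrightarrow> i \<in> {1..N} \<Longrightarrow> c k i \<in> space (S' k)" "z \<in> space (S' n)"
    and "\<And>y. y \<in> space (E n) \<Longrightarrow> y n = z \<Longrightarrow> f y = g y"
  shows "backward c n z f = backward c n z g"
  using assms
proof (induction n arbitrary: z f g)
  case 0
  then show ?case
    by (simp add: path_space_def space_PiM)
next
  case (Suc n)
  have "backward c n (c n i) (\<lambda>y. f (y(Suc n := z))) = backward c n (c n i) (\<lambda>y. g (y(Suc n := z)))" if "i \<in> {1..N}" for i
    using that by (intro Suc.IH Suc.prems path_extend_space fun_upd_same) auto
  then show ?case
    by simp
qed

lemma backward_history_cong:
  "(\<And>k i. k < n \<Longrightarrow> i \<in> {1..N} \<Longrightarrow> c k i = c' k i) \<Longrightarrow> backward c n z f = backward c' n z f"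
proof (induction n arbitrary: z f)
  case (Suc n)
  have "weight n (c n) (c n i) z = weight n (c' n) (c' n i) z" if "i \<in> {1..N}" for i
    using that Suc.prems weight_cong[of "c n" "c' n"] by (metis lessI)
  then show ?case
    using Suc by simp
qed simp

lemma backward_cmult: "backward c n z (\<lambda>x. a * f x) = a * backward c n z f"
  by (induction n arbitrary: z f) (auto simp: sum_distrib_left ac_simps)

lemma backward_sum: "backward c n z (\<lambda>x. \<Sum>j\<in>J. f j x) = (\<Sum>j\<in>J. backward c n z (f j))"
proof (induction n arbitrary: z f)
  case (Suc n)
  show ?case
    by (simp add: Suc sum_distrib_left) (rule sum.swap)
qed simp

lemma backward_finite:
  assumes "\<And>k i. k < n \<Longrightarrow> i \<in> {1..N} \<Longrightarrow> c k i \<in> space (S' k)" "z \<in> space (S' n)"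
    and "\<And>y. y \<in> space (E n) \<Longrightarrow> f y < \<top>"
  shows "backward c n z f < \<top>"
  using assms
proof (induction n arbitrary: z f)
  case 0
  then show ?case
    by (simp add: path_space_def space_PiM)
next
  case (Suc n)
  have "backward c n (c n i) (\<lambda>y. f (y(Suc n := z))) < \<top>" if "i \<in> {1..N}" for i
    using that by (intro Suc.IH Suc.prems path_extend_space) auto
  then show ?case
    using weight_finite by (simp add: ennreal_mult_less_top)
qed

lemma backward_measurable:
  assumes "\<And>k i. k < n \<Longrightarrow> i \<in> {1..N} \<Longrightarrow> (\<lambda>\<omega>. c \<omega> k i) \<in> measurable A (S' k)"
    and "z \<in> measurable A (S' n)" and "(\<lambda>(\<omega>, x). F \<omega> x) \<in> borel_measurable (A \<Otimes>\<^sub>M E n)"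
  shows "(\<lambda>\<omega>. backward (c \<omega>) n (z \<omega>) (F \<omega>)) \<in> borel_measurable A"
  using assms
proof (induction n arbitrary: z F)
  case 0
  note 0(2)[measurable]
  have "(\<lambda>\<omega>. \<lambda>k\<in>{..0}. z \<omega>) \<in> measurable A (E 0)"
    unfolding path_space_def by (rule measurable_restrict) simp
  then have "(\<lambda>\<omega>. (\<omega>, \<lambda>k\<in>{..0}. z \<omega>)) \<in> measurable A (A \<Otimes>\<^sub>M E 0)"
    by (rule measurable_Pair[OF measurable_ident_sets[OF refl]])
  from measurable_compose[OF this 0(3)] show ?case
    by simp
next
  case (Suc n)
  note Suc.prems(2,3)[measurable]
  have c[measurable]: "i \<in> {1..N} \<Longrightarrow> (\<lambda>\<omega>. c \<omega> n i) \<in> measurable A (S' n)" for i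
    using Suc.prems by auto
  have "(\<lambda>z'. (fst z', (snd z')(Suc n := z (fst z')))) \<in> measurable (A \<Otimes>\<^sub>M E n) (A \<Otimes>\<^sub>M E (Suc n))"
    by measurable
  from measurable_compose[OF this Suc.prems(3)]
  have F: "(\<lambda>(\<omega>, y). F \<omega> (y(Suc n := z \<omega>))) \<in> borel_measurable (A \<Otimes>\<^sub>M E n)"
    by (simp add: split_beta')
  show ?case
    unfolding backward.simps
    by (intro borel_measurable_sum borel_measurable_times_ennreal weight_measurable Suc.IH c F Suc.prems) auto
qed

text \<open>
  A form of Fubini's theorem for arbitrary K: one of the two integrals is a finite sum.
\<close>

lemma backward_swap:
  assumes "\<And>k i. k < n \<Longrightarrow> i \<in> {1..N} \<Longrightarrow> c k i \<in> space (S' k)" "z \<in> space (S' n)"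
    and "\<And>x. x \<in> space (E n) \<Longrightarrow> (\<lambda>u. F u x) \<in> borel_measurable K"
  shows "(\<lambda>u. backward c n z (F u)) \<in> borel_measurable K \<and>
    (\<integral>\<^sup>+u. backward c n z (F u) \<partial>K) = backward c n z (\<lambda>x. \<integral>\<^sup>+u. F u x \<partial>K)"
  using assms
proof (induction n arbitrary: z F)
  case 0
  then show ?case
    by (simp add: path_space_def space_PiM)
next
  case (Suc n)
  have IH: "(\<lambda>u. backward c n (c n i) (\<lambda>y. F u (y(Suc n := z)))) \<in> borel_measurable K"
    "(\<integral>\<^sup>+u. backward c n (c n i) (\<lambda>y. F u (y(Suc n := z))) \<partial>K) = backward c n (c n i) (\<lambda>y. \<integral>\<^sup>+u. F u (y(Suc n := z)) \<partial>K)"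
    if "i \<in> {1..N}" for i
    using that Suc.IH[of "c n i" "\<lambda>u y. F u (y(Suc n := z))"] Suc.prems path_extend_space[of _ n z] by auto
  have m: "(\<lambda>u. weight n (c n) (c n i) z * backward c n (c n i) (\<lambda>y. F u (y(Suc n := z)))) \<in> borel_measurable K"
    if "i \<in> {1..N}" for i
    using IH(1)[OF that] by measurable
  have "(\<integral>\<^sup>+u. backward c (Suc n) z (F u) \<partial>K)
    = (\<Sum>i\<in>{1..N}. \<integral>\<^sup>+u. weight n (c n) (c n i) z * backward c n (c n i) (\<lambda>y. F u (y(Suc n := z))) \<partial>K)"
    unfolding backward.simps by (rule nn_integral_sum) (rule m)
  also have "\<dots> = backward c (Suc n) z (\<lambda>x. \<integral>\<^sup>+u. F u x \<partial>K)"
    unfolding backward.simps by (intro sum.cong refl) (simp only: nn_integral_cmult[OF IH(1)] IH(2))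
  finally show ?case
    unfolding backward.simps using m by auto
qed

text \<open>
  The factor at time n of the product measure is a point mass. Integrating over the remaining coordinates from the
  last to the first, every integral is an average over N particles and contributes one weight.
\<close>

lemma nn_integral_backward_kernel:
  assumes c: "\<And>k i. i \<in> {1..N} \<Longrightarrow> c k i \<in> space (S' k)" and x: "x \<in> space (S' n)"
    and f: "f \<in> borel_measurable (E n)"
  shows "(\<integral>\<^sup>+y. f y \<partial>backward_kernel S' H' (\<lambda>k. empirical N (S' k) (c k)) n x) = backward c n x f"
proof -
  let ?m = "\<lambda>k. empirical N (S' k) (c k)"
  define D where "D k v = (\<Sum>l\<in>{1..N}. H' (Suc k) (c k l) v) / of_nat N" for k v
  have D: "(\<integral>\<^sup>+z. H' (Suc k) z v \<partial>?m k) = D k v" if "v \<in> space (S' (Suc k))" for k v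
    unfolding D_def using that by (intro nn_integral_empirical N c) auto
  have D_meas[measurable]: "D k \<in> borel_measurable (S' (Suc k))" for k
    unfolding D_def using c by (intro borel_measurable_divide_ennreal borel_measurable_sum H'_compose) auto
  define W where "W n y = (\<Prod>k<n. H' (Suc k) (y k) (y (Suc k)) / D k (y (Suc k)))" for n y
  have W_meas[measurable]: "W n \<in> borel_measurable (E n)" for n
    unfolding W_def by (intro borel_measurable_prod_ennreal borel_measurable_divide_ennreal H'_compose
        measurable_compose[OF _ D_meas]) auto
  have pm: "prob_space (?m k)" for k
    by (rule prob_space_empirical[OF N c])
  interpret m: product_prob_space ?m
    by (simp add: product_prob_space_def product_sigma_finite_def product_prob_space_axioms_def pm
        prob_space_imp_sigma_finite)
  define J where "J n x f = (\<integral>\<^sup>+y. W n (y(n := x)) * f (y(n := x)) \<partial>PiM {..<n} ?m)" for n x and f :: "_ \<Rightarrow> ennreal"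
  have upd: "(\<lambda>(y, z). y(n := z)) \<in> measurable (PiM {..<n} S' \<Otimes>\<^sub>M S' n) (E n)" for n
    using measurable_add_dim[where I="{..<n}" and M=S' and i=n]
    by (simp add: path_space_def lessThan_Suc_atMost flip: lessThan_Suc)
  have setsPi[measurable_cong]: "sets (PiM {..<n} ?m) = sets (PiM {..<n} S')" for n
    by (intro sets_PiM_cong) auto
  have upd'[measurable]: "(\<lambda>y. (g y)(n := h y)) \<in> measurable A (E n)"
    if "g \<in> measurable A (PiM {..<n} S')" "h \<in> measurable A (S' n)" for g h n and A :: "'z measure"
    using measurable_compose[OF measurable_Pair[OF that] upd] by simp
  have J_eq: "(\<integral>\<^sup>+y. f y \<partial>backward_kernel S' H' ?m n x) = J n x f"
    if x: "x \<in> space (S' n)" and f[measurable]: "f \<in> borel_measurable (E n)" for n x f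
  proof -
    let ?m' = "\<lambda>k. if k = n then return (S' n) x else ?m k"
    have "prob_space (?m' k)" for k
      using pm prob_space_return[OF x] by auto
    then interpret m': product_prob_space ?m'
      by (simp add: product_prob_space_def product_sigma_finite_def product_prob_space_axioms_def
          prob_space_imp_sigma_finite)
    have s[measurable_cong]: "sets (PiM {..n} ?m') = sets (E n)"
      unfolding path_space_def by (intro sets_PiM_cong) auto
    have ins: "{..n} = insert n {..<n}" by auto
    define W0 where "W0 y = (\<Prod>k<n. H' (Suc k) (y k) (y (Suc k)) / (\<integral>\<^sup>+z. H' (Suc k) z (y (Suc k)) \<partial>?m k))" for y
    have W0: "W0 y = W n y" if "y \<in> space (E n)" for y
      unfolding W0_def W_def using that
      by (intro prod.cong refl) (simp add: D path_component_space)
    have W0_meas[measurable]: "W0 \<in> borel_measurable (E n)"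
      by (subst measurable_cong[OF W0]) measurable
    have "(\<integral>\<^sup>+y. f y \<partial>backward_kernel S' H' ?m n x) = (\<integral>\<^sup>+y. W0 y * f y \<partial>PiM {..n} ?m')"
      unfolding backward_kernel_def W0_def[symmetric] by (rule nn_integral_density) measurable
    also have "\<dots> = (\<integral>\<^sup>+y. W n y * f y \<partial>PiM {..n} ?m')"
      using sets_eq_imp_space_eq[OF s] by (intro nn_integral_cong) (simp add: W0)
    also have "\<dots> = (\<integral>\<^sup>+y. (\<integral>\<^sup>+z. W n (y(n := z)) * f (y(n := z)) \<partial>return (S' n) x) \<partial>PiM {..<n} ?m')"
    proof -
      have "(\<lambda>y. W n y * f y) \<in> borel_measurable (PiM (insert n {..<n}) ?m')"
        unfolding ins[symmetric] by measurable
      from m'.product_nn_integral_insert[OF _ _ this] show ?thesis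
        unfolding ins by simp
    qed
    also have "\<dots> = (\<integral>\<^sup>+y. (\<integral>\<^sup>+z. W n (y(n := z)) * f (y(n := z)) \<partial>return (S' n) x) \<partial>PiM {..<n} ?m)"
      by (intro arg_cong2[where f="nn_integral"] PiM_cong) auto
    also have "\<dots> = J n x f"
      unfolding J_def
    proof (intro nn_integral_cong nn_integral_return x)
      fix y assume "y \<in> space (PiM {..<n} ?m)"
      then have "y \<in> space (PiM {..<n} S')"
        using sets_eq_imp_space_eq[OF setsPi] by simp
      then show "(\<lambda>z. W n (y(n := z)) * f (y(n := z))) \<in> borel_measurable (S' n)"
        by measurable
    qed
    finally show ?thesis .
  qed
  have "J n x f = backward c n x f"
    using x f
  proof (induction n arbitrary: x f)
    case 0
    have "(\<lambda>k. undefined)(0::nat := x) = (\<lambda>k\<in>{..0}. x)"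
      by (auto simp: fun_eq_iff)
    then show ?case
      by (simp add: J_def W_def m.nn_integral_empty)
  next
    case (Suc n)
    note Suc.prems(2)[measurable]
    let ?g = "\<lambda>y. f (y(Suc n := x))"
    have g[measurable]: "?g \<in> borel_measurable (E n)"
      using Suc.prems(1) by measurable
    have W_Suc: "W (Suc n) (y(n := z, Suc n := x)) = H' (Suc n) z x / D n x * W n (y(n := z))" for y z
      by (auto simp: W_def mult.commute intro!: arg_cong2[where f="(*)"] prod.cong)
    have [measurable]: "(\<lambda>y. W (Suc n) (y(Suc n := x)) * f (y(Suc n := x))) \<in> borel_measurable (PiM (insert n {..<n}) ?m)"
    proof -
      have s: "sets (PiM (insert n {..<n}) ?m) = sets (E n)"
        unfolding path_space_def by (intro sets_PiM_cong) auto
      show ?thesis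
        unfolding measurable_cong_sets[OF s refl] using Suc.prems(1) by measurable
    qed
    have Jm: "(\<lambda>z. J n z ?g) \<in> borel_measurable (S' n)"
    proof -
      interpret prob_space "PiM {..<n} ?m"
        by (rule prob_space_PiM) (rule pm)
      show ?thesis
        unfolding J_def by measurable
    qed
    have "J (Suc n) x f = (\<integral>\<^sup>+z. (\<integral>\<^sup>+y. W (Suc n) (y(n := z, Suc n := x)) * f (y(n := z, Suc n := x)) \<partial>PiM {..<n} ?m) \<partial>?m n)"
      unfolding J_def lessThan_Suc by (subst m.product_nn_integral_insert_rev) auto
    also have "\<dots> = (\<integral>\<^sup>+z. H' (Suc n) z x / D n x * J n z ?g \<partial>?m n)"
    proof (intro nn_integral_cong)
      fix z assume "z \<in> space (?m n)"
      then have z: "z \<in> space (S' n)" by (simp add: empirical_def)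
      show "(\<integral>\<^sup>+y. W (Suc n) (y(n := z, Suc n := x)) * f (y(n := z, Suc n := x)) \<partial>PiM {..<n} ?m) = H' (Suc n) z x / D n x * J n z ?g"
        unfolding W_Suc J_def mult.assoc using z by (subst nn_integral_cmult) auto
    qed
    also have "\<dots> = (\<Sum>i\<in>{1..N}. H' (Suc n) (c n i) x / D n x * J n (c n i) ?g) / of_nat N"
      using Suc.prems(1) Jm by (intro nn_integral_empirical N c) auto
    also have "\<dots> = (\<Sum>i\<in>{1..N}. weight n (c n) (c n i) x * J n (c n i) ?g)"
      unfolding weight_def D_def[symmetric]
      by (simp add: divide_ennreal_def[of _ "of_nat N"] sum_distrib_left sum_distrib_right ac_simps)
    also have "\<dots> = backward c (Suc n) x f"
      unfolding backward.simps by (intro sum.cong refl arg_cong2[where f="(*)"] Suc.IH c g)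
    finally show ?case .
  qed
  with J_eq[OF x f] show ?thesis by simp
qed

end

section \<open>Ancestral lines given the terminal states\<close>

context backward_particle_system
begin

abbreviation "tips n y \<equiv> \<lambda>i\<in>{1..N}. y i n"

text \<open>
  The law of the terminal state of a particle in the next generation, which depends on the
  terminal states c of the current generation only.
\<close>

definition tip_law :: "nat \<Rightarrow> (nat \<Rightarrow> 'a) \<Rightarrow> 'a measure" where
  "tip_law p c = boltzmann_gibbs (G' p) (empirical N (S' p) c) \<bind> M' (Suc p)"

lemma tips_measurable[measurable]:
  assumes [measurable]: "f \<in> measurable A (C n)"
  shows "(\<lambda>\<omega>. tips n (f \<omega>)) \<in> measurable A (T n)"
proof (rule measurable_restrict)
  fix i assume i: "i \<in> {1..N}"
  have "(\<lambda>\<omega>. f \<omega> i) \<in> measurable A (E n)"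
    using i by measurable
  from measurable_compose[OF this path_component[of n n]]
  show "(\<lambda>\<omega>. f \<omega> i n) \<in> measurable A (S' n)"
    by simp
qed

lemma tip_law_kernel: "tip_law p \<in> measurable (T p) (prob_algebra (S' (Suc p)))"
  unfolding tip_law_def by (rule resampling_kernel[OF N G'_measurable G'_pos M'_kernel])

lemma tips_kernel: "(\<lambda>c. PiM {1..N} (\<lambda>_. tip_law p c)) \<in> measurable (T p) (prob_algebra (T (Suc p)))"
  by (rule iid_kernel[OF _ tip_law_kernel]) simp

lemma tips_space: "x \<in> space (C p) \<Longrightarrow> tips p x \<in> space (T p)"
  using measurable_space[OF tips_measurable[OF measurable_ident]] by auto

lemma config_component_space: "x \<in> space (C p) \<Longrightarrow> i \<in> {1..N} \<Longrightarrow> x i \<in> space (E p)"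
  by (auto simp: space_PiM)

lemma Phi_tip:
  assumes x: "x \<in> space (C p)" and g[measurable]: "g \<in> borel_measurable (S' (Suc p))"
  shows "(\<integral>\<^sup>+y. g (y (Suc p)) \<partial>\<Phi> p x) = (\<integral>\<^sup>+v. g v \<partial>tip_law p (tips p x))"
proof -
  have t: "tips p x i \<in> space (S' p)" if "i \<in> {1..N}" for i
    using config_component_space[OF x that] that by (simp add: path_component_space)
  have "(\<integral>\<^sup>+y. g (y (Suc p)) \<partial>\<Phi> p x) = (\<Sum>i\<in>{1..N}. ennreal (path_pot G' p (x i)) * (\<integral>\<^sup>+y. g (y (Suc p)) \<partial>M (Suc p) (x i)))
      / (\<Sum>i\<in>{1..N}. ennreal (path_pot G' p (x i)))"
    by (intro nn_integral_Phi config_component_space x) measurable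
  also have "\<dots> = (\<Sum>i\<in>{1..N}. ennreal (G' p (tips p x i)) * (\<integral>\<^sup>+v. g v \<partial>M' (Suc p) (tips p x i)))
      / (\<Sum>i\<in>{1..N}. ennreal (G' p (tips p x i)))"
    using config_component_space[OF x]
    by (intro arg_cong2[where f="(/)"] sum.cong refl) (auto simp: path_pot_def nn_integral_path_trans)
  also have "\<dots> = (\<integral>\<^sup>+v. g v \<partial>tip_law p (tips p x))"
    unfolding tip_law_def by (rule nn_integral_resampling[OF N t G'_measurable G'_pos M'_kernel g, symmetric])
  finally show ?thesis .
qed

lemma tip_law_prob:
  assumes "c \<in> space (T p)"
  shows "sets (tip_law p c) = sets (S' (Suc p))" "prob_space (tip_law p c)"
  using measurable_space[OF tip_law_kernel assms] by (auto simp: space_prob_algebra)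

text \<open>
  The terminal states follow the particle model with selection by G' and mutation by M'.
\<close>

lemma Phi_tips:
  assumes x: "x \<in> space (C p)" and g: "g \<in> borel_measurable (T (Suc p))"
  shows "(\<integral>\<^sup>+y. g (tips (Suc p) y) \<partial>PiM {1..N} (\<lambda>_. \<Phi> p x)) = (\<integral>\<^sup>+u. g u \<partial>PiM {1..N} (\<lambda>_. tip_law p (tips p x)))"
proof -
  let ?A = "\<Phi> p x" and ?B = "tip_law p (tips p x)" and ?f = "\<lambda>y. y (Suc p)"
  note A = Phi_prob[OF x] and B = tip_law_prob[OF tips_space[OF x]]
  have f: "?f \<in> measurable ?A ?B"
    unfolding measurable_cong_sets[OF A(1) B(1)] by simp
  have "distr ?A ?B ?f = ?B"
  proof (rule measure_eqI)
    fix D assume "D \<in> sets (distr ?A ?B ?f)"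
    then have D: "D \<in> sets (S' (Suc p))" by (simp add: B)
    have "emeasure (distr ?A ?B ?f) D = (\<integral>\<^sup>+v. indicator D v \<partial>distr ?A ?B ?f)"
      using D B(1) by simp
    also have "\<dots> = (\<integral>\<^sup>+y. indicator D (y (Suc p)) \<partial>?A)"
      using D B(1) by (intro nn_integral_distr f borel_measurable_indicator) simp
    also have "\<dots> = (\<integral>\<^sup>+v. indicator D v \<partial>?B)"
      using D by (intro Phi_tip x) auto
    finally show "emeasure (distr ?A ?B ?f) D = emeasure ?B D"
      using D B(1) by simp
  qed simp
  moreover have "distr (PiM {1..N} (\<lambda>_. ?A)) (PiM {1..N} (\<lambda>_. ?B)) (compose {1..N} ?f) = PiM {1..N} (\<lambda>_. distr ?A ?B ?f)"
    using A(2) B(2) f by (intro distr_PiM_finite_prob_space) (auto intro: product_prob_spaceI)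
  ultimately have eq: "distr (PiM {1..N} (\<lambda>_. ?A)) (PiM {1..N} (\<lambda>_. ?B)) (compose {1..N} ?f) = PiM {1..N} (\<lambda>_. ?B)"
    by simp
  have sA: "sets (PiM {1..N} (\<lambda>_. ?A)) = sets (C (Suc p))" and sB: "sets (PiM {1..N} (\<lambda>_. ?B)) = sets (T (Suc p))"
    using A(1) B(1) by (auto intro!: sets_PiM_cong)
  have "(\<integral>\<^sup>+u. g u \<partial>PiM {1..N} (\<lambda>_. ?B)) = (\<integral>\<^sup>+y. g (compose {1..N} ?f y) \<partial>PiM {1..N} (\<lambda>_. ?A))"
  proof (subst eq[symmetric], rule nn_integral_distr)
    show "compose {1..N} ?f \<in> measurable (PiM {1..N} (\<lambda>_. ?A)) (PiM {1..N} (\<lambda>_. ?B))"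
      unfolding measurable_cong_sets[OF sA sB] compose_def using tips_measurable[OF measurable_ident] by simp
    show "g \<in> borel_measurable (distr (PiM {1..N} (\<lambda>_. ?A)) (PiM {1..N} (\<lambda>_. ?B)) (compose {1..N} ?f))"
      using g by (simp add: measurable_cong_sets[OF sB refl])
  qed
  then show ?thesis
    by (simp add: compose_def)
qed

text \<open>
  Under \<Phi> the pair of the index k of the parent and the new state a has a density proportional to H'(x_k, a).
  The parent may therefore be redrawn given a, with the conditional probabilities \<open>weight\<close>.
\<close>

lemma Phi_backward:
  assumes x: "x \<in> space (C p)" and u[measurable]: "u \<in> borel_measurable (E (Suc p))"
  shows "(\<integral>\<^sup>+v. u v \<partial>\<Phi> p x)
    = (\<integral>\<^sup>+v. (\<Sum>j\<in>{1..N}. weight p (tips p x) (tips p x j) (v (Suc p)) * u ((x j)(Suc p := v (Suc p)))) \<partial>\<Phi> p x)"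
proof -
  let ?c = "tips p x"
  have xj: "x j \<in> space (E p)" "x j p \<in> space (S' p)" "?c j = x j p" if "j \<in> {1..N}" for j
    using config_component_space[OF x that] that by (auto simp: path_component_space)
  define U where "U j a = u ((x j)(Suc p := a))" for j a
  define h where "h k a = H' (Suc p) (?c k) a" for k a
  define w where "w j a = weight p ?c (?c j) a" for j a
  have U_meas[measurable]: "U j \<in> borel_measurable (S' (Suc p))" if "j \<in> {1..N}" for j
    unfolding U_def using xj[OF that] by measurable
  have h_meas[measurable]: "h k \<in> borel_measurable (S' (Suc p))" if "k \<in> {1..N}" for k
    unfolding h_def using xj[OF that] by simp
  have w_meas[measurable]: "w j \<in> borel_measurable (S' (Suc p))" if "j \<in> {1..N}" for j
    unfolding w_def using xj that by (intro weight_measurable) auto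
  have \<nu>_meas: "borel_measurable (\<nu>' (Suc p)) = borel_measurable (S' (Suc p))"
    by (rule measurable_cong_sets[OF sets_\<nu>' refl])
  have dens: "ennreal (path_pot G' p (x k)) * (\<integral>\<^sup>+a. g a \<partial>M' (Suc p) (x k p)) = (\<integral>\<^sup>+a. h k a * g a \<partial>\<nu>' (Suc p))"
    if k: "k \<in> {1..N}" and g[measurable]: "g \<in> borel_measurable (S' (Suc p))" for k g
  proof -
    note xk = xj[OF k]
    have gm: "g \<in> borel_measurable (M' (Suc p) (x k p))"
      using g by (simp add: measurable_cong_sets[OF sets_M'[OF xk(2)] refl])
    have "ennreal (path_pot G' p (x k)) * (\<integral>\<^sup>+a. g a \<partial>M' (Suc p) (x k p))
        = (\<integral>\<^sup>+a. g a \<partial>density (M' (Suc p) (x k p)) (\<lambda>_. ennreal (G' p (x k p))))"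
      using gm by (simp add: nn_integral_density nn_integral_cmult path_pot_def)
    also have "density (M' (Suc p) (x k p)) (\<lambda>_. ennreal (G' p (x k p))) = density (\<nu>' (Suc p)) (h k)"
      using densities xk unfolding transition_densities_def h_def by simp
    also have "(\<integral>\<^sup>+a. g a \<partial>density (\<nu>' (Suc p)) (h k)) = (\<integral>\<^sup>+a. h k a * g a \<partial>\<nu>' (Suc p))"
      using h_meas[OF k] g by (intro nn_integral_density) (simp_all add: \<nu>_meas)
    finally show ?thesis .
  qed
  \<comment> \<open>\<open>sum_weight\<close> requires a finite denominator; the exceptional set is null because every H'(x_k, -) has total mass G'(x_k)\<close>
  have fin: "AE a in \<nu>' (Suc p). \<forall>k\<in>{1..N}. h k a \<noteq> \<top>"
  proof (rule AE_finite_allI)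
    fix k assume k: "k \<in> {1..N}"
    have "(\<integral>\<^sup>+a. h k a \<partial>\<nu>' (Suc p)) = ennreal (path_pot G' p (x k)) * (\<integral>\<^sup>+a. 1 \<partial>M' (Suc p) (x k p))"
      using dens[OF k, of "\<lambda>_. 1"] by simp
    also have "\<dots> \<noteq> \<infinity>"
      using prob_space_M'[OF xj(2)[OF k]] by (simp add: prob_space.emeasure_space_1)
    finally show "AE a in \<nu>' (Suc p). h k a \<noteq> \<top>"
      using h_meas[OF k] nn_integral_PInf_AE[of "h k" "\<nu>' (Suc p)"] by (simp add: \<nu>_meas)
  qed simp
  have Phi: "(\<integral>\<^sup>+v. g v \<partial>\<Phi> p x)
      = (\<integral>\<^sup>+a. (\<Sum>k\<in>{1..N}. h k a * g ((x k)(Suc p := a))) \<partial>\<nu>' (Suc p)) / (\<Sum>k\<in>{1..N}. ennreal (path_pot G' p (x k)))"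
    if g[measurable]: "g \<in> borel_measurable (E (Suc p))" for g
  proof -
    have gm: "(\<lambda>a. g ((x k)(Suc p := a))) \<in> borel_measurable (S' (Suc p))" if "k \<in> {1..N}" for k
      using xj[OF that] by measurable
    have "(\<integral>\<^sup>+v. g v \<partial>\<Phi> p x) = (\<Sum>k\<in>{1..N}. ennreal (path_pot G' p (x k)) * (\<integral>\<^sup>+y. g y \<partial>M (Suc p) (x k)))
      / (\<Sum>k\<in>{1..N}. ennreal (path_pot G' p (x k)))"
      by (intro nn_integral_Phi config_component_space x g)
    also have "(\<Sum>k\<in>{1..N}. ennreal (path_pot G' p (x k)) * (\<integral>\<^sup>+y. g y \<partial>M (Suc p) (x k)))
      = (\<Sum>k\<in>{1..N}. \<integral>\<^sup>+a. h k a * g ((x k)(Suc p := a)) \<partial>\<nu>' (Suc p))"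
      by (intro sum.cong refl) (simp only: nn_integral_path_trans[OF xj(1) g] dens[OF _ gm])
    also have "\<dots> = (\<integral>\<^sup>+a. (\<Sum>k\<in>{1..N}. h k a * g ((x k)(Suc p := a))) \<partial>\<nu>' (Suc p))"
      using h_meas gm by (intro nn_integral_sum[symmetric]) (simp add: \<nu>_meas)
    finally show ?thesis .
  qed
  let ?g = "\<lambda>v. \<Sum>j\<in>{1..N}. w j (v (Suc p)) * U j (v (Suc p))"
  have g: "?g \<in> borel_measurable (E (Suc p))"
    using w_meas U_meas by (intro borel_measurable_sum borel_measurable_times_ennreal measurable_compose[OF path_component]) auto
  have "(\<integral>\<^sup>+a. (\<Sum>k\<in>{1..N}. h k a * ?g ((x k)(Suc p := a))) \<partial>\<nu>' (Suc p)) = (\<integral>\<^sup>+a. (\<Sum>k\<in>{1..N}. h k a * u ((x k)(Suc p := a))) \<partial>\<nu>' (Suc p))"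
  proof (rule nn_integral_cong_AE, use fin in eventually_elim)
    fix a assume fin: "\<forall>k\<in>{1..N}. h k a \<noteq> \<top>"
    then have D: "(\<Sum>l\<in>{1..N}. H' (Suc p) (?c l) a) < \<top>"
      unfolding h_def by (simp add: less_top)
    have "(\<Sum>k\<in>{1..N}. h k a * ?g ((x k)(Suc p := a))) = (\<Sum>j\<in>{1..N}. (\<Sum>k\<in>{1..N}. h k a) * w j a * U j a)"
      by (simp add: sum_distrib_left sum_distrib_right mult.assoc) (rule sum.swap)
    also have "\<dots> = (\<Sum>j\<in>{1..N}. h j a * U j a)"
      unfolding h_def w_def by (intro sum.cong refl) (simp only: sum_weight[OF D])
    finally show "(\<Sum>k\<in>{1..N}. h k a * ?g ((x k)(Suc p := a))) = (\<Sum>k\<in>{1..N}. h k a * u ((x k)(Suc p := a)))"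
      by (simp add: U_def)
  qed
  then have "(\<integral>\<^sup>+v. u v \<partial>\<Phi> p x) = (\<integral>\<^sup>+v. ?g v \<partial>\<Phi> p x)"
    unfolding Phi[OF u] Phi[OF g] by simp
  then show ?thesis
    by (simp only: w_def U_def)
qed

text \<open>
  The contribution of a single parent, with path x in a generation with terminal states c, to the conditional
  expectation of the sum of g over the next generation.
\<close>

definition pull :: "nat \<Rightarrow> ((nat \<Rightarrow> 'a) \<times> (nat \<Rightarrow> 'a) \<Rightarrow> ennreal) \<Rightarrow> (nat \<Rightarrow> 'a) \<times> (nat \<Rightarrow> 'a) \<Rightarrow> ennreal" where
  "pull p g = (\<lambda>(x, c). \<integral>\<^sup>+u. (\<Sum>i\<in>{1..N}. weight p c (x p) (u i) * g (x(Suc p := u i), u)) \<partial>PiM {1..N} (\<lambda>_. tip_law p c))"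

lemma pull_integrand_measurable:
  assumes g: "g \<in> borel_measurable (E (Suc p) \<Otimes>\<^sub>M T (Suc p))"
    and [measurable]: "x \<in> measurable A (E p)" "c \<in> measurable A (T p)" "u \<in> measurable A (T (Suc p))"
  shows "(\<lambda>\<omega>. \<Sum>i\<in>{1..N}. weight p (c \<omega>) (x \<omega> p) (u \<omega> i) * g ((x \<omega>)(Suc p := u \<omega> i), u \<omega>)) \<in> borel_measurable A"
proof (intro borel_measurable_sum borel_measurable_times_ennreal weight_measurable)
  fix i assume i: "i \<in> {1..N}"
  have ui[measurable]: "(\<lambda>\<omega>. u \<omega> i) \<in> measurable A (S' (Suc p))"
    using i by measurable
  then show "(\<lambda>\<omega>. u \<omega> i) \<in> measurable A (S' (Suc p))" .
  show "(\<lambda>\<omega>. x \<omega> p) \<in> measurable A (S' p)"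
    by (rule measurable_compose[OF _ path_component]) auto
  show "(\<lambda>\<omega>. c \<omega> l) \<in> measurable A (S' p)" if "l \<in> {1..N}" for l
    using that by measurable
  have "(\<lambda>\<omega>. ((x \<omega>)(Suc p := u \<omega> i), u \<omega>)) \<in> measurable A (E (Suc p) \<Otimes>\<^sub>M T (Suc p))"
    by measurable
  from measurable_compose[OF this g]
  show "(\<lambda>\<omega>. g ((x \<omega>)(Suc p := u \<omega> i), u \<omega>)) \<in> borel_measurable A" .
qed

lemma pull_measurable:
  assumes g: "g \<in> borel_measurable (E (Suc p) \<Otimes>\<^sub>M T (Suc p))"
  shows "pull p g \<in> borel_measurable (E p \<Otimes>\<^sub>M T p)"
proof -
  have K: "(\<lambda>z. PiM {1..N} (\<lambda>_. tip_law p (snd z))) \<in> measurable (E p \<Otimes>\<^sub>M T p) (subprob_algebra (T (Suc p)))"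
    by (rule measurable_compose[OF measurable_snd measurable_prob_algebraD[OF tips_kernel]])
  show ?thesis
    unfolding pull_def split_beta'
    by (rule nn_integral_measurable_subprob_algebra2[OF _ K, unfolded split_beta'])
       (intro pull_integrand_measurable g measurable_compose[OF measurable_fst] measurable_fst measurable_snd)
qed

lemma tips_update_path: "tips (Suc p) (y(i := (x :: nat \<Rightarrow> 'a)(Suc p := v (Suc p)))) = tips (Suc p) (y(i := v))"
  by (auto simp: fun_eq_iff)

text \<open>
  The parent of each new particle is redrawn according to \<open>Phi_backward\<close>, the other particles being fixed.
  After that the integrand depends on the new generation through its terminal states only.
\<close>

lemma mean_pull:
  assumes x: "x \<in> space (C p)" and g: "g \<in> borel_measurable (E (Suc p) \<Otimes>\<^sub>M T (Suc p))"
  shows "(\<integral>\<^sup>+y. (\<Sum>i\<in>{1..N}. g (y i, tips (Suc p) y)) \<partial>PiM {1..N} (\<lambda>_. \<Phi> p x))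
    = (\<Sum>j\<in>{1..N}. pull p g (x j, tips p x))"
proof -
  let ?c = "tips p x" and ?K = "PiM {1..N} (\<lambda>_. \<Phi> p x)" and ?L = "PiM {1..N} (\<lambda>_. tip_law p (tips p x))"
  note \<Phi> = Phi_prob[OF x]
  interpret prod: product_prob_space "\<lambda>_::nat. \<Phi> p x"
    by (rule product_prob_spaceI) (rule \<Phi>)
  have c: "?c \<in> space (T p)"
    by (rule tips_space[OF x])
  have xj: "x j \<in> space (E p)" "?c j = x j p" "?c j \<in> space (S' p)" if "j \<in> {1..N}" for j
    using config_component_space[OF x that] that by (auto simp: path_component_space)
  have sPi: "sets (PiM I (\<lambda>_. \<Phi> p x)) = sets (PiM I (\<lambda>_. E (Suc p)))" for I :: "nat set"
    by (intro sets_PiM_cong \<Phi> refl)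
  have sL: "sets ?L = sets (T (Suc p))"
    by (intro sets_PiM_cong tip_law_prob c refl)
  have insI: "insert i ({1..N} - {i}) = {1..N}" if "i \<in> {1..N}" for i
    using that by auto
  have g': "(\<lambda>\<omega>. g (f \<omega>, h \<omega>)) \<in> borel_measurable A"
    if "f \<in> measurable A (E (Suc p))" "h \<in> measurable A (T (Suc p))" for f h and A :: "'z measure"
    using measurable_compose[OF measurable_Pair[OF that] g] .
  define \<psi> where "\<psi> j i u = weight p ?c (?c j) (u i) * g ((x j)(Suc p := u i), u)" for i j u
  have \<psi>: "\<psi> j i \<in> borel_measurable (T (Suc p))" if "i \<in> {1..N}" "j \<in> {1..N}" for i j
  proof -
    have ui: "(\<lambda>u. u i) \<in> measurable (T (Suc p)) (S' (Suc p))"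
      using that by measurable
    show ?thesis
      unfolding \<psi>_def
    proof (intro borel_measurable_times_ennreal weight_measurable g' ui)
      show "(\<lambda>u. (x j)(Suc p := u i)) \<in> measurable (T (Suc p)) (E (Suc p))"
        using xj[OF that(2)] ui by measurable
    qed (use xj that in auto)
  qed
  have ins: "(\<integral>\<^sup>+y. f y \<partial>?K) = (\<integral>\<^sup>+y. (\<integral>\<^sup>+v. f (y(i := v)) \<partial>\<Phi> p x) \<partial>PiM ({1..N} - {i}) (\<lambda>_. \<Phi> p x))"
    if i: "i \<in> {1..N}" and f: "f \<in> borel_measurable (C (Suc p))" for i f
    using prod.product_nn_integral_insert[of "{1..N} - {i}" i f] f
    unfolding insI[OF i] measurable_cong_sets[OF sPi refl] by simp
  have "(\<integral>\<^sup>+y. g (y i, tips (Suc p) y) \<partial>?K) = (\<integral>\<^sup>+y. (\<Sum>j\<in>{1..N}. \<psi> j i (tips (Suc p) y)) \<partial>?K)"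
    if i: "i \<in> {1..N}" for i
  proof -
    have m1: "(\<lambda>y. g (y i, tips (Suc p) y)) \<in> borel_measurable (C (Suc p))"
      using i by (intro g') measurable
    have m2: "(\<lambda>y. \<Sum>j\<in>{1..N}. \<psi> j i (tips (Suc p) y)) \<in> borel_measurable (C (Suc p))"
      by (intro borel_measurable_sum measurable_compose[OF tips_measurable[OF measurable_ident_sets[OF refl]] \<psi>] i)
    show ?thesis
      unfolding ins[OF i m1] ins[OF i m2]
    proof (rule nn_integral_cong)
      fix y assume "y \<in> space (PiM ({1..N} - {i}) (\<lambda>_. \<Phi> p x))"
      then have y: "y \<in> space (PiM ({1..N} - {i}) (\<lambda>_. E (Suc p)))"
        using sets_eq_imp_space_eq[OF sPi] by blast
      have upd: "(\<lambda>v. y(i := v)) \<in> measurable (E (Suc p)) (C (Suc p))"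
        using measurable_compose[OF measurable_Pair1'[OF y] measurable_add_dim[where I="{1..N} - {i}" and M="\<lambda>_. E (Suc p)" and i=i]]
        unfolding insI[OF i] by simp
      have "(\<integral>\<^sup>+v. g ((y(i := v)) i, tips (Suc p) (y(i := v))) \<partial>\<Phi> p x)
        = (\<integral>\<^sup>+v. (\<Sum>j\<in>{1..N}. weight p ?c (?c j) (v (Suc p)) *
            g ((y(i := (x j)(Suc p := v (Suc p)))) i, tips (Suc p) (y(i := (x j)(Suc p := v (Suc p)))))) \<partial>\<Phi> p x)"
        by (rule Phi_backward[OF x]) (use measurable_compose[OF upd m1] in simp)
      also have "\<dots> = (\<integral>\<^sup>+v. (\<Sum>j\<in>{1..N}. \<psi> j i (tips (Suc p) (y(i := v)))) \<partial>\<Phi> p x)"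
        unfolding \<psi>_def tips_update_path using i by simp
      finally show "(\<integral>\<^sup>+v. g ((y(i := v)) i, tips (Suc p) (y(i := v))) \<partial>\<Phi> p x)
        = (\<integral>\<^sup>+v. (\<Sum>j\<in>{1..N}. \<psi> j i (tips (Suc p) (y(i := v)))) \<partial>\<Phi> p x)" .
    qed
  qed
  note one = this
  have "(\<integral>\<^sup>+y. (\<Sum>i\<in>{1..N}. g (y i, tips (Suc p) y)) \<partial>?K) = (\<Sum>i\<in>{1..N}. \<integral>\<^sup>+y. g (y i, tips (Suc p) y) \<partial>?K)"
    by (intro nn_integral_sum) (unfold measurable_cong_sets[OF sPi refl], intro g', measurable)
  also have "\<dots> = (\<Sum>i\<in>{1..N}. \<integral>\<^sup>+y. (\<Sum>j\<in>{1..N}. \<psi> j i (tips (Suc p) y)) \<partial>?K)"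
    by (intro sum.cong refl one)
  also have "\<dots> = (\<Sum>i\<in>{1..N}. \<integral>\<^sup>+u. (\<Sum>j\<in>{1..N}. \<psi> j i u) \<partial>?L)"
    by (intro sum.cong refl Phi_tips[OF x] borel_measurable_sum \<psi>)
  also have "\<dots> = (\<integral>\<^sup>+u. (\<Sum>i\<in>{1..N}. \<Sum>j\<in>{1..N}. \<psi> j i u) \<partial>?L)"
    using \<psi> by (intro nn_integral_sum[symmetric] borel_measurable_sum) (simp add: measurable_cong_sets[OF sL refl])
  also have "\<dots> = (\<integral>\<^sup>+u. (\<Sum>j\<in>{1..N}. \<Sum>i\<in>{1..N}. \<psi> j i u) \<partial>?L)"
    by (intro nn_integral_cong sum.swap)
  also have "\<dots> = (\<Sum>j\<in>{1..N}. \<integral>\<^sup>+u. (\<Sum>i\<in>{1..N}. \<psi> j i u) \<partial>?L)"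
    using \<psi> by (intro nn_integral_sum borel_measurable_sum) (simp add: measurable_cong_sets[OF sL refl])
  also have "\<dots> = (\<Sum>j\<in>{1..N}. pull p g (x j, ?c))"
    unfolding pull_def \<psi>_def using xj(2) by (intro sum.cong refl) simp
  finally show ?thesis .
qed

text \<open>
  The first step of the backward recursion is the same reweighting of parents as in \<open>pull\<close>; what remains is the
  interchange of the integral over the new terminal states with the rest of the kernel.
\<close>

lemma backward_pull:
  assumes c: "\<And>k i. i \<in> {1..N} \<Longrightarrow> c k i \<in> space (S' k)" and t: "t \<in> space (T p)" "\<And>i. i \<in> {1..N} \<Longrightarrow> t i = c p i"
    and g: "g \<in> borel_measurable (E (Suc p) \<Otimes>\<^sub>M T (Suc p))"
  shows "(\<integral>\<^sup>+u. (\<Sum>i\<in>{1..N}. backward c (Suc p) (u i) (\<lambda>x. g (x, u))) \<partial>PiM {1..N} (\<lambda>_. tip_law p t))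
    = (\<Sum>j\<in>{1..N}. backward c p (c p j) (\<lambda>x. pull p g (x, t)))"
proof -
  let ?L = "PiM {1..N} (\<lambda>_. tip_law p t)"
  have sL: "sets ?L = sets (T (Suc p))"
    by (intro sets_PiM_cong tip_law_prob t refl)
  define F where "F j u x = (\<Sum>i\<in>{1..N}. weight p t (c p j) (u i) * g (x(Suc p := u i), u))" for j u x
  have wt: "weight p (c p) z v = weight p t z v" for z v
    by (rule weight_cong) (simp add: t)
  have F: "(\<lambda>u. F j u x) \<in> borel_measurable (T (Suc p))" if j: "j \<in> {1..N}" and x: "x \<in> space (E p)" for j x
    unfolding F_def
  proof (intro borel_measurable_sum borel_measurable_times_ennreal weight_measurable)
    fix i assume i: "i \<in> {1..N}"
    have ui[measurable]: "(\<lambda>u. u i) \<in> measurable (T (Suc p)) (S' (Suc p))"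
      using i by measurable
    then show "(\<lambda>u. u i) \<in> measurable (T (Suc p)) (S' (Suc p))" .
    have "(\<lambda>u. (x(Suc p := u i), u)) \<in> measurable (T (Suc p)) (E (Suc p) \<Otimes>\<^sub>M T (Suc p))"
      using x by measurable
    from measurable_compose[OF this g]
    show "(\<lambda>u. g (x(Suc p := u i), u)) \<in> borel_measurable (T (Suc p))" .
  qed (use c t j in auto)
  have swap: "(\<lambda>u. backward c p (c p j) (F j u)) \<in> borel_measurable ?L"
    "(\<integral>\<^sup>+u. backward c p (c p j) (F j u) \<partial>?L) = backward c p (c p j) (\<lambda>x. \<integral>\<^sup>+u. F j u x \<partial>?L)"
    if j: "j \<in> {1..N}" for j
  proof -
    have "(\<lambda>u. F j u x) \<in> borel_measurable ?L" if "x \<in> space (E p)" for x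
      unfolding measurable_cong_sets[OF sL refl] by (rule F[OF j that])
    from backward_swap[OF c c[OF j] this]
    show "(\<lambda>u. backward c p (c p j) (F j u)) \<in> borel_measurable ?L"
      "(\<integral>\<^sup>+u. backward c p (c p j) (F j u) \<partial>?L) = backward c p (c p j) (\<lambda>x. \<integral>\<^sup>+u. F j u x \<partial>?L)"
      by auto
  qed
  have "(\<Sum>i\<in>{1..N}. backward c (Suc p) (u i) (\<lambda>x. g (x, u))) = (\<Sum>j\<in>{1..N}. backward c p (c p j) (F j u))" for u
    unfolding F_def backward_sum backward_cmult backward.simps wt by (rule sum.swap)
  then have "(\<integral>\<^sup>+u. (\<Sum>i\<in>{1..N}. backward c (Suc p) (u i) (\<lambda>x. g (x, u))) \<partial>?L)
    = (\<Sum>j\<in>{1..N}. \<integral>\<^sup>+u. backward c p (c p j) (F j u) \<partial>?L)"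
    by (simp only: nn_integral_sum[OF swap(1)])
  also have "\<dots> = (\<Sum>j\<in>{1..N}. backward c p (c p j) (\<lambda>x. pull p g (x, t)))"
  proof (intro sum.cong refl)
    fix j assume j: "j \<in> {1..N}"
    show "(\<integral>\<^sup>+u. backward c p (c p j) (F j u) \<partial>?L) = backward c p (c p j) (\<lambda>x. pull p g (x, t))"
      unfolding swap(2)[OF j] by (rule backward_cong) (use c j in \<open>auto simp: F_def pull_def\<close>)
  qed
  finally show ?thesis .
qed

abbreviation "tip \<omega> \<equiv> \<lambda>k i. \<xi> k \<omega> i k"

text \<open>
  Letting g depend on the terminal states as well makes the induction work: \<open>pull\<close> maps this class of functions for
  generation p + 1 to that for generation p. The terminal states alone are
  allowed as further arguments, because the full paths of generation n reveal the ancestors.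
\<close>

lemma backward_identity:
  assumes "g \<in> borel_measurable (E n \<Otimes>\<^sub>M T n)"
  shows "(\<integral>\<^sup>+\<omega>. (\<Sum>i\<in>{1..N}. g (\<xi> n \<omega> i, tips n (\<xi> n \<omega>))) \<partial>P)
    = (\<integral>\<^sup>+\<omega>. (\<Sum>i\<in>{1..N}. backward (tip \<omega>) n (\<xi> n \<omega> i n) (\<lambda>x. g (x, tips n (\<xi> n \<omega>)))) \<partial>P)"
  using assms
proof (induction n arbitrary: g)
  case 0
  have "(\<lambda>k\<in>{..0}. \<xi> 0 \<omega> i 0) = \<xi> 0 \<omega> i" if "\<omega> \<in> space P" "i \<in> {1..N}" for \<omega> i
    using \<xi>_space[OF that, of 0] by (auto simp: path_space_def space_PiM PiE_def extensional_def fun_eq_iff)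
  then show ?case
    by (intro nn_integral_cong) simp
next
  case (Suc p)
  note g = Suc.prems
  have xi: "\<xi> p \<omega> \<in> space (C p)" if "\<omega> \<in> space P" for \<omega>
    using measurable_space[OF \<xi>_measurable that] .
  have comp: "(\<lambda>y. y i) \<in> measurable (C k) (E k)" if "i \<in> {1..N}" for i k
    using that by measurable
  have "(\<integral>\<^sup>+\<omega>. (\<Sum>i\<in>{1..N}. g (\<xi> (Suc p) \<omega> i, tips (Suc p) (\<xi> (Suc p) \<omega>))) \<partial>P)
    = (\<integral>\<^sup>+\<omega>. (\<integral>\<^sup>+y. (\<Sum>i\<in>{1..N}. g (y i, tips (Suc p) y)) \<partial>PiM {1..N} (\<lambda>_. \<Phi> p (\<xi> p \<omega>))) \<partial>P)"
    by (rule particle_step)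
      (intro borel_measurable_sum measurable_compose[OF measurable_Pair g] comp tips_measurable measurable_ident_sets refl)
  also have "\<dots> = (\<integral>\<^sup>+\<omega>. (\<Sum>j\<in>{1..N}. pull p g (\<xi> p \<omega> j, tips p (\<xi> p \<omega>))) \<partial>P)"
    by (intro nn_integral_cong mean_pull xi g)
  also have "\<dots> = (\<integral>\<^sup>+\<omega>. (\<Sum>j\<in>{1..N}. backward (tip \<omega>) p (\<xi> p \<omega> j p) (\<lambda>x. pull p g (x, tips p (\<xi> p \<omega>)))) \<partial>P)"
    by (rule Suc.IH[OF pull_measurable[OF g]])
  also have "\<dots> = (\<integral>\<^sup>+\<omega>. (\<integral>\<^sup>+u. (\<Sum>i\<in>{1..N}. backward (tip \<omega>) (Suc p) (u i) (\<lambda>x. g (x, u))) \<partial>PiM {1..N} (\<lambda>_. tip_law p (tips p (\<xi> p \<omega>)))) \<partial>P)"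
  proof (intro nn_integral_cong backward_pull[symmetric] g)
    fix \<omega> assume \<omega>: "\<omega> \<in> space P"
    show "tips p (\<xi> p \<omega>) \<in> space (T p)"
      by (rule tips_space[OF xi[OF \<omega>]])
    show "\<xi> k \<omega> i k \<in> space (S' k)" if "i \<in> {1..N}" for k i
      using path_component_space[OF \<xi>_space[OF \<omega> that]] by simp
  qed simp
  also have "\<dots> = (\<integral>\<^sup>+\<omega>. (\<integral>\<^sup>+y. (\<Sum>i\<in>{1..N}. backward (tip \<omega>) (Suc p) (tips (Suc p) y i) (\<lambda>x. g (x, tips (Suc p) y))) \<partial>PiM {1..N} (\<lambda>_. \<Phi> p (\<xi> p \<omega>))) \<partial>P)"
  proof (intro nn_integral_cong Phi_tips[symmetric] xi borel_measurable_sum backward_measurable)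
    fix \<omega> i assume \<omega>: "\<omega> \<in> space P" and i: "i \<in> {1..N}"
    show "(\<lambda>u. u i) \<in> measurable (T (Suc p)) (S' (Suc p))"
      using i by measurable
    show "(\<lambda>u. \<xi> k \<omega> i k) \<in> measurable (T (Suc p)) (S' k)" if "i \<in> {1..N}" for k i
      using path_component_space[OF \<xi>_space[OF \<omega> that]] by simp
    have "(\<lambda>z. (snd z, fst z)) \<in> measurable (T (Suc p) \<Otimes>\<^sub>M E (Suc p)) (E (Suc p) \<Otimes>\<^sub>M T (Suc p))"
      by measurable
    from measurable_compose[OF this g]
    show "(\<lambda>(u, x). g (x, u)) \<in> borel_measurable (T (Suc p) \<Otimes>\<^sub>M E (Suc p))"
      by (simp add: split_beta')
  qed
  also have "\<dots> = (\<integral>\<^sup>+\<omega>. (\<Sum>i\<in>{1..N}. backward (tip \<omega>) (Suc p) (\<xi> (Suc p) \<omega> i (Suc p)) (\<lambda>x. g (x, tips (Suc p) (\<xi> (Suc p) \<omega>)))) \<partial>P)"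
  proof -
    let ?h = "\<lambda>\<omega>. \<lambda>k\<in>{..p}. \<xi> k \<omega>"
    define \<phi> where "\<phi> = (\<lambda>(h :: nat \<Rightarrow> nat \<Rightarrow> nat \<Rightarrow> 'a, y). \<Sum>i\<in>{1..N}. backward (\<lambda>k i. h k i k) (Suc p) (y i (Suc p)) (\<lambda>x. g (x, tips (Suc p) y)))"
    have \<phi>: "\<phi> \<in> borel_measurable (PiM {..p} C \<Otimes>\<^sub>M C (Suc p))"
      unfolding \<phi>_def split_beta'
    proof (intro borel_measurable_sum backward_measurable)
      let ?A = "PiM {..p} C \<Otimes>\<^sub>M C (Suc p)"
      fix i assume i: "i \<in> {1..N}"
      have "(\<lambda>z. snd z i) \<in> measurable ?A (E (Suc p))"
        using i by measurable
      from measurable_compose[OF this path_component[of "Suc p" "Suc p"]]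
      show "(\<lambda>z. snd z i (Suc p)) \<in> measurable ?A (S' (Suc p))"
        by simp
      show "(\<lambda>z. fst z k i k) \<in> measurable ?A (S' k)" if "k < Suc p" "i \<in> {1..N}" for k i
      proof -
        have "(\<lambda>z. fst z k) \<in> measurable ?A (C k)"
          using that by (intro measurable_compose[OF measurable_fst measurable_component_singleton]) simp
        from measurable_compose[OF measurable_compose[OF this comp[OF that(2)]] path_component[of k k]]
        show ?thesis by simp
      qed
      have "(\<lambda>z. (snd z, tips (Suc p) (snd (fst z)))) \<in> measurable (?A \<Otimes>\<^sub>M E (Suc p)) (E (Suc p) \<Otimes>\<^sub>M T (Suc p))"
        by measurable
      from measurable_compose[OF this g]
      show "(\<lambda>(z, x). g (x, tips (Suc p) (snd z))) \<in> borel_measurable (?A \<Otimes>\<^sub>M E (Suc p))"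
        by (simp add: split_beta')
    qed
    have tip: "backward (\<lambda>k i. ?h \<omega> k i k) (Suc p) z f = backward (tip \<omega>) (Suc p) z f" for \<omega> z f
      by (rule backward_history_cong) simp
    show ?thesis
      using particle_step_history[OF \<phi>] unfolding \<phi>_def prod.case tip by simp
  qed
  finally show ?case .
qed

end

section \<open>Real-valued estimates and their expectations\<close>

text \<open>
  Put x = n r (r - 1) / N, so that k^n \<le> exp x. As 4 r (r - 1) \<le> c_2, the assumption on N yields x \<le> 1 and
  exp x \<le> 1 + 2 x \<le> 1 + c_2 n/N; as r (r - 1) \<le> c_1, also 1 - c_1 n/N \<le> exp (- x).
\<close>

lemma bias_factor_bounds:
  fixes r :: real
  assumes r: "1 \<le> r" and N: "1 \<le> N" and Nn: "c2 r * real n \<le> real N"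
  defines "k \<equiv> 1 + r * (r - 1) / real N"
  shows "k ^ n \<le> 1 + c2 r * (real n / real N)"
    and "0 \<le> 1 - c1 r * (real n / real N) \<Longrightarrow> k ^ n * (1 - c1 r * (real n / real N)) \<le> 1"
proof -
  define x where "x = real n * (r * (r - 1) / real N)"
  have N': "0 < real N" using N by simp
  have x0: "0 \<le> x"
    using r by (simp add: x_def)
  have "k ^ n \<le> exp (r * (r - 1) / real N) ^ n"
    unfolding k_def using r N' by (intro power_mono exp_ge_add_one_self add_nonneg_nonneg) auto
  then have kx: "k ^ n \<le> exp x"
    unfolding x_def exp_of_nat_mult .
  have "1 \<le> 2 * ((r + 1)\<^sup>2 * r\<^sup>2)"
  proof -
    have "1 * 1 \<le> (r + 1)\<^sup>2 * r\<^sup>2"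
      using r by (intro mult_mono) (auto intro: one_le_power)
    then show ?thesis by simp
  qed
  then have "0 \<le> 2 * (r - 1)\<^sup>2 * (2 * ((r + 1)\<^sup>2 * r\<^sup>2) - 1)"
    by (intro mult_nonneg_nonneg) auto
  also have "\<dots> = c2 r - 4 * (r * (r - 1))"
    unfolding c2_def c1_def by (simp add: power2_eq_square algebra_simps)
  finally have c2: "4 * (r * (r - 1)) \<le> c2 r"
    by simp
  have c1: "r * (r - 1) \<le> c1 r"
    using r by (simp add: c1_def power2_eq_square algebra_simps)
  have "4 * (r * (r - 1)) * (real n / real N) \<le> c2 r * (real n / real N)"
    using c2 N' by (intro mult_right_mono) auto
  then have x4: "4 * x \<le> c2 r * (real n / real N)"
    by (simp add: x_def ac_simps)
  also have "\<dots> \<le> 1"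
    using Nn N' by (simp add: field_simps)
  finally have x1: "x \<le> 1" by simp
  have "exp x \<le> 1 + x + x\<^sup>2"
    using x0 x1 by (rule exp_bound)
  also have "x\<^sup>2 \<le> x"
    using x0 x1 by (simp add: power2_eq_square mult_left_le_one_le)
  finally show "k ^ n \<le> 1 + c2 r * (real n / real N)"
    using kx x4 x0 by simp
  assume nonneg: "0 \<le> 1 - c1 r * (real n / real N)"
  have "x = r * (r - 1) * (real n / real N)"
    by (simp add: x_def)
  also have "\<dots> \<le> c1 r * (real n / real N)"
    using c1 N' by (intro mult_right_mono) auto
  finally have "1 - c1 r * (real n / real N) \<le> 1 + - x"
    by simp
  also have "\<dots> \<le> exp (- x)"
    by (rule exp_ge_add_one_self)
  finally have "k ^ n * (1 - c1 r * (real n / real N)) \<le> exp x * exp (- x)"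
    using kx nonneg by (intro mult_mono) auto
  then show "k ^ n * (1 - c1 r * (real n / real N)) \<le> 1"
    by (simp add: exp_minus)
qed

lemma c1_le_c2: "1 \<le> r \<Longrightarrow> 0 \<le> c1 r \<and> c1 r \<le> c2 r"
proof -
  assume "1 \<le> r"
  then have c: "0 \<le> c1 r"
    by (simp add: c1_def one_le_power)
  then have "0 \<le> c1 r * (4 * (c1 r * (c1 r + 1)) + 1)"
    by (intro mult_nonneg_nonneg add_nonneg_nonneg) auto
  also have "\<dots> = c2 r - c1 r"
    by (simp add: c2_def algebra_simps)
  finally show ?thesis
    using c by simp
qed

lemma integral_enn2real_diff:
  assumes [measurable]: "X \<in> borel_measurable M" "Y \<in> borel_measurable M"
    and fin: "\<And>\<omega>. \<omega> \<in> space M \<Longrightarrow> X \<omega> < \<top>" "\<And>\<omega>. \<omega> \<in> space M \<Longrightarrow> Y \<omega> < \<top>"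
    and int: "(\<integral>\<^sup>+\<omega>. X \<omega> \<partial>M) < \<top>" "(\<integral>\<^sup>+\<omega>. Y \<omega> \<partial>M) < \<top>"
  shows "integrable M (\<lambda>\<omega>. enn2real (X \<omega>) - enn2real (Y \<omega>))"
    and "(\<integral>\<omega>. enn2real (X \<omega>) - enn2real (Y \<omega>) \<partial>M) = enn2real (\<integral>\<^sup>+\<omega>. X \<omega> \<partial>M) - enn2real (\<integral>\<^sup>+\<omega>. Y \<omega> \<partial>M)"
proof -
  have X: "(\<integral>\<^sup>+\<omega>. ennreal (enn2real (X \<omega>)) \<partial>M) = (\<integral>\<^sup>+\<omega>. X \<omega> \<partial>M)"
    and Y: "(\<integral>\<^sup>+\<omega>. ennreal (enn2real (Y \<omega>)) \<partial>M) = (\<integral>\<^sup>+\<omega>. Y \<omega> \<partial>M)"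
    using fin by (auto intro!: nn_integral_cong)
  have iX: "integrable M (\<lambda>\<omega>. enn2real (X \<omega>))" and iY: "integrable M (\<lambda>\<omega>. enn2real (Y \<omega>))"
    using X Y int by (auto intro!: integrableI_nonneg)
  then show "integrable M (\<lambda>\<omega>. enn2real (X \<omega>) - enn2real (Y \<omega>))"
    by simp
  show "(\<integral>\<omega>. enn2real (X \<omega>) - enn2real (Y \<omega>) \<partial>M) = enn2real (\<integral>\<^sup>+\<omega>. X \<omega> \<partial>M) - enn2real (\<integral>\<^sup>+\<omega>. Y \<omega> \<partial>M)"
    using iX iY by (simp add: integral_eq_nn_integral X Y)
qed

context backward_particle_system
begin

text \<open>
  The two estimates for the positive part of f, with values in the extended nonnegative reals.
\<close>

definition particle_estimate :: "nat \<Rightarrow> ((nat \<Rightarrow> 'a) \<Rightarrow> real) \<Rightarrow> 'v \<Rightarrow> ennreal" where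
  "particle_estimate n f \<omega> = (\<Sum>i\<in>{1..N}. ennreal (f (\<xi> n \<omega> i))) / of_nat N"

definition backward_estimate :: "nat \<Rightarrow> ((nat \<Rightarrow> 'a) \<Rightarrow> real) \<Rightarrow> 'v \<Rightarrow> ennreal" where
  "backward_estimate n f \<omega> = (\<Sum>i\<in>{1..N}. backward (tip \<omega>) n (\<xi> n \<omega> i n) (\<lambda>x. ennreal (f x))) / of_nat N"

lemma tip_space: "\<omega> \<in> space P \<Longrightarrow> i \<in> {1..N} \<Longrightarrow> \<xi> k \<omega> i k \<in> space (S' k)"
  using path_component_space[OF \<xi>_space] by simp

lemma tip_measurable: "i \<in> {1..N} \<Longrightarrow> (\<lambda>\<omega>. \<xi> k \<omega> i k) \<in> measurable P (S' k)"
proof -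
  assume "i \<in> {1..N}"
  then have "(\<lambda>\<omega>. \<xi> k \<omega> i) \<in> measurable P (E k)"
    by measurable
  from measurable_compose[OF this path_component[of k k]] show ?thesis by simp
qed

lemma particle_estimate_measurable:
  assumes [measurable]: "f \<in> borel_measurable (E n)"
  shows "particle_estimate n f \<in> borel_measurable P"
  unfolding particle_estimate_def
  by (intro borel_measurable_divide_ennreal borel_measurable_sum) measurable

lemma backward_estimate_measurable:
  assumes f[measurable]: "f \<in> borel_measurable (E n)"
  shows "backward_estimate n f \<in> borel_measurable P"
proof -
  have "(\<lambda>(\<omega>, x). ennreal (f x)) \<in> borel_measurable (P \<Otimes>\<^sub>M E n)"
    by measurable
  then show ?thesis
    unfolding backward_estimate_def
    by (intro borel_measurable_divide_ennreal borel_measurable_sum backward_measurable tip_measurable borel_measurable_const)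
qed

lemma divide_N_finite: "x < \<top> \<Longrightarrow> x / of_nat N < (\<top>::ennreal)"
  using N unfolding ennreal_of_nat_eq_real_of_nat by (cases x) (auto simp: divide_ennreal)

lemma enn2real_mean:
  assumes "\<And>i. i \<in> {1..N} \<Longrightarrow> x i < (\<top>::ennreal)"
  shows "enn2real ((\<Sum>i\<in>{1..N}. x i) / of_nat N) = (\<Sum>i\<in>{1..N}. enn2real (x i)) / real N"
proof -
  have "(\<Sum>i\<in>{1..N}. x i) = (\<Sum>i\<in>{1..N}. ennreal (enn2real (x i)))"
    using assms by (intro sum.cong refl) auto
  also have "\<dots> = ennreal (\<Sum>i\<in>{1..N}. enn2real (x i))"
    by (intro sum_ennreal) auto
  finally show ?thesis
    unfolding ennreal_of_nat_eq_real_of_nat using N by (simp add: divide_ennreal sum_nonneg)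
qed

lemma particle_estimate_finite: "particle_estimate n f \<omega> < \<top>"
  unfolding particle_estimate_def by (rule divide_N_finite) simp

lemma backward_estimate_finite: "\<omega> \<in> space P \<Longrightarrow> backward_estimate n f \<omega> < \<top>"
  unfolding backward_estimate_def
  by (rule divide_N_finite) (auto simp: less_top[symmetric] intro!: less_imp_neq backward_finite tip_space)

lemma path_mean_eq:
  assumes \<omega>: "\<omega> \<in> space P" and f: "f \<in> borel_measurable (E n)"
  shows "path_mean S' N \<xi> n f \<omega> = enn2real (particle_estimate n f \<omega>) - enn2real (particle_estimate n (\<lambda>x. - f x) \<omega>)"
proof -
  have "path_mean S' N \<xi> n f \<omega> = (\<Sum>i\<in>{1..N}. f (\<xi> n \<omega> i)) / real N"
    unfolding path_mean_def path_empirical_def by (intro integral_empirical N \<xi>_space \<omega> f)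
  also have "\<dots> = (\<Sum>i\<in>{1..N}. enn2real (ennreal (f (\<xi> n \<omega> i))) - enn2real (ennreal (- f (\<xi> n \<omega> i)))) / real N"
  proof -
    have "v = enn2real (ennreal v) - enn2real (ennreal (- v))" for v
      by (cases "0 \<le> v") (auto simp: ennreal_neg)
    then show ?thesis by metis
  qed
  finally show ?thesis
    unfolding particle_estimate_def by (simp add: enn2real_mean sum_subtractf diff_divide_distrib)
qed

text \<open>
  The inner and the outer Bochner integral may be split into positive and negative parts, since the backward kernel has
  finite support and finite weights.
\<close>

lemma backward_mean_eq:
  assumes \<omega>: "\<omega> \<in> space P" and f[measurable]: "f \<in> borel_measurable (E n)"
  shows "backward_mean S' H' N \<xi> n f \<omega> = enn2real (backward_estimate n f \<omega>) - enn2real (backward_estimate n (\<lambda>x. - f x) \<omega>)"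
proof -
  have t: "terminal_empirical S' N \<xi> \<omega> = (\<lambda>k. empirical N (S' k) (tip \<omega> k))"
    by (simp add: terminal_empirical_def fun_eq_iff)
  let ?H = "backward_kernel S' H' (terminal_empirical S' N \<xi> \<omega>) n"
  let ?B = "\<lambda>x g. backward (tip \<omega>) n x (\<lambda>y. ennreal (g y))"
  have nn: "(\<integral>\<^sup>+y. ennreal (g y) \<partial>?H x) = ?B x g" if "x \<in> space (S' n)" and [measurable]: "g \<in> borel_measurable (E n)" for x g
    unfolding t by (intro nn_integral_backward_kernel tip_space \<omega> that) measurable
  have B_fin: "?B x g < \<top>" if "x \<in> space (S' n)" for x g
    by (intro backward_finite tip_space \<omega> that) auto
  have sH: "sets (?H x) = sets (E n)" for x
    unfolding backward_kernel_def path_space_def t by (simp, intro sets_PiM_cong) auto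
  have int: "(\<integral>y. f y \<partial>?H x) = enn2real (?B x f) - enn2real (?B x (\<lambda>y. - f y))" if x: "x \<in> space (S' n)" for x
  proof -
    have m: "f \<in> borel_measurable (?H x)"
      using f by (simp add: measurable_cong_sets[OF sH refl])
    have "integrable (?H x) f"
      using m nn[OF x, of "\<lambda>y. norm (f y)"] B_fin[OF x, of "\<lambda>y. norm (f y)"]
      by (intro integrableI_bounded) simp_all
    then show ?thesis
      by (simp add: real_lebesgue_integral_def nn[OF x])
  qed
  have B_meas: "(\<lambda>x. ?B x g) \<in> borel_measurable (S' n)" if [measurable]: "g \<in> borel_measurable (E n)" for g
  proof (rule backward_measurable)
    show "(\<lambda>(x, y). ennreal (g y)) \<in> borel_measurable (S' n \<Otimes>\<^sub>M E n)"
      by measurable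
  qed (use tip_space[OF \<omega>] in auto)
  have "(\<lambda>x. enn2real (?B x f) - enn2real (?B x (\<lambda>y. - f y))) \<in> borel_measurable (S' n)"
    using B_meas[of f] B_meas[of "\<lambda>y. - f y"] by measurable
  then have im: "(\<lambda>x. \<integral>y. f y \<partial>?H x) \<in> borel_measurable (S' n)"
    by (subst measurable_cong[OF int])
  have "backward_mean S' H' N \<xi> n f \<omega> = (\<Sum>i\<in>{1..N}. \<integral>y. f y \<partial>?H (\<xi> n \<omega> i n)) / real N"
    unfolding backward_mean_def terminal_empirical_def[of S' N \<xi> \<omega> n]
    by (intro integral_empirical N tip_space \<omega> im)
  also have "\<dots> = (\<Sum>i\<in>{1..N}. enn2real (?B (\<xi> n \<omega> i n) f) - enn2real (?B (\<xi> n \<omega> i n) (\<lambda>y. - f y))) / real N"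
    by (intro arg_cong2[where f="(/)"] sum.cong refl int tip_space \<omega>)
  also have "\<dots> = enn2real (backward_estimate n f \<omega>) - enn2real (backward_estimate n (\<lambda>x. - f x) \<omega>)"
  proof -
    have "enn2real (backward_estimate n g \<omega>) = (\<Sum>i\<in>{1..N}. enn2real (?B (\<xi> n \<omega> i n) g)) / real N" for g
      unfolding backward_estimate_def by (intro enn2real_mean B_fin tip_space \<omega>)
    then show ?thesis
      by (simp only: sum_subtractf diff_divide_distrib)
  qed
  finally show ?thesis .
qed

lemma backward_estimate_expectation:
  assumes [measurable]: "f \<in> borel_measurable (E n)"
  shows "(\<integral>\<^sup>+\<omega>. backward_estimate n f \<omega> \<partial>P) = (\<integral>\<^sup>+\<omega>. particle_estimate n f \<omega> \<partial>P)"
proof -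
  have "(\<lambda>(x, c). ennreal (f x)) \<in> borel_measurable (E n \<Otimes>\<^sub>M T n)"
    by measurable
  from backward_identity[OF this]
  have eq: "(\<integral>\<^sup>+\<omega>. (\<Sum>i\<in>{1..N}. ennreal (f (\<xi> n \<omega> i))) \<partial>P)
    = (\<integral>\<^sup>+\<omega>. (\<Sum>i\<in>{1..N}. backward (tip \<omega>) n (\<xi> n \<omega> i n) (\<lambda>x. ennreal (f x))) \<partial>P)"
    by simp
  have F: "(\<lambda>(\<omega>, x). ennreal (f x)) \<in> borel_measurable (P \<Otimes>\<^sub>M E n)"
    by measurable
  have "(\<lambda>\<omega>. \<Sum>i\<in>{1..N}. backward (tip \<omega>) n (\<xi> n \<omega> i n) (\<lambda>x. ennreal (f x))) \<in> borel_measurable P"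
    by (intro borel_measurable_sum backward_measurable tip_measurable F)
  moreover have "(\<lambda>\<omega>. \<Sum>i\<in>{1..N}. ennreal (f (\<xi> n \<omega> i))) \<in> borel_measurable P"
    by (intro borel_measurable_sum) measurable
  ultimately show ?thesis
    unfolding backward_estimate_def particle_estimate_def using eq by (simp add: nn_integral_divide)
qed

end

theorem theorem3p3:
  fixes S' :: "nat \<Rightarrow> 'a measure"
    and \<eta>0 :: "'a measure"
    and M' :: "nat \<Rightarrow> 'a \<Rightarrow> 'a measure"
    and G' :: "nat \<Rightarrow> 'a \<Rightarrow> real"
    and H' :: "nat \<Rightarrow> 'a \<Rightarrow> 'a \<Rightarrow> ennreal"
    and \<nu>' :: "nat \<Rightarrow> 'a measure"
    and PX :: "'w measure"
    and X' :: "nat \<Rightarrow> 'w \<Rightarrow> 'a"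
    and P :: "'v measure"
    and \<xi> :: "nat \<Rightarrow> 'v \<Rightarrow> nat \<Rightarrow> nat \<Rightarrow> 'a"
    and \<rho> :: "nat \<Rightarrow> real"
    and n N :: nat
  assumes model: "feynman_kac_model S' \<eta>0 M' G'"
    and chain: "markov_chain PX S' \<eta>0 M' X'"
    and densities: "transition_densities S' M' G' H' \<nu>'"
    and A1: "fk_A1 S' M' G' \<rho>"
    and N1: "N \<ge> 1"
    and particles: "particle_model P S' \<eta>0 M' G' N \<xi>"
    and N_ge: "real N \<ge> c2 (\<rho> n) * real n"
  shows "(\<forall>f :: (nat \<Rightarrow> 'a) \<Rightarrow> real.
            f \<in> borel_measurable (path_space S' n) \<and>
            (\<forall>x \<in> space (path_space S' n). 0 \<le> f x) \<and>
            (\<integral>\<^sup>+x. ennreal (f x) \<partial>fk_eta PX S' G' X' n) < \<infinity> \<longrightarrow>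
            integrable P (path_mean S' N \<xi> n f) \<and>
            integrable P (backward_mean S' H' N \<xi> n f) \<and>
            (1 - c1 (\<rho> n) * (real n / real N)) * (\<integral>x. f x \<partial>fk_eta PX S' G' X' n)
              \<le> (\<integral>\<omega>. path_mean S' N \<xi> n f \<omega> \<partial>P) \<and>
            (\<integral>\<omega>. path_mean S' N \<xi> n f \<omega> \<partial>P) = (\<integral>\<omega>. backward_mean S' H' N \<xi> n f \<omega> \<partial>P) \<and>
            (\<integral>\<omega>. backward_mean S' H' N \<xi> n f \<omega> \<partial>P)
              \<le> (1 + c2 (\<rho> n) * (real n / real N)) * (\<integral>x. f x \<partial>fk_eta PX S' G' X' n))
       \<and> (\<forall>f :: (nat \<Rightarrow> 'a) \<Rightarrow> real.
            integrable (fk_eta PX S' G' X' n) f \<longrightarrow>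
            integrable P (path_mean S' N \<xi> n f) \<and>
            integrable P (backward_mean S' H' N \<xi> n f) \<and>
            \<bar>(\<integral>\<omega>. path_mean S' N \<xi> n f \<omega> \<partial>P) - (\<integral>x. f x \<partial>fk_eta PX S' G' X' n)\<bar>
              = \<bar>(\<integral>\<omega>. backward_mean S' H' N \<xi> n f \<omega> \<partial>P) - (\<integral>x. f x \<partial>fk_eta PX S' G' X' n)\<bar> \<and>
            \<bar>(\<integral>\<omega>. backward_mean S' H' N \<xi> n f \<omega> \<partial>P) - (\<integral>x. f x \<partial>fk_eta PX S' G' X' n)\<bar>
              \<le> c2 (\<rho> n) * (real n / real N) * (\<integral>x. \<bar>f x\<bar> \<partial>fk_eta PX S' G' X' n))"
proof -
  interpret backward_particle_system S' \<eta>0 M' G' P N \<xi> H' \<nu>'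
    by standard (fact model N1 particles densities)+
  let ?\<eta> = "fk_eta PX S' G' X' n" and ?r = "\<rho> n"
  have cmp: "Q p n (\<lambda>_. 1) x \<le> ennreal ?r * Q p n (\<lambda>_. 1) y"
    if "p \<le> n" "x \<in> space (E p)" "y \<in> space (E p)" for p x y
    using A1 that unfolding fk_A1_def by blast
  obtain x where "x \<in> space (E n)"
    using path_space_nonempty[of n] by blast
  then have "1 \<le> ennreal ?r"
    using cmp[of n x x] by simp
  then have r: "1 \<le> ?r"
    by simp
  define t1 t2 k where "t1 = c1 ?r * (real n / real N)" and "t2 = c2 ?r * (real n / real N)"
    and "k = 1 + ?r * (?r - 1) / real N"
  have t: "0 \<le> t1" "t1 \<le> t2"
    using c1_le_c2[OF r] unfolding t1_def t2_def
    by (simp_all only: mult_nonneg_nonneg mult_right_mono divide_nonneg_nonneg of_nat_0_le_iff)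
  have k: "0 \<le> k"
    using r by (simp add: k_def)
  have k_bounds: "k ^ n \<le> 1 + t2" "0 \<le> 1 - t1 \<Longrightarrow> k ^ n * (1 - t1) \<le> 1"
    unfolding k_def t1_def t2_def using bias_factor_bounds[OF r N1 N_ge] by auto
  have s\<eta>: "sets ?\<eta> = sets (E n)"
    by (simp add: fk_eta_def fk_gamma_def)
  define a b where "a f = enn2real (\<integral>\<^sup>+x. ennreal (f x) \<partial>?\<eta>)"
    and "b f = enn2real (\<integral>\<^sup>+\<omega>. particle_estimate n f \<omega> \<partial>P)" for f
  have fin: "(\<integral>\<^sup>+\<omega>. particle_estimate n f \<omega> \<partial>P) < \<top>" and low: "(1 - t1) * a f \<le> b f" and up: "b f \<le> (1 + t2) * a f"
    if f[measurable]: "f \<in> borel_measurable (E n)" and int: "(\<integral>\<^sup>+x. ennreal (f x) \<partial>?\<eta>) < \<top>" for f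
  proof -
    have "(\<lambda>x. ennreal (f x)) \<in> borel_measurable (E n)"
      by measurable
    from mean_bounds[OF r this cmp chain]
    have 1: "(\<integral>\<^sup>+\<omega>. particle_estimate n f \<omega> \<partial>P) \<le> ennreal k ^ n * (\<integral>\<^sup>+x. ennreal (f x) \<partial>?\<eta>)"
      and 2: "(\<integral>\<^sup>+x. ennreal (f x) \<partial>?\<eta>) \<le> ennreal k ^ n * (\<integral>\<^sup>+\<omega>. particle_estimate n f \<omega> \<partial>P)"
      unfolding particle_estimate_def k_def by auto
    have a: "(\<integral>\<^sup>+x. ennreal (f x) \<partial>?\<eta>) = ennreal (a f)" "0 \<le> a f"
      using int by (auto simp: a_def)
    have kn: "ennreal k ^ n = ennreal (k ^ n)" "0 \<le> k ^ n"
      using k by (auto simp: ennreal_power)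
    show fin: "(\<integral>\<^sup>+\<omega>. particle_estimate n f \<omega> \<partial>P) < \<top>"
      using 1 unfolding a kn by (rule le_less_trans) (simp add: ennreal_mult_less_top)
    then have b: "(\<integral>\<^sup>+\<omega>. particle_estimate n f \<omega> \<partial>P) = ennreal (b f)" "0 \<le> b f"
      by (auto simp: b_def)
    have 1: "b f \<le> k ^ n * a f" and 2: "a f \<le> k ^ n * b f"
      using 1 2 a b kn by (simp_all flip: ennreal_mult)
    show "b f \<le> (1 + t2) * a f"
      using 1 mult_right_mono[OF k_bounds(1) a(2)] by linarith
    show "(1 - t1) * a f \<le> b f"
    proof (cases "0 \<le> 1 - t1")
      case True
      have "(1 - t1) * a f \<le> (k ^ n * (1 - t1)) * b f"
        using mult_left_mono[OF 2 True] by (simp add: ac_simps)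
      also have "\<dots> \<le> 1 * b f"
        using k_bounds(2)[OF True] b(2) by (rule mult_right_mono)
      finally show ?thesis by simp
    next
      case False
      then show ?thesis
        using a(2) b(2) mult_nonpos_nonneg[of "1 - t1" "a f"] by linarith
    qed
  qed
  have means: "integrable P (path_mean S' N \<xi> n f)" "integrable P (backward_mean S' H' N \<xi> n f)"
    "(\<integral>\<omega>. path_mean S' N \<xi> n f \<omega> \<partial>P) = b f - b (\<lambda>x. - f x)"
    "(\<integral>\<omega>. backward_mean S' H' N \<xi> n f \<omega> \<partial>P) = b f - b (\<lambda>x. - f x)"
    "(\<integral>x. f x \<partial>?\<eta>) = a f - a (\<lambda>x. - f x)"
    "(\<integral>\<^sup>+x. ennreal (f x) \<partial>?\<eta>) < \<top>" "(\<integral>\<^sup>+x. ennreal (- f x) \<partial>?\<eta>) < \<top>"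
    "f \<in> borel_measurable (E n)" "(\<lambda>x. - f x) \<in> borel_measurable (E n)"
    if int: "integrable ?\<eta> f" for f
  proof -
    show f: "f \<in> borel_measurable (E n)"
      using borel_measurable_integrable[OF int] by (simp add: measurable_cong_sets[OF s\<eta> refl])
    then show f': "(\<lambda>x. - f x) \<in> borel_measurable (E n)"
      by measurable
    show i1: "(\<integral>\<^sup>+x. ennreal (f x) \<partial>?\<eta>) < \<top>" and i2: "(\<integral>\<^sup>+x. ennreal (- f x) \<partial>?\<eta>) < \<top>"
      using int by (auto simp: real_integrable_def less_top)
    show "(\<integral>x. f x \<partial>?\<eta>) = a f - a (\<lambda>x. - f x)"
      unfolding a_def by (rule real_lebesgue_integral_def[OF int])
    note p = integral_enn2real_diff[OF particle_estimate_measurable[OF f] particle_estimate_measurable[OF f']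
        particle_estimate_finite particle_estimate_finite fin[OF f i1] fin[OF f' i2]]
    note q = integral_enn2real_diff[OF backward_estimate_measurable[OF f] backward_estimate_measurable[OF f']
        backward_estimate_finite backward_estimate_finite, unfolded backward_estimate_expectation[OF f] backward_estimate_expectation[OF f'],
        OF _ _ fin[OF f i1] fin[OF f' i2]]
    show "integrable P (path_mean S' N \<xi> n f)"
      using p(1) by (subst Bochner_Integration.integrable_cong[OF refl path_mean_eq[OF _ f]])
    show "integrable P (backward_mean S' H' N \<xi> n f)"
      using q(1) by (subst Bochner_Integration.integrable_cong[OF refl backward_mean_eq[OF _ f]])
    show "(\<integral>\<omega>. path_mean S' N \<xi> n f \<omega> \<partial>P) = b f - b (\<lambda>x. - f x)"
      using p(2) unfolding b_def by (subst Bochner_Integration.integral_cong[OF refl path_mean_eq[OF _ f]])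
    show "(\<integral>\<omega>. backward_mean S' H' N \<xi> n f \<omega> \<partial>P) = b f - b (\<lambda>x. - f x)"
      using q(2) unfolding b_def by (subst Bochner_Integration.integral_cong[OF refl backward_mean_eq[OF _ f]])
  qed
  show ?thesis
    unfolding t1_def[symmetric] t2_def[symmetric]
  proof (intro conjI allI impI; (elim conjE)?)
    fix f :: "(nat \<Rightarrow> 'a) \<Rightarrow> real"
    assume f: "f \<in> borel_measurable (E n)" "\<forall>x\<in>space (E n). 0 \<le> f x" "(\<integral>\<^sup>+x. ennreal (f x) \<partial>?\<eta>) < \<infinity>"
    have sp: "space ?\<eta> = space (E n)"
      by (rule sets_eq_imp_space_eq[OF s\<eta>])
    have int: "integrable ?\<eta> f"
      using f sp by (intro integrableI_nonneg) (auto simp: measurable_cong_sets[OF s\<eta> refl])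
    have a0: "a (\<lambda>x. - f x) = 0"
    proof -
      have "(\<integral>\<^sup>+x. ennreal (- f x) \<partial>?\<eta>) = (\<integral>\<^sup>+x. 0 \<partial>?\<eta>)"
        using f sp by (intro nn_integral_cong) (simp add: ennreal_neg)
      then show ?thesis by (simp add: a_def)
    qed
    have b0: "b (\<lambda>x. - f x) = 0"
    proof -
      have "(\<integral>\<^sup>+\<omega>. particle_estimate n (\<lambda>x. - f x) \<omega> \<partial>P) = (\<integral>\<^sup>+\<omega>. 0 \<partial>P)"
        using f(2) \<xi>_space by (intro nn_integral_cong) (simp add: particle_estimate_def ennreal_neg)
      then show ?thesis by (simp add: b_def)
    qed
    note m = means[OF int]
    show "integrable P (path_mean S' N \<xi> n f)" "integrable P (backward_mean S' H' N \<xi> n f)"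
      by (fact m)+
    show "(\<integral>\<omega>. path_mean S' N \<xi> n f \<omega> \<partial>P) = (\<integral>\<omega>. backward_mean S' H' N \<xi> n f \<omega> \<partial>P)"
      by (simp add: m)
    show "(1 - t1) * (\<integral>x. f x \<partial>?\<eta>) \<le> (\<integral>\<omega>. path_mean S' N \<xi> n f \<omega> \<partial>P)"
      using low[OF m(8,6)] by (simp add: m a0 b0)
    show "(\<integral>\<omega>. backward_mean S' H' N \<xi> n f \<omega> \<partial>P) \<le> (1 + t2) * (\<integral>x. f x \<partial>?\<eta>)"
      using up[OF m(8,6)] by (simp add: m a0 b0)
  next
    fix f :: "(nat \<Rightarrow> 'a) \<Rightarrow> real"
    assume int: "integrable ?\<eta> f"
    note m = means[OF int]
    show "integrable P (path_mean S' N \<xi> n f)" "integrable P (backward_mean S' H' N \<xi> n f)"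
      by (fact m)+
    show "\<bar>(\<integral>\<omega>. path_mean S' N \<xi> n f \<omega> \<partial>P) - (\<integral>x. f x \<partial>?\<eta>)\<bar> = \<bar>(\<integral>\<omega>. backward_mean S' H' N \<xi> n f \<omega> \<partial>P) - (\<integral>x. f x \<partial>?\<eta>)\<bar>"
      by (simp add: m)
    have dev: "\<bar>b g - a g\<bar> \<le> t2 * a g"
      if "g \<in> borel_measurable (E n)" "(\<integral>\<^sup>+x. ennreal (g x) \<partial>?\<eta>) < \<top>" for g
    proof -
      have "t1 * a g \<le> t2 * a g"
        using t by (intro mult_right_mono) (auto simp: a_def)
      then show ?thesis
        using low[OF that] up[OF that] by (simp add: algebra_simps abs_le_iff)
    qed
    have "(\<integral>x. \<bar>f x\<bar> \<partial>?\<eta>) = a f + a (\<lambda>x. - f x)"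
    proof -
      have "(\<integral>x. \<bar>f x\<bar> \<partial>?\<eta>) = enn2real (\<integral>\<^sup>+x. ennreal \<bar>f x\<bar> \<partial>?\<eta>)"
        using int by (intro integral_eq_nn_integral) auto
      also have "(\<integral>\<^sup>+x. ennreal \<bar>f x\<bar> \<partial>?\<eta>) = (\<integral>\<^sup>+x. ennreal (f x) + ennreal (- f x) \<partial>?\<eta>)"
        by (intro nn_integral_cong) (auto simp: abs_if ennreal_neg)
      also have "\<dots> = (\<integral>\<^sup>+x. ennreal (f x) \<partial>?\<eta>) + (\<integral>\<^sup>+x. ennreal (- f x) \<partial>?\<eta>)"
        using borel_measurable_integrable[OF int] by (intro nn_integral_add) auto
      finally show ?thesis
        using m(6,7) by (simp add: a_def enn2real_plus)
    qed
    then show "\<bar>(\<integral>\<omega>. backward_mean S' H' N \<xi> n f \<omega> \<partial>P) - (\<integral>x. f x \<partial>?\<eta>)\<bar> \<le> t2 * (\<integral>x. \<bar>f x\<bar> \<partial>?\<eta>)"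
      using dev[OF m(8,6)] dev[OF m(9,7)] by (simp add: m abs_le_iff algebra_simps)
  qed
qed

end
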